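(* Let $K$ be a field, $S=K[x_1,\dots,x_n]$, and let $I\subset S$ be an ideal belonging to one of the following families: (a) principal Borel ideals; (b) polymatroidal ideals satisfying the strong exchange property; (c) matroidal edge ideals. Then for all $i>0$, $$\mathrm{Ass}\,\mathrm{HS}_i(I^{i})\subset\mathrm{Ass}\,\mathrm{HS}_i(I^{i+1})\subset\mathrm{Ass}\,\mathrm{HS}_i(I^{i+2})\subset\cdots.$$
   Context: $S$ carries its standard $\mathbb{Z}^n$-grading. For a monomial ideal $J$, $\mathcal{G}(J)$ denotes its minimal set of monomial generators, and $\deg_{x_i}(u)$ is the exponent of $x_i$ in the monomial $u$. For $i\ge0$, $\mathrm{HS}_i(J)=(\mathbf{x}^{\mathbf a}:\ \mathrm{Tor}_i^S(K,J)_{\mathbf a}\neq0)$, where $\mathbf{x}^{\mathbf a}=x_1^{a_1}\cdots x_n^{a_n}$ (the zero ideal if $\mathrm{Tor}_i^S(K,J)=0$). For an ideal $L\subset S$, $\mathrm{Ass}\,L$ denotes the set of associated primes of $S/L$. Inclusions $\subset$ are not necessarily strict. (a) For a monomial $u=x_{j_1}\cdots x_{j_d}$ with $1\le j_1\le\dots\le j_d\le n$, the principal Borel ideal generated by $u$ is $B(u)=(x_{p_1}\cdots x_{p_d}:\ 1\le p_1\le\dots\le p_d\le n,\ p_s\le j_s\text{ for all }s)$. (b) A nonzero monomial ideal $I$ is polymatroidal if all elements of $\mathcal{G}(I)$ have the same degree and: for all $u,v\in\mathcal{G}(I)$ and all $i$ with $\deg_{x_i}(u)>\deg_{x_i}(v)$,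 there is $j$ with $\deg_{x_j}(u)<\deg_{x_j}(v)$ such that $x_j(u/x_i)\in\mathcal{G}(I)$. It satisfies the strong exchange property if for all $u,v\in\mathcal{G}(I)$, all $i$ with $\deg_{x_i}(u)>\deg_{x_i}(v)$ and all $j$ with $\deg_{x_j}(u)<\deg_{x_j}(v)$ one has $x_j(u/x_i)\in I$. (c) A matroidal edge ideal is an ideal $I(G)=(x_ix_j:\{i,j\}\in E(G))$, for a finite simple graph $G$ on $\{1,\dots,n\}$, which is (squarefree and) polymatroidal. *)

theory Defs
  imports Complex_Main "HOL-Library.Poly_Mapping"
begin

text \<open>
  The polynomial ring \<open>S = K[x\<^sub>1, \<dots>, x\<^sub>n]\<close> is the type below for a field \<open>'k\<close> and a finite
  linearly ordered type \<open>'n\<close> of variables: the elements of \<open>'n\<close>, in increasing order, are the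
  indices \<open>1 < \<dots> < n\<close>. A monomial is identified with its exponent vector in \<open>'n \<Rightarrow>\<^sub>0 nat\<close>, so that
  the exponent of \<open>x\<^sub>i\<close> in \<open>u\<close> is \<open>lookup u i\<close>. Ideals are subspaces of the \<open>S\<close>-module \<open>S\<close>.
\<close>

type_synonym ('n, 'k) mpoly = "('n \<Rightarrow>\<^sub>0 nat) \<Rightarrow>\<^sub>0 'k"

definition monom :: "('n \<Rightarrow>\<^sub>0 nat) \<Rightarrow> ('n, 'k::field) mpoly" where
  "monom a = Poly_Mapping.single a 1"

definition var :: "'n \<Rightarrow> ('n, 'k::field) mpoly" where
  "var i = monom (Poly_Mapping.single i 1)"

definition total_degree :: "('n::finite \<Rightarrow>\<^sub>0 nat) \<Rightarrow> nat" where
  "total_degree u = (\<Sum>i\<in>UNIV. Poly_Mapping.lookup u i)"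

abbreviation is_ideal :: "'a::comm_ring_1 set \<Rightarrow> bool" where
  "is_ideal \<equiv> module.subspace (*)"

abbreviation ideal_span :: "'a::comm_ring_1 set \<Rightarrow> 'a set" where
  "ideal_span \<equiv> module.span (*)"

definition ideal_mult :: "'a::comm_ring_1 set \<Rightarrow> 'a set \<Rightarrow> 'a set" where
  "ideal_mult I J = ideal_span {f * g |f g. f \<in> I \<and> g \<in> J}"

primrec ideal_power :: "'a::comm_ring_1 set \<Rightarrow> nat \<Rightarrow> 'a set" where
  "ideal_power I 0 = UNIV"
| "ideal_power I (Suc k) = ideal_mult I (ideal_power I k)"

definition is_prime_ideal :: "'a::comm_ring_1 set \<Rightarrow> bool" where
  "is_prime_ideal P \<longleftrightarrow>
     is_ideal P \<and> P \<noteq> UNIV \<and> (\<forall>f g. f * g \<in> P \<longrightarrow> f \<in> P \<or> g \<in> P)"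

text \<open>\<open>{g. g * f \<in> L}\<close> is the annihilator of the class of \<open>f\<close> in the module \<open>S/L\<close>.\<close>

definition Ass :: "'a::comm_ring_1 set \<Rightarrow> 'a set set" where
  "Ass L = {P. is_prime_ideal P \<and> (\<exists>f. P = {g. g * f \<in> L})}"


section \<open>Multigraded Tor and homological shift ideals\<close>

text \<open>
  A complex of multigraded free modules of finite rank
  \<open>\<cdots> \<rightarrow> P\<^sub>2 \<rightarrow> P\<^sub>1 \<rightarrow> P\<^sub>0 \<rightarrow> K\<close>, given in coordinates: \<open>P\<^sub>j\<close> has a basis of \<open>rank j\<close> elements, the
  \<open>b\<close>-th one (\<open>b < rank j\<close>) sitting in multidegree \<open>shift j b\<close>; \<open>diff j\<close> is the matrix of
  \<open>P\<^bsub>j+1\<^esub> \<rightarrow> P\<^sub>j\<close>; and \<open>aug b\<close> is the image in \<open>K\<close> of the \<open>b\<close>-th basis element of \<open>P\<^sub>0\<close>.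
\<close>

record (overloaded) ('n, 'k) free_complex =
  rank :: "nat \<Rightarrow> nat"
  shift :: "nat \<Rightarrow> nat \<Rightarrow> 'n \<Rightarrow>\<^sub>0 nat"
  diff :: "nat \<Rightarrow> nat \<Rightarrow> nat \<Rightarrow> ('n \<Rightarrow>\<^sub>0 nat) \<Rightarrow>\<^sub>0 'k"
  aug :: "nat \<Rightarrow> 'k"

definition vectors :: "nat \<Rightarrow> 'a::zero set \<Rightarrow> (nat \<Rightarrow> 'a) set" where
  "vectors r M = {v. (\<forall>b<r. v b \<in> M) \<and> (\<forall>b\<ge>r. v b = 0)}"

definition boundary_map ::
  "('n, 'k::field) free_complex \<Rightarrow> nat \<Rightarrow> (nat \<Rightarrow> ('n, 'k) mpoly) \<Rightarrow> nat \<Rightarrow> ('n, 'k) mpoly" where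
  "boundary_map P j v =
     (\<lambda>b. if b < rank P j then \<Sum>c<rank P (Suc j). diff P j b c * v c else 0)"

text \<open>
  \<open>K = S/(x\<^sub>1, \<dots>, x\<^sub>n)\<close>, so a polynomial acts on \<open>K\<close> through its constant coefficient.
\<close>

definition augmentation ::
  "('n, 'k::field) free_complex \<Rightarrow> (nat \<Rightarrow> ('n, 'k) mpoly) \<Rightarrow> 'k" where
  "augmentation P v = (\<Sum>b<rank P 0. Poly_Mapping.lookup (v b) 0 * aug P b)"

definition multigraded :: "('n, 'k::field) free_complex \<Rightarrow> bool" where
  "multigraded P \<longleftrightarrow>
     (\<forall>j. \<forall>b<rank P j. \<forall>c<rank P (Suc j). \<forall>m\<in>Poly_Mapping.keys (diff P j b c).
        m + shift P j b = shift P (Suc j) c) \<and>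
     (\<forall>b<rank P 0. aug P b \<noteq> 0 \<longrightarrow> shift P 0 b = 0)"

definition resolves_residue_field :: "('n, 'k::field) free_complex \<Rightarrow> bool" where
  "resolves_residue_field P \<longleftrightarrow>
     multigraded P \<and>
     augmentation P ` vectors (rank P 0) UNIV = UNIV \<and>
     {v \<in> vectors (rank P 0) UNIV. augmentation P v = 0} =
       boundary_map P 0 ` vectors (rank P 1) UNIV \<and>
     (\<forall>j. {v \<in> vectors (rank P (Suc j)) UNIV. boundary_map P j v = (\<lambda>_. 0)} =
       boundary_map P (Suc j) ` vectors (rank P (Suc (Suc j))) UNIV)"

text \<open>
  The complex \<open>P \<otimes>\<^sub>S J\<close> has \<open>P\<^sub>i \<otimes>\<^sub>S J = J\<^bsup>rank i\<^esup>\<close> as its \<open>i\<close>-th module, with the same matrices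
  as boundary maps.
\<close>

definition cycles ::
  "('n, 'k::field) free_complex \<Rightarrow> ('n, 'k) mpoly set \<Rightarrow> nat \<Rightarrow> (nat \<Rightarrow> ('n, 'k) mpoly) set" where
  "cycles P J i = {z \<in> vectors (rank P i) J.
     case i of 0 \<Rightarrow> True | Suc j \<Rightarrow> boundary_map P j z = (\<lambda>_. 0)}"

definition boundaries ::
  "('n, 'k::field) free_complex \<Rightarrow> ('n, 'k) mpoly set \<Rightarrow> nat \<Rightarrow> (nat \<Rightarrow> ('n, 'k) mpoly) set" where
  "boundaries P J i = boundary_map P i ` vectors (rank P (Suc i)) J"

definition homogeneous_vectors ::
  "('n, 'k::field) free_complex \<Rightarrow> nat \<Rightarrow> ('n \<Rightarrow>\<^sub>0 nat) \<Rightarrow> (nat \<Rightarrow> ('n, 'k) mpoly) set" where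
  "homogeneous_vectors P i a =
     {z. \<forall>b<rank P i. \<forall>m\<in>Poly_Mapping.keys (z b). m + shift P i b = a}"

text \<open>
  \<open>Tor\<^sub>i(K, J)\<^sub>a \<noteq> 0\<close>, where \<open>Tor\<^sub>i(K, \<^bold>\<cdot>)\<close> is computed from a multigraded free resolution of \<open>K\<close>.
  As usual the choice of the resolution does not matter; one with finite ranks and basis
  elements in multidegrees in \<open>\<nat>\<^sup>n\<close> exists (the Koszul complex), and for such a resolution all
  multidegrees of \<open>P \<otimes> J\<close> lie in \<open>\<nat>\<^sup>n\<close>.
\<close>

definition Tor_nonzero :: "nat \<Rightarrow> ('n, 'k::field) mpoly set \<Rightarrow> ('n \<Rightarrow>\<^sub>0 nat) \<Rightarrow> bool" where
  "Tor_nonzero i J a \<longleftrightarrow>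
     (\<exists>P :: ('n, 'k) free_complex. resolves_residue_field P \<and>
        \<not> cycles P J i \<inter> homogeneous_vectors P i a \<subseteq> boundaries P J i)"

definition HS :: "nat \<Rightarrow> ('n, 'k::field) mpoly set \<Rightarrow> ('n, 'k) mpoly set" where
  "HS i J = ideal_span (monom ` {a. Tor_nonzero i J a})"


section \<open>The three families of ideals\<close>

text \<open>
  The monomial \<open>x\<^bsub>j\<^sub>1\<^esub> \<cdots> x\<^bsub>j\<^sub>d\<^esub>\<close> with \<open>j\<^sub>1 \<le> \<dots> \<le> j\<^sub>d\<close> is given by the sorted list of its indices.
\<close>

definition borel_ideal :: "'n::linorder list \<Rightarrow> ('n, 'k::field) mpoly set" where
  "borel_ideal js = ideal_span {prod_list (map var ps) |ps. sorted ps \<and> list_all2 (\<le>) ps js}"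

definition principal_borel :: "('n::linorder, 'k::field) mpoly set \<Rightarrow> bool" where
  "principal_borel I \<longleftrightarrow> (\<exists>js. sorted js \<and> I = borel_ideal js)"

definition is_monomial_ideal :: "('n, 'k::field) mpoly set \<Rightarrow> bool" where
  "is_monomial_ideal I \<longleftrightarrow> (\<exists>A. I = ideal_span (monom ` A))"

definition min_gens :: "('n, 'k::field) mpoly set \<Rightarrow> ('n \<Rightarrow>\<^sub>0 nat) set" where
  "min_gens I = (THE G. ideal_span (monom ` G) = I \<and>
     (\<forall>H. H \<subset> G \<longrightarrow> ideal_span (monom ` H) \<noteq> I))"

text \<open>
  The monomial \<open>x\<^sub>j (u/x\<^sub>i)\<close>; the truncated subtraction is only meant for monomials \<open>u\<close>
  divisible by \<open>x\<^sub>i\<close>.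
\<close>

definition exchange :: "('n \<Rightarrow>\<^sub>0 nat) \<Rightarrow> 'n \<Rightarrow> 'n \<Rightarrow> ('n \<Rightarrow>\<^sub>0 nat)" where
  "exchange u i j = u - Poly_Mapping.single i 1 + Poly_Mapping.single j 1"

definition polymatroidal :: "('n::finite, 'k::field) mpoly set \<Rightarrow> bool" where
  "polymatroidal I \<longleftrightarrow>
     is_monomial_ideal I \<and> I \<noteq> {0} \<and>
     (\<forall>u\<in>min_gens I. \<forall>v\<in>min_gens I. total_degree u = total_degree v) \<and>
     (\<forall>u\<in>min_gens I. \<forall>v\<in>min_gens I. \<forall>i. Poly_Mapping.lookup u i > Poly_Mapping.lookup v i \<longrightarrow>
        (\<exists>j. Poly_Mapping.lookup u j < Poly_Mapping.lookup v j \<and> exchange u i j \<in> min_gens I))"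

definition strong_exchange :: "('n, 'k::field) mpoly set \<Rightarrow> bool" where
  "strong_exchange I \<longleftrightarrow>
     (\<forall>u\<in>min_gens I. \<forall>v\<in>min_gens I. \<forall>i j.
        Poly_Mapping.lookup u i > Poly_Mapping.lookup v i \<longrightarrow>
        Poly_Mapping.lookup u j < Poly_Mapping.lookup v j \<longrightarrow>
        monom (exchange u i j) \<in> I)"

text \<open>A simple graph on the vertex set \<open>'n\<close> is given by its edges, which are sets of two vertices.\<close>

definition simple_graph :: "'n set set \<Rightarrow> bool" where
  "simple_graph E \<longleftrightarrow> (\<forall>e\<in>E. card e = 2)"

definition edge_ideal :: "'n set set \<Rightarrow> ('n, 'k::field) mpoly set" where
  "edge_ideal E = ideal_span {var i * var j |i j. {i, j} \<in> E}"

definition matroidal_edge_ideal :: "('n::finite, 'k::field) mpoly set \<Rightarrow> bool" where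
  "matroidal_edge_ideal I \<longleftrightarrow>
     (\<exists>E. simple_graph E \<and> I = edge_ideal E) \<and> polymatroidal I"

end

theory Submission
  imports Defs
begin

text \<open>
  All three families consist of polymatroidal ideals: a principal Borel ideal is a product of ideals
  \<open>(x\<^sub>1, \<dots>, x\<^sub>j)\<close>, and products of polymatroidal ideals are polymatroidal. Let \<open>B\<close> be the set of
  exponents of the generators of \<open>I\<close>, all of degree \<open>d\<close>, and \<open>r U\<close> the maximum over \<open>b \<in> B\<close> of
  \<open>b(U) = \<Sum>\<^bsub>x\<in>U\<^esub> b\<^sub>x\<close>.

  By the Koszul complex, \<open>Tor\<^sub>i(K, I\<^sup>k)\<^sub>a\<close> is the reduced homology in degree \<open>i - 1\<close> of the complex of all
  \<open>F\<close> with \<open>x\<^sup>a/x\<^sup>F \<in> I\<^sup>k\<close>. This is the independence complex of a matroid, so the homology is nonzero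
  iff the matroid has rank \<open>i\<close> and no coloop, and this in turn holds iff \<open>a\<close> has degree \<open>k d + i\<close> and
  \<open>a(U) \<le> k r(U) + min i (|U| - 1)\<close> for all \<open>U \<noteq> {}\<close>. Let \<open>A\<^sub>k\<close> be the set of these \<open>a\<close>.

  It is enough that \<open>HS\<^sub>i(I\<^bsup>k+1\<^esup>) : I = HS\<^sub>i(I\<^sup>k)\<close> for \<open>k \<ge> i\<close>. Let \<open>f\<close> be a monomial outside \<open>HS\<^sub>i(I\<^sup>k)\<close>,
  choose \<open>a \<in> A\<^sub>k\<close> with \<open>a - f\<close> having the smallest positive part, and \<open>y\<close> with \<open>a\<^sub>y > f\<^sub>y\<close>. Let \<open>R\<close> consist
  of \<open>y\<close> and all \<open>z\<close> with \<open>a - e\<^sub>y + e\<^sub>z \<in> A\<^sub>k\<close>; then \<open>f(R) < a(R)\<close>. By uncrossing, the complement of \<open>R\<close> is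
  a disjoint union of sets \<open>U\<close> for which the inequality above is an equality. Take \<open>g \<in> B\<close> with \<open>g(R)\<close>
  minimal. Then \<open>f + g\<close> violates an inequality valid on \<open>A\<^bsub>k+1\<^esub>\<close>: if \<open>r\<close> is additive on the sets \<open>U\<close>, the
  sum of the inequalities for these sets, and otherwise, as \<open>k \<ge> i\<close>, already \<open>a(R) \<ge> (k + 1) g(R)\<close>.
\<close>

section \<open>M-convex sets of monomials\<close>

abbreviation lookup :: "('a \<Rightarrow>\<^sub>0 'b::zero) \<Rightarrow> 'a \<Rightarrow> 'b" where
  "lookup \<equiv> Poly_Mapping.lookup"

abbreviation keys :: "('a \<Rightarrow>\<^sub>0 'b::zero) \<Rightarrow> 'a set" where
  "keys \<equiv> Poly_Mapping.keys"

abbreviation single :: "'a \<Rightarrow> 'b::zero \<Rightarrow> 'a \<Rightarrow>\<^sub>0 'b" where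
  "single \<equiv> Poly_Mapping.single"

section \<open>Weights, divisibility and exchanges of exponent vectors\<close>

definition weight :: "('n \<Rightarrow>\<^sub>0 nat) \<Rightarrow> 'n set \<Rightarrow> nat" where
  "weight u T = (\<Sum>x\<in>T. lookup u x)"

definition divides :: "('n \<Rightarrow>\<^sub>0 nat) \<Rightarrow> ('n \<Rightarrow>\<^sub>0 nat) \<Rightarrow> bool" (infix "\<unlhd>" 50) where
  "u \<unlhd> v \<longleftrightarrow> (\<forall>x. lookup u x \<le> lookup v x)"

definition indicator_mon :: "'n::finite set \<Rightarrow> 'n \<Rightarrow>\<^sub>0 nat" where
  "indicator_mon F = (\<Sum>x\<in>F. single x 1)"

lemma lookup_indicator_mon [simp]: "lookup (indicator_mon F) x = of_bool (x \<in> F)"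
  unfolding indicator_mon_def lookup_sum by (simp add: lookup_single when_def)

lemma indicator_mon_empty [simp]: "indicator_mon {} = 0"
  by (simp add: indicator_mon_def)

lemma indicator_mon_insert:
  "x \<notin> F \<Longrightarrow> indicator_mon (insert x F) = single x 1 + indicator_mon F"
  by (simp add: indicator_mon_def)

lemma divides_add_right: "u \<unlhd> u + w"
  by (simp add: divides_def lookup_add)

lemma divides_iff: "u \<unlhd> v \<longleftrightarrow> (\<exists>w. v = u + w)"
proof
  assume "u \<unlhd> v"
  then have "v = u + (v - u)"
    by (intro poly_mapping_eqI) (simp add: divides_def lookup_add lookup_minus)
  then show "\<exists>w. v = u + w" ..
qed (auto simp: divides_add_right)

lemma divides_trans: "u \<unlhd> v \<Longrightarrow> v \<unlhd> w \<Longrightarrow> u \<unlhd> w"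
  unfolding divides_def using le_trans by blast

lemma divides_antisym: "u \<unlhd> v \<Longrightarrow> v \<unlhd> u \<Longrightarrow> u = v"
  unfolding divides_def by (intro poly_mapping_eqI) (simp add: antisym)

lemma divides_add_mono: "u \<unlhd> v \<Longrightarrow> u' \<unlhd> v' \<Longrightarrow> u + u' \<unlhd> v + v'"
  unfolding divides_def lookup_add by (simp add: add_mono)

lemma weight_add: "weight (u + v) T = weight u T + weight v T"
  by (simp add: weight_def lookup_add sum.distrib)

lemma weight_zero [simp]: "weight 0 T = 0"
  by (simp add: weight_def)

lemma weight_single [simp]: "weight (single (x::'n::finite) k) T = (if x \<in> T then k else 0)"
  by (simp add: weight_def lookup_single when_def)

lemma weight_empty [simp]: "weight u {} = 0"
  by (simp add: weight_def)

lemma weight_mono: "u \<unlhd> v \<Longrightarrow> weight u T \<le> weight v T"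
  unfolding weight_def divides_def by (simp add: sum_mono)

lemma weight_less_witness:
  assumes "weight u T < weight v T"
  obtains x where "x \<in> T" "lookup u x < lookup v x"
  using assms sum_mono[of T "lookup v" "lookup u"] unfolding weight_def by force

lemma weight_Compl: "weight u T + weight u (- T) = weight u (UNIV::'n::finite set)"
  unfolding weight_def using sum.subset_diff[of T UNIV "lookup u"]
  by (simp add: Compl_eq_Diff_UNIV add.commute)

lemma weight_Un_Int:
  "weight u (S \<union> T) + weight u (S \<inter> T) = weight u S + weight u (T :: 'n::finite set)"
  unfolding weight_def by (rule sum.union_inter) auto

lemma weight_indicator_mon: "weight (indicator_mon F) T = card (F \<inter> T)"
  unfolding weight_def by (simp add: of_bool_def sum.If_cases Int_commute)

lemma weight_UN_disjoint:
  fixes M :: "'n::finite set set"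
  assumes "\<And>U V. U \<in> M \<Longrightarrow> V \<in> M \<Longrightarrow> U \<noteq> V \<Longrightarrow> U \<inter> V = {}"
  shows "weight u (\<Union>M) = (\<Sum>U\<in>M. weight u U)"
  unfolding weight_def by (subst sum.Union_disjoint) (use assms in auto)

lemma divides_weight_eq:
  fixes u v :: "'n::finite \<Rightarrow>\<^sub>0 nat"
  assumes "u \<unlhd> v" "weight v UNIV \<le> weight u UNIV"
  shows "u = v"
proof (rule ccontr)
  assume "u \<noteq> v"
  then obtain x where "lookup u x \<noteq> lookup v x"
    by (metis poly_mapping_eqI)
  then have "lookup u x < lookup v x"
    using assms(1) by (simp add: divides_def order_less_le)
  then have "weight u UNIV < weight v UNIV"
    unfolding weight_def using assms(1) by (intro sum_strict_mono_ex1) (auto simp: divides_def)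
  with assms(2) show False by simp
qed

text \<open>At most one of the two truncated differences is nonzero, so this is the l1-distance. It
  decreases in the exchange arguments below.\<close>

definition mon_dist :: "('n::finite \<Rightarrow>\<^sub>0 nat) \<Rightarrow> ('n \<Rightarrow>\<^sub>0 nat) \<Rightarrow> nat" where
  "mon_dist u v = (\<Sum>x\<in>UNIV. (lookup u x - lookup v x) + (lookup v x - lookup u x))"

text \<open>The additive form is free of truncated subtraction, so that exchanges can be composed
  and weighed by cancellation.\<close>

lemma exchange_add:
  "lookup u x > 0 \<Longrightarrow> exchange u x y + single x 1 = u + single y 1"
  by (intro poly_mapping_eqI)
    (auto simp: exchange_def lookup_add lookup_minus lookup_single when_def)

lemma exchange_unique:
  assumes "w + single x 1 = u + single y 1" "x \<noteq> y"
  shows "exchange u x y = w" "lookup u x > 0"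
proof -
  have *: "lookup w z + (1 when x = z) = lookup u z + (1 when y = z)" for z
    using arg_cong[OF assms(1), of "\<lambda>w. lookup w z"] by (simp add: lookup_add lookup_single)
  have "lookup (exchange u x y) z = lookup w z" for z
    using *[of z] assms(2)
    by (cases "x = z"; cases "y = z")
      (simp_all add: exchange_def lookup_add lookup_minus lookup_single)
  then show "exchange u x y = w"
    by (rule poly_mapping_eqI)
  show "lookup u x > 0" using *[of x] assms(2) by auto
qed

lemma lookup_exchange:
  assumes "lookup u x > 0" "x \<noteq> y"
  shows "lookup (exchange u x y) z =
    (if z = x then lookup u x - 1 else if z = y then lookup u y + 1 else lookup u z)"
  using assms by (auto simp: exchange_def lookup_add lookup_minus lookup_single when_def)

lemma weight_exchange:
  fixes x :: "'n::finite"
  assumes "lookup u x > 0"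
  shows "weight (exchange u x y) T + of_bool (x \<in> T) = weight u T + of_bool (y \<in> T)"
  using arg_cong[OF exchange_add[OF assms, of y], of "\<lambda>w. weight w T"]
  by (auto simp: weight_add of_bool_def split: if_splits)

lemma mon_dist_commute: "mon_dist u v = mon_dist v u"
  by (simp add: mon_dist_def add.commute)

lemma mon_dist_exchange:
  assumes "lookup v x < lookup u x" "lookup u y < lookup v y"
  shows "mon_dist (exchange u x y) v < mon_dist u v"
proof -
  have *: "x \<noteq> y" "lookup u x > 0" using assms by auto
  show ?thesis
    unfolding mon_dist_def using assms *
    by (intro sum_strict_mono_ex1) (auto simp: lookup_exchange)
qed

text \<open>The base set of an integral polymatroid. Nonemptiness ensures that maxima of weights
  over \<open>B\<close> exist.\<close>

definition M_convex :: "nat \<Rightarrow> ('n::finite \<Rightarrow>\<^sub>0 nat) set \<Rightarrow> bool" where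
  "M_convex d B \<longleftrightarrow> B \<noteq> {} \<and> (\<forall>u\<in>B. weight u UNIV = d) \<and>
     (\<forall>u\<in>B. \<forall>v\<in>B. \<forall>x. lookup v x < lookup u x \<longrightarrow>
        (\<exists>y. lookup u y < lookup v y \<and> exchange u x y \<in> B))"

lemma M_convexD:
  assumes "M_convex d B"
  shows "B \<noteq> {}" "u \<in> B \<Longrightarrow> weight u UNIV = d"
  using assms by (auto simp: M_convex_def)

lemma M_convex_exchange:
  assumes "M_convex d B" "u \<in> B" "v \<in> B" "lookup v x < lookup u x"
  obtains y where "lookup u y < lookup v y" "exchange u x y \<in> B"
  using assms unfolding M_convex_def by blast

lemma finite_weight_le: "finite {u :: 'n::finite \<Rightarrow>\<^sub>0 nat. weight u UNIV \<le> d}"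
proof -
  have "lookup ` {u :: 'n \<Rightarrow>\<^sub>0 nat. weight u UNIV \<le> d} \<subseteq> {f. \<forall>x. f x \<in> {..d}}"
  proof (intro image_subsetI CollectI allI)
    fix u :: "'n \<Rightarrow>\<^sub>0 nat" and x
    assume "u \<in> {u. weight u UNIV \<le> d}"
    then have "weight u UNIV \<le> d" by simp
    moreover have "lookup u x \<le> weight u UNIV"
      unfolding weight_def by (intro member_le_sum) auto
    ultimately show "lookup u x \<in> {..d}" by simp
  qed
  moreover have "finite {f :: 'n \<Rightarrow> nat. \<forall>x. f x \<in> {..d}}"
    using finite_set_of_finite_funs[of "UNIV :: 'n set" "{..d}"] by simp
  ultimately have "finite (lookup ` {u :: 'n \<Rightarrow>\<^sub>0 nat. weight u UNIV \<le> d})"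
    by (rule finite_subset)
  then show ?thesis
    by (rule finite_imageD) (auto intro!: inj_onI poly_mapping_eqI)
qed

lemma M_convex_finite: "M_convex d B \<Longrightarrow> finite B"
  by (rule finite_subset[OF _ finite_weight_le[of d]]) (auto simp: M_convex_def)

text \<open>The rank function of the polymatroid with bases \<open>B\<close>; the maximum is
  meaningful because an M-convex set is finite and nonempty.\<close>

definition max_weight :: "('n::finite \<Rightarrow>\<^sub>0 nat) set \<Rightarrow> 'n set \<Rightarrow> nat" where
  "max_weight B U = Max ((\<lambda>b. weight b U) ` B)"

lemma weight_le_max_weight: "M_convex d B \<Longrightarrow> b \<in> B \<Longrightarrow> weight b U \<le> max_weight B U"
  unfolding max_weight_def by (intro Max_ge) (auto dest: M_convex_finite)

lemma max_weight_attained: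
  assumes "M_convex d B" obtains b where "b \<in> B" "weight b U = max_weight B U"
proof -
  have "max_weight B U \<in> (\<lambda>b. weight b U) ` B"
    unfolding max_weight_def using assms by (intro Max_in) (auto dest: M_convex_finite M_convexD)
  then show ?thesis using that by auto
qed

lemma max_weight_leI:
  assumes "M_convex d B" "\<And>b. b \<in> B \<Longrightarrow> weight b U \<le> m"
  shows "max_weight B U \<le> m"
  using max_weight_attained[OF assms(1), of U] assms(2) by metis

definition sumset :: "('a::plus) set \<Rightarrow> 'a set \<Rightarrow> 'a set" where
  "sumset B C = {b + c |b c. b \<in> B \<and> c \<in> C}"

lemma add_exchange_step:
  fixes a :: "'a::cancel_ab_semigroup_add"
  assumes "e + c = a + y" "a + b + x = u + c"
  shows "e + b + x = u + y"
proof -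
  have "(e + b + x) + c = (e + c) + (b + x)" by (simp only: ac_simps)
  also have "\<dots> = (a + b + x) + y" unfolding assms(1) by (simp only: ac_simps)
  also have "\<dots> = (u + y) + c" unfolding assms(2) by (simp only: ac_simps)
  finally show ?thesis by simp
qed

text \<open>
  Exchange alternately in the two summands: every step moves one of them closer to the corresponding
  summand of \<open>v\<close>, and the element \<open>c\<close> that is too large in the current sum moves on until it is one
  where \<open>u\<close> lies below \<open>v\<close>.
\<close>

lemma M_convex_sumset:
  fixes B C :: "('n::finite \<Rightarrow>\<^sub>0 nat) set"
  assumes B: "M_convex d B" and C: "M_convex e C"
  shows "M_convex (d + e) (sumset B C)"
  unfolding M_convex_def
proof (intro conjI ballI allI impI)
  show "sumset B C \<noteq> {}"
    using M_convexD(1)[OF B] M_convexD(1)[OF C] by (auto simp: sumset_def)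
  show "weight u UNIV = d + e" if "u \<in> sumset B C" for u
    using that M_convexD(2)[OF B] M_convexD(2)[OF C] by (auto simp: sumset_def weight_add)
  fix u v x
  assume u: "u \<in> sumset B C" and v: "v \<in> sumset B C" and x: "lookup v x < lookup u x"
  from v obtain v1 v2 where v12: "v = v1 + v2" "v1 \<in> B" "v2 \<in> C"
    by (auto simp: sumset_def)
  \<comment> \<open>Invariant: \<open>u1 + u2\<close> is \<open>u\<close> with \<open>x\<close>
    traded for \<open>c\<close>. The walk starts at \<open>c = x\<close> and ends once
    \<open>u\<close> lies below \<open>v\<close> at \<open>c\<close>.\<close>
  have claim: "\<exists>y. lookup u y < lookup v y \<and> exchange u x y \<in> sumset B C"
    if "u1 \<in> B" "u2 \<in> C" "u1 + u2 + single x 1 = u + single c 1" for u1 u2 c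
    using that
  proof (induction "mon_dist u1 v1 + mon_dist u2 v2" arbitrary: u1 u2 c rule: less_induct)
    case less
    show ?case
    proof (cases "lookup u c < lookup v c")
      case True
      then have "x \<noteq> c" using x by auto
      with less.prems have "exchange u x c = u1 + u2"
        by (intro exchange_unique) auto
      then show ?thesis using True less.prems by (auto simp: sumset_def intro!: exI[of _ c])
    next
      case False
      have "lookup u1 c + lookup u2 c + (1 when x = c) = lookup u c + 1"
        using arg_cong[OF less.prems(3), of "\<lambda>w. lookup w c"] by (simp add: lookup_add lookup_single)
      with False x have "lookup v1 c + lookup v2 c < lookup u1 c + lookup u2 c"
        unfolding v12 lookup_add by (cases "x = c") auto
      then consider "lookup v1 c < lookup u1 c" | "lookup v2 c < lookup u2 c"
        by linarith
      then show ?thesis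
      proof cases
        case 1
        obtain y where y: "lookup u1 y < lookup v1 y" "exchange u1 c y \<in> B"
          using M_convex_exchange[OF B less.prems(1) v12(2) 1] .
        have "exchange u1 c y + single c 1 = u1 + single y 1"
          using 1 by (intro exchange_add) auto
        then have "exchange u1 c y + u2 + single x 1 = u + single y 1"
          using less.prems(3) by (rule add_exchange_step)
        then show ?thesis
          using less.hyps[OF _ y(2) less.prems(2)] mon_dist_exchange[OF 1 y(1)] by simp
      next
        case 2
        obtain y where y: "lookup u2 y < lookup v2 y" "exchange u2 c y \<in> C"
          using M_convex_exchange[OF C less.prems(2) v12(3) 2] .
        have "exchange u2 c y + single c 1 = u2 + single y 1"
          using 2 by (intro exchange_add) auto
        then have "u1 + exchange u2 c y + single x 1 = u + single y 1"
          using add_exchange_step[of "exchange u2 c y" "single c 1" u2 "single y 1" u1 "single x 1" u]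
            less.prems(3) by (simp add: add.commute)
        then show ?thesis
          using less.hyps[OF _ less.prems(1) y(2)] mon_dist_exchange[OF 2 y(1)] by simp
      qed
    qed
  qed
  from u obtain u1 u2 where "u = u1 + u2" "u1 \<in> B" "u2 \<in> C"
    by (auto simp: sumset_def)
  then show "\<exists>y. lookup u y < lookup v y \<and> exchange u x y \<in> sumset B C"
    using claim[of u1 u2 x] by simp
qed

text \<open>Among the pairs of a base optimal on \<open>S\<close> and a base optimal on
  \<open>T\<close>, take one at minimal distance. If the first were not optimal on \<open>T\<close>,
  an exchange would bring the two closer and keep both optimal.\<close>

lemma max_weight_chain:
  assumes B: "M_convex d B" and "S \<subseteq> T"
  obtains b where "b \<in> B" "weight b S = max_weight B S" "weight b T = max_weight B T"
proof -
  define P where "P p \<longleftrightarrow> fst p \<in> B \<and> snd p \<in> B \<and>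
    weight (fst p) S = max_weight B S \<and> weight (snd p) T = max_weight B T" for p
  obtain b0 where b0: "b0 \<in> B" "weight b0 S = max_weight B S"
    using max_weight_attained[OF B] .
  obtain c0 where c0: "c0 \<in> B" "weight c0 T = max_weight B T"
    using max_weight_attained[OF B] .
  have "P (b0, c0)" using b0 c0 by (simp add: P_def)
  then obtain p where p: "P p" and p_min: "\<And>q. P q \<Longrightarrow> mon_dist (fst p) (snd p) \<le> mon_dist (fst q) (snd q)"
    using ex_has_least_nat[of P "(b0, c0)" "\<lambda>p. mon_dist (fst p) (snd p)"] by blast
  obtain b c where [simp]: "p = (b, c)" by (cases p)
  have bc: "P (b, c)" and min: "\<And>b' c'. P (b', c') \<Longrightarrow> mon_dist b c \<le> mon_dist b' c'"
    using p p_min by force+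
  have "weight b T = max_weight B T"
  proof (rule ccontr)
    assume "weight b T \<noteq> max_weight B T"
    then have "weight b T < weight c T"
      using bc weight_le_max_weight[OF B, of b T] unfolding P_def by auto
    moreover have "weight c S \<le> weight b S"
      using bc weight_le_max_weight[OF B, of c S] unfolding P_def by auto
    moreover have "weight w T = weight w (T - S) + weight w S" for w
      unfolding weight_def by (rule sum.subset_diff[OF \<open>S \<subseteq> T\<close>]) simp
    from this[of b] this[of c]
    have "weight b T = weight b (T - S) + weight b S" "weight c T = weight c (T - S) + weight c S" .
    ultimately have "weight b (T - S) < weight c (T - S)" by simp
    then obtain x where x: "x \<in> T - S" "lookup b x < lookup c x"
      by (rule weight_less_witness)
    obtain y where y: "lookup c y < lookup b y" "exchange c x y \<in> B"
      using M_convex_exchange[OF B _ _ x(2)] bc unfolding P_def by auto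
    show False
    proof (cases "y \<in> T")
      case True
      then have "weight (exchange c x y) T = max_weight B T"
        using weight_exchange[of c x y T] x bc unfolding P_def by simp
      then have "P (b, exchange c x y)" using y bc unfolding P_def by simp
      with min have "mon_dist b c \<le> mon_dist b (exchange c x y)" .
      then show False
        using mon_dist_exchange[OF x(2) y(1)] by (simp add: mon_dist_commute)
    next
      case False
      \<comment> \<open>Now \<open>y\<close> lies outside \<open>T\<close>, hence outside
        \<open>S\<close>, and removing it from \<open>b\<close> cannot lower the weight on
        \<open>S\<close>.\<close>
      obtain z where z: "lookup b z < lookup c z" "exchange b y z \<in> B"
        using M_convex_exchange[OF B _ _ y(1)] bc unfolding P_def by auto
      have "weight (exchange b y z) S \<ge> weight b S"
        using weight_exchange[of b y z S] y False \<open>S \<subseteq> T\<close> by (auto simp: of_bool_def split: if_splits)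
      then have "weight (exchange b y z) S = max_weight B S"
        using bc weight_le_max_weight[OF B z(2), of S] unfolding P_def by simp
      then have "P (exchange b y z, c)" using z bc unfolding P_def by simp
      with min have "mon_dist b c \<le> mon_dist (exchange b y z) c" .
      then show False
        using mon_dist_exchange[OF y(1) z(1)] by simp
    qed
  qed
  with bc show ?thesis using that unfolding P_def by auto
qed

text \<open>By \<open>max_weight_chain\<close> one base attains the rank on both the intersection
  and the union, and the weight of a single base is modular.\<close>

lemma max_weight_submodular:
  assumes B: "M_convex d B"
  shows "max_weight B (S \<union> T) + max_weight B (S \<inter> T) \<le> max_weight B S + max_weight B T"
proof -
  obtain b where b: "b \<in> B" "weight b (S \<inter> T) = max_weight B (S \<inter> T)"
    "weight b (S \<union> T) = max_weight B (S \<union> T)"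
    using max_weight_chain[OF B, of "S \<inter> T" "S \<union> T"] by blast
  then have "max_weight B (S \<union> T) + max_weight B (S \<inter> T) = weight b S + weight b T"
    using weight_Un_Int[of b S T] by simp
  then show ?thesis
    using weight_le_max_weight[OF B b(1), of S] weight_le_max_weight[OF B b(1), of T] by simp
qed

text \<open>Local optimality implies global optimality. An exchange of \<open>g\<close> at an
  element of \<open>R\<close> must stay inside \<open>R\<close>, so a lighter \<open>g'\<close> can
  be moved towards \<open>g\<close> by removing an element of \<open>R\<close>, which does not raise
  its weight on \<open>R\<close>.\<close>

lemma M_convex_closed_min:
  assumes B: "M_convex d B" and g: "g \<in> B" and "g' \<in> B"
    and closed: "\<And>x y. x \<in> R \<Longrightarrow> y \<notin> R \<Longrightarrow> lookup g x > 0 \<Longrightarrow> exchange g x y \<notin> B"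
  shows "weight g R \<le> weight g' R"
  using \<open>g' \<in> B\<close>
proof (induction "mon_dist g' g" arbitrary: g' rule: less_induct)
  case less
  show ?case
  proof (rule ccontr)
    assume "\<not> weight g R \<le> weight g' R"
    then have lt: "weight g' R < weight g R" by simp
    then obtain x where x: "x \<in> R" "lookup g' x < lookup g x"
      by (rule weight_less_witness)
    obtain y where y: "lookup g y < lookup g' y" "exchange g x y \<in> B"
      using M_convex_exchange[OF B g less.prems x(2)] .
    with closed x have "y \<in> R" by fastforce
    obtain z where z: "lookup g' z < lookup g z" "exchange g' y z \<in> B"
      using M_convex_exchange[OF B less.prems g y(1)] .
    have "weight g R \<le> weight (exchange g' y z) R"
      using less.hyps[OF mon_dist_exchange[OF y(1) z(1)] z(2)] .
    also have "\<dots> \<le> weight g' R"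
      using weight_exchange[of g' y z R] y \<open>y \<in> R\<close> by (auto simp: of_bool_def split: if_splits)
    finally show False using lt by simp
  qed
qed

text \<open>Compare \<open>exchange g y z\<close> with \<open>exchange g x y\<close> at
  \<open>x\<close>: the only coordinate where the former is smaller is \<open>y\<close>, and trading
  \<open>x\<close> for \<open>y\<close> in it yields \<open>exchange g x z\<close>.\<close>

lemma M_convex_exchange_trans:
  assumes B: "M_convex d B" and xy: "exchange g x y \<in> B" and yz: "exchange g y z \<in> B"
    and gx: "lookup g x > 0" and gy: "lookup g y > 0" and ne: "x \<noteq> y" "y \<noteq> z" "x \<noteq> z"
  shows "exchange g x z \<in> B"
proof -
  let ?u = "exchange g x y" and ?v = "exchange g y z"
  have l: "lookup ?u w = (if w = x then lookup g x - 1 else if w = y then lookup g y + 1 else lookup g w)"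
    "lookup ?v w = (if w = y then lookup g y - 1 else if w = z then lookup g z + 1 else lookup g w)" for w
    using lookup_exchange[OF gx ne(1)] lookup_exchange[OF gy ne(2)] by auto
  have "lookup ?u x < lookup ?v x"
    using l[of x] gx ne by simp
  then obtain w where w: "lookup ?v w < lookup ?u w" "exchange ?v x w \<in> B"
    using M_convex_exchange[OF B yz xy] by blast
  then have "w = y"
    using l[of w] by (auto split: if_splits)
  moreover have "exchange ?v x y = exchange g x z"
    by (intro poly_mapping_eqI) (use l[of x] gx gy ne in \<open>simp add: lookup_exchange\<close>)
  ultimately show ?thesis using w by simp
qed

text \<open>Take a base \<open>g\<close> with the least excess over \<open>f\<close>. If it exceeds
  \<open>f\<close> at \<open>y\<close>, the elements for which \<open>y\<close> can be traded form a
  set \<open>R\<close> on which \<open>g\<close> has the least weight of all bases, and the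
  inequality for \<open>R\<close> fails. The criterion turns membership in a polymatroidal ideal
  into rank inequalities.\<close>

lemma M_convex_divides_iff:
  assumes B: "M_convex d B"
  shows "(\<exists>b\<in>B. b \<unlhd> f) \<longleftrightarrow> (\<forall>T. d \<le> weight f T + max_weight B (- T))"
proof
  assume "\<exists>b\<in>B. b \<unlhd> f"
  then obtain b where b: "b \<in> B" "b \<unlhd> f" by auto
  show "\<forall>T. d \<le> weight f T + max_weight B (- T)"
  proof
    fix T
    have "d = weight b T + weight b (- T)"
      using M_convexD(2)[OF B b(1)] by (simp add: weight_Compl)
    also have "\<dots> \<le> weight f T + max_weight B (- T)"
      using weight_mono[OF b(2)] weight_le_max_weight[OF B b(1)] by (rule add_mono)
    finally show "d \<le> weight f T + max_weight B (- T)" .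
  qed
next
  assume f: "\<forall>T. d \<le> weight f T + max_weight B (- T)"
  define e where "e g = (\<Sum>x\<in>UNIV. lookup g x - lookup f x)" for g
  obtain g where g: "g \<in> B" "\<And>g'. g' \<in> B \<Longrightarrow> e g \<le> e g'"
    using M_convexD(1)[OF B] ex_has_least_nat[of "\<lambda>g. g \<in> B" _ e] by blast
  have "g \<unlhd> f"
  proof (rule ccontr)
    assume "\<not> g \<unlhd> f"
    then obtain y where y: "lookup f y < lookup g y" by (auto simp: divides_def not_le)
    define R where "R = {z. z = y \<or> exchange g y z \<in> B}"
    have le: "lookup f z \<le> lookup g z" if "z \<in> R" for z
    proof (rule ccontr)
      assume *: "\<not> lookup f z \<le> lookup g z"
      then have "z \<noteq> y" using y by auto
      then have "exchange g y z \<in> B" using that by (simp add: R_def)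
      moreover have "e (exchange g y z) < e g"
        unfolding e_def using y * \<open>z \<noteq> y\<close> by (intro sum_strict_mono_ex1) (auto simp: lookup_exchange)
      ultimately show False using g(2) by fastforce
    qed
    have "weight f R < weight g R"
      unfolding weight_def using le y by (intro sum_strict_mono_ex1) (auto simp: R_def)
    moreover obtain b where b: "b \<in> B" "weight b (- R) = max_weight B (- R)"
      using max_weight_attained[OF B] by blast
    moreover have "weight g R \<le> weight b R"
    proof (rule M_convex_closed_min[OF B g(1) b(1)])
      fix x z assume "x \<in> R" "z \<notin> R" "lookup g x > 0"
      then show "exchange g x z \<notin> B"
        using M_convex_exchange_trans[OF B, of g y x z] y unfolding R_def by auto
    qed
    ultimately show False
      using f[rule_format, of R] M_convexD(2)[OF B b(1)] weight_Compl[of b R] by simp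
  qed
  with g(1) show "\<exists>b\<in>B. b \<unlhd> f" ..
qed

section \<open>Homology of matroid complexes\<close>

definition matroid :: "'n set set \<Rightarrow> bool" where
  "matroid \<Delta> \<longleftrightarrow> {} \<in> \<Delta> \<and> (\<forall>F\<in>\<Delta>. \<forall>G\<subseteq>F. G \<in> \<Delta>) \<and>
     (\<forall>F\<in>\<Delta>. \<forall>G\<in>\<Delta>. card F < card G \<longrightarrow> (\<exists>x\<in>G - F. insert x F \<in> \<Delta>))"

lemma matroidD:
  assumes "matroid \<Delta>"
  shows "{} \<in> \<Delta>" "F \<in> \<Delta> \<Longrightarrow> G \<subseteq> F \<Longrightarrow> G \<in> \<Delta>"
    "F \<in> \<Delta> \<Longrightarrow> G \<in> \<Delta> \<Longrightarrow> card F < card G \<Longrightarrow> \<exists>x\<in>G - F. insert x F \<in> \<Delta>"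
  using assms unfolding matroid_def by blast+

lemma matroid_extend:
  fixes \<Delta> :: "'n::finite set set"
  assumes m: "matroid \<Delta>" and "F \<in> \<Delta>" and G: "G \<in> \<Delta>"
  obtains H where "H \<in> \<Delta>" "F \<subseteq> H" "H \<subseteq> F \<union> G" "card G \<le> card H"
proof -
  have "\<exists>H\<in>\<Delta>. F \<subseteq> H \<and> H \<subseteq> F \<union> G \<and> card G \<le> card H"
    using \<open>F \<in> \<Delta>\<close>
  proof (induction "card G - card F" arbitrary: F)
    case 0
    then show ?case by (intro bexI[of _ F]) auto
  next
    case (Suc n)
    then have "card F < card G" by simp
    then obtain x where x: "x \<in> G - F" "insert x F \<in> \<Delta>"
      using matroidD(3)[OF m Suc.prems G] by auto
    then have "n = card G - card (insert x F)" using Suc.hyps(2) by simp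
    from Suc.hyps(1)[OF this x(2)] show ?case using x by blast
  qed
  then show ?thesis using that by blast
qed

text \<open>Extending \<open>F\<close> by elements of \<open>G\<close> gives a set as large as
  \<open>G\<close> that contains \<open>F\<close> and therefore not \<open>x\<close>. A set that
  \<open>x\<close> does not extend thus witnesses that \<open>x\<close> is no coloop.\<close>

lemma matroid_avoiding:
  fixes \<Delta> :: "'n::finite set set"
  assumes m: "matroid \<Delta>" and F: "F \<in> \<Delta>" "insert x F \<notin> \<Delta>" and G: "G \<in> \<Delta>"
  obtains H where "H \<in> \<Delta>" "x \<notin> H" "card G \<le> card H"
proof -
  obtain H where "H \<in> \<Delta>" "F \<subseteq> H" "card G \<le> card H"
    using matroid_extend[OF m F(1) G] by metis
  moreover from this have "x \<notin> H" using F(2) matroidD(2)[OF m, of H "insert x F"] by auto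
  ultimately show ?thesis using that by blast
qed

definition deletion :: "'n set set \<Rightarrow> 'n \<Rightarrow> 'n set set" where
  "deletion \<Delta> x = {F \<in> \<Delta>. x \<notin> F}"

definition link :: "'n set set \<Rightarrow> 'n \<Rightarrow> 'n set set" where
  "link \<Delta> x = {F. x \<notin> F \<and> insert x F \<in> \<Delta>}"

lemma matroid_deletion: "matroid \<Delta> \<Longrightarrow> matroid (deletion \<Delta> x)"
  unfolding matroid_def deletion_def by (auto 0 3 simp: subset_iff)

lemma matroid_link:
  fixes \<Delta> :: "'n::finite set set"
  assumes m: "matroid \<Delta>" and x: "{x} \<in> \<Delta>"
  shows "matroid (link \<Delta> x)"
  unfolding matroid_def
proof (intro conjI ballI allI impI)
  show "{} \<in> link \<Delta> x" using x by (simp add: link_def)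
next
  fix F G assume "F \<in> link \<Delta> x" "G \<subseteq> F"
  then show "G \<in> link \<Delta> x"
    using matroidD(2)[OF m, of "insert x F" "insert x G"] by (auto simp: link_def)
next
  fix F G assume *: "F \<in> link \<Delta> x" "G \<in> link \<Delta> x" "card F < card G"
  then have "card (insert x F) < card (insert x G)" by (simp add: link_def)
  with * obtain y where "y \<in> insert x G - insert x F" "insert y (insert x F) \<in> \<Delta>"
    using matroidD(3)[OF m, of "insert x F" "insert x G"] by (auto simp: link_def)
  with * show "\<exists>y\<in>G - F. insert y F \<in> link \<Delta> x"
    by (intro bexI[of _ y]) (auto simp: link_def insert_commute)
qed

section \<open>Oriented chains, the boundary operator and cones\<close>

definition sgn_at :: "'n::linorder \<Rightarrow> 'n set \<Rightarrow> 'k::comm_ring_1" where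
  "sgn_at x G = (-1) ^ card {y\<in>G. y < x}"

lemma sgn_at_square [simp]: "sgn_at x G * sgn_at x G = 1"
  unfolding sgn_at_def by (simp flip: power_add mult_2 add: power_mult)

lemma sgn_at_neq_0 [simp]: "sgn_at x G \<noteq> (0 :: 'k::field)"
  by (simp add: sgn_at_def)

lemma sgn_at_insert:
  fixes x :: "'n::{finite,linorder}"
  assumes "y \<notin> G"
  shows "sgn_at x (insert y G) = (if y < x then - sgn_at x G else sgn_at x G)"
proof -
  have "{z \<in> insert y G. z < x} =
      (if y < x then insert y {z \<in> G. z < x} else {z \<in> G. z < x})" by auto
  then show ?thesis using assms by (simp add: sgn_at_def)
qed

lemma sgn_at_anticommute:
  fixes x y :: "'n::{finite,linorder}"
  assumes "x \<notin> G" "y \<notin> G" "x \<noteq> y"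
  shows "sgn_at y (insert x G) * sgn_at x (insert y G) = - (sgn_at x G * sgn_at y G)"
    "sgn_at x G * sgn_at y (insert x G) = - (sgn_at y G * sgn_at x (insert y G))"
  using assms by (auto simp: sgn_at_insert mult.commute not_less)

text \<open>The simplicial boundary, read off at each face \<open>G\<close>. The empty set counts as
  a face, so the homology is reduced.\<close>

definition bd :: "('n::{finite,linorder} set \<Rightarrow> 'k::field) \<Rightarrow> 'n set \<Rightarrow> 'k" where
  "bd c G = (\<Sum>x\<in>-G. sgn_at x G * c (insert x G))"

definition cone :: "'n::{finite,linorder} \<Rightarrow> ('n set \<Rightarrow> 'k::field) \<Rightarrow> 'n set \<Rightarrow> 'k" where
  "cone x c F = (if x \<in> F then sgn_at x (F - {x}) * c (F - {x}) else 0)"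

lemma bd_diff: "bd (\<lambda>F. c F - e F) G = bd c G - bd e G"
  by (simp add: bd_def algebra_simps sum_subtractf)

lemma bd_add: "bd (\<lambda>F. c F + e F) G = bd c G + bd e G"
  by (simp add: bd_def algebra_simps sum.distrib)

lemma bd_zero [simp]: "bd (\<lambda>F. 0) G = 0"
  by (simp add: bd_def)

lemma cone_zero [simp]: "cone x (\<lambda>F. 0) = (\<lambda>F. 0)"
  by (auto simp: cone_def)

lemma bd_bd: "bd (bd c) G = 0"
proof -
  define t where "t x y = sgn_at x G * sgn_at y (insert x G) * c (insert y (insert x G))" for x y
  have "bd (bd c) G = (\<Sum>x\<in>-G. \<Sum>y\<in>-G - {x}. t x y)"
    unfolding bd_def t_def
    by (simp add: sum_distrib_left mult.assoc Compl_insert cong: sum.cong)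
  also have "\<dots> = (\<Sum>x\<in>-G. \<Sum>y\<in>-G. if x < y then t x y else 0) +
      (\<Sum>x\<in>-G. \<Sum>y\<in>-G. if y < x then t x y else 0)"
  proof -
    have "(\<Sum>y\<in>-G - {x}. t x y) =
        (\<Sum>y\<in>-G. if x < y then t x y else 0) + (\<Sum>y\<in>-G. if y < x then t x y else 0)" for x
      unfolding sum.distrib[symmetric]
      by (rule sum.mono_neutral_cong_left) auto
    then show ?thesis by (simp add: sum.distrib)
  qed
  also have "(\<Sum>x\<in>-G. \<Sum>y\<in>-G. if y < x then t x y else 0) =
      (\<Sum>x\<in>-G. \<Sum>y\<in>-G. if x < y then t y x else 0)"
    by (rule sum.swap)
  also have "\<dots> = - (\<Sum>x\<in>-G. \<Sum>y\<in>-G. if x < y then t x y else 0)"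
    unfolding sum_negf[symmetric]
    by (intro sum.cong refl) (auto simp: t_def sgn_at_insert insert_commute)
  finally show ?thesis by simp
qed

text \<open>The homotopy identity for the cone with apex \<open>x\<close>. If \<open>x\<close> is
  outside \<open>G\<close>, only \<open>insert x G\<close> contributes. Otherwise the signs of
  \<open>x\<close> and \<open>y\<close> anticommute, which gives \<open>- cone x (bd c) G\<close>
  except for the term of \<open>bd c\<close> belonging to \<open>x\<close> itself; that term
  supplies \<open>c G\<close>.\<close>

lemma bd_cone:
  fixes c :: "'n::{finite,linorder} set \<Rightarrow> 'k::field"
  shows "bd (cone x c) G = c G - cone x (bd c) G"
proof (cases "x \<in> G")
  case False
  have "bd (cone x c) G = (\<Sum>y\<in>-G. if y = x then sgn_at x G * (sgn_at x G * c G) else 0)"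
    unfolding bd_def cone_def using False by (intro sum.cong refl) auto
  also have "\<dots> = c G" using False by simp
  finally show ?thesis using False by (simp add: cone_def)
next
  case True
  define H where "H = G - {x}"
  have G: "G = insert x H" "x \<notin> H" "- H = insert x (- G)" using True by (auto simp: H_def)
  have "bd (cone x c) G = (\<Sum>y\<in>-G. sgn_at y (insert x H) * (sgn_at x (insert y H) * c (insert y H)))"
    unfolding bd_def
  proof (intro sum.cong refl)
    fix y assume "y \<in> - G"
    then have "x \<in> insert y G" "insert y G - {x} = insert y H" using True by (auto simp: H_def)
    then show "sgn_at y G * cone x c (insert y G) =
        sgn_at y (insert x H) * (sgn_at x (insert y H) * c (insert y H))"
      by (simp add: cone_def G(1)[symmetric])
  qed
  also have "\<dots> = - (\<Sum>y\<in>-G. sgn_at x H * (sgn_at y H * c (insert y H)))"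
    unfolding sum_negf[symmetric]
  proof (intro sum.cong refl)
    fix y assume "y \<in> - G"
    then have "y \<notin> H" "x \<noteq> y" using G by auto
    then have "sgn_at y (insert x H) * sgn_at x (insert y H) = - (sgn_at x H * sgn_at y H :: 'k)"
      using G(2) by (intro sgn_at_anticommute(1)) auto
    then show "sgn_at y (insert x H) * (sgn_at x (insert y H) * c (insert y H)) =
        - (sgn_at x H * (sgn_at y H * c (insert y H)))"
      by (simp flip: mult.assoc)
  qed
  also have "\<dots> = c G - sgn_at x H * bd c H"
  proof -
    have "x \<notin> - G" using True by simp
    then have "bd c H = sgn_at x H * c G + (\<Sum>y\<in>-G. sgn_at y H * c (insert y H))"
      unfolding bd_def G(3) by (simp add: G(1)[symmetric])
    then show ?thesis by (simp add: distrib_left sum_distrib_left)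
  qed
  finally show ?thesis using True by (simp add: cone_def H_def)
qed

text \<open>Chains are graded by cardinality, one more than the dimension, so that the degree
  matches the index of Tor.\<close>

definition simplicial_chains :: "'n set set \<Rightarrow> nat \<Rightarrow> ('n set \<Rightarrow> 'k::zero) set" where
  "simplicial_chains \<Delta> i = {c. \<forall>F. c F \<noteq> 0 \<longrightarrow> F \<in> \<Delta> \<and> card F = i}"

text \<open>The coefficient field cannot be read off from \<open>\<Delta>\<close> and
  \<open>i\<close>, so it is passed as a type. The condition is the vanishing of reduced homology in
  dimension \<open>i - 1\<close>.\<close>

definition acyclic_at ::
  "'k::field itself \<Rightarrow> 'n::{finite,linorder} set set \<Rightarrow> nat \<Rightarrow> bool" where
  "acyclic_at K \<Delta> i \<longleftrightarrow>
     (\<forall>c \<in> simplicial_chains \<Delta> i. bd c = (\<lambda>_. 0) \<longrightarrow> (\<exists>e \<in> simplicial_chains \<Delta> (Suc i). (bd e :: _ \<Rightarrow> 'k) = c))"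

lemma simplicial_chains_diff:
  fixes c e :: "'n set \<Rightarrow> 'k::field"
  assumes "c \<in> simplicial_chains \<Delta> i" "e \<in> simplicial_chains \<Delta> i"
  shows "(\<lambda>F. c F - e F) \<in> simplicial_chains \<Delta> i"
  unfolding simplicial_chains_def
proof (intro CollectI allI impI)
  fix F assume "c F - e F \<noteq> 0"
  then have "c F \<noteq> 0 \<or> e F \<noteq> 0" by auto
  with assms show "F \<in> \<Delta> \<and> card F = i" by (auto simp: simplicial_chains_def)
qed

lemma simplicial_chains_deletion:
  "c \<in> simplicial_chains (deletion \<Delta> x) i \<Longrightarrow> c \<in> simplicial_chains \<Delta> i"
  by (auto simp: simplicial_chains_def deletion_def)

lemma cone_in_simplicial_chains:
  fixes c :: "'n::{finite,linorder} set \<Rightarrow> 'k::field"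
  assumes "c \<in> simplicial_chains \<Delta> i" "\<And>F. F \<in> \<Delta> \<Longrightarrow> x \<notin> F \<Longrightarrow> insert x F \<in> \<Delta>'"
  shows "cone x c \<in> simplicial_chains \<Delta>' (Suc i)"
  unfolding simplicial_chains_def
proof (intro CollectI allI impI)
  fix F assume "cone x c F \<noteq> 0"
  then have x: "x \<in> F" and c: "c (F - {x}) \<noteq> 0" by (auto simp: cone_def split: if_splits)
  from c assms(1) have F: "F - {x} \<in> \<Delta>" and card: "card (F - {x}) = i"
    unfolding simplicial_chains_def by blast+
  have "insert x (F - {x}) \<in> \<Delta>'"
    using assms(2)[OF F] by blast
  then show "F \<in> \<Delta>' \<and> card F = Suc i"
    using x card card_Suc_Diff1[of F x] by (simp only: insert_Diff finite)
qed

text \<open>Coning with apex \<open>x\<close> stays inside the complex, so \<open>bd_cone\<close>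
  makes every cycle a boundary.\<close>

lemma acyclic_at_coloop:
  assumes "\<And>F. F \<in> \<Delta> \<Longrightarrow> insert x F \<in> \<Delta>"
  shows "acyclic_at TYPE('k::field) \<Delta> i"
  unfolding acyclic_at_def
proof (intro ballI impI)
  fix c :: "_ \<Rightarrow> 'k" assume "c \<in> simplicial_chains \<Delta> i" "bd c = (\<lambda>_. 0)"
  then show "\<exists>e\<in>simplicial_chains \<Delta> (Suc i). bd e = c"
    using assms by (intro bexI[of _ "cone x c"]) (auto simp: bd_cone intro!: cone_in_simplicial_chains)
qed

text \<open>Induction on the number of vertices through deletion and link of \<open>x\<close>, a
  Mayer-Vietoris argument by hand. The part of a cycle on faces through \<open>x\<close> is removed
  by the boundary of a cone over a link chain; what remains lives in the deletion, whose rank is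
  large enough unless \<open>x\<close> is a coloop.\<close>

lemma matroid_acyclic_below_rank:
  fixes \<Delta> :: "'n::{finite,linorder} set set"
  assumes "matroid \<Delta>" "G \<in> \<Delta>" "i < card G"
  shows "acyclic_at TYPE('k::field) \<Delta> i"
  using assms
proof (induction "card (\<Union>\<Delta>)" arbitrary: \<Delta> G i rule: less_induct)
  case less
  note m = less.prems(1)
  obtain x where x: "x \<in> G" using less.prems(3) by fastforce
  have x\<Delta>: "{x} \<in> \<Delta>" using matroidD(2)[OF m less.prems(2), of "{x}"] x by simp
  have smaller: "card (\<Union>\<Delta>') < card (\<Union>\<Delta>)" if "\<Delta>' = deletion \<Delta> x \<or> \<Delta>' = link \<Delta> x" for \<Delta>'
  proof -
    have "x \<in> \<Union>\<Delta>" using x less.prems(2) by auto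
    moreover have "x \<notin> \<Union>\<Delta>'" using that by (auto simp: deletion_def link_def)
    moreover have "\<Union>\<Delta>' \<subseteq> \<Union>\<Delta>" using that by (auto simp: deletion_def link_def)
    ultimately show ?thesis by (intro psubset_card_mono) auto
  qed
  show ?case
  proof (cases "\<forall>F\<in>\<Delta>. insert x F \<in> \<Delta>")
    case True
    then show ?thesis by (intro acyclic_at_coloop) auto
  next
    case False
    then obtain F where "F \<in> \<Delta>" "insert x F \<notin> \<Delta>" by auto
    then obtain H where H: "H \<in> \<Delta>" "x \<notin> H" "card G \<le> card H"
      using matroid_avoiding[OF m _ _ less.prems(2)] by metis
    have del: "acyclic_at TYPE('k) (deletion \<Delta> x) i"
      by (rule less.hyps[of _ H])
        (use H less.prems smaller matroid_deletion[OF m] in \<open>auto simp: deletion_def\<close>)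
    show ?thesis
      unfolding acyclic_at_def
    proof (intro ballI impI)
      fix c :: "_ \<Rightarrow> 'k" assume c: "c \<in> simplicial_chains \<Delta> i" "bd c = (\<lambda>_. 0)"
      \<comment> \<open>The link part of \<open>c\<close>, signed so that \<open>cone x c1\<close>
        agrees with \<open>c\<close> on the faces containing \<open>x\<close>.\<close>
      define c1 where "c1 F = (if x \<in> F then 0 else sgn_at x F * c (insert x F))" for F
      have c_cone: "c F = cone x c1 F" if "x \<in> F" for F
        using that by (simp add: cone_def c1_def insert_absorb)
      have c1: "c1 F = 0 \<or> F \<in> link \<Delta> x \<and> Suc (card F) = i" for F
        using c(1) by (auto simp: c1_def simplicial_chains_def link_def)
      have "\<exists>e1. (\<forall>F. e1 F = 0 \<or> F \<in> link \<Delta> x \<and> card F = i) \<and> bd e1 = c1"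
      proof (cases i)
        case 0
        with c1 have "c1 = (\<lambda>_. 0)" by auto
        then show ?thesis by (intro exI[of _ "\<lambda>_. 0"]) auto
      next
        case (Suc j)
        have "acyclic_at TYPE('k) (link \<Delta> x) j"
        proof (rule less.hyps[of _ "G - {x}"])
          show "G - {x} \<in> link \<Delta> x" using x less.prems(2) by (simp add: link_def insert_absorb)
          show "j < card (G - {x})" using x Suc less.prems(3) by simp
        qed (use smaller matroid_link[OF m x\<Delta>] in auto)
        moreover have "c1 \<in> simplicial_chains (link \<Delta> x) j"
          using c1 Suc by (auto simp: simplicial_chains_def)
        moreover have "bd c1 = (\<lambda>_. 0)"
        proof
          fix F
          show "bd c1 F = 0"
          proof (cases "x \<in> F")
            case True
            then show ?thesis by (simp add: bd_def c1_def)
          next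
            case False
            have "bd c1 F = (\<Sum>y\<in>- insert x F. sgn_at y F * (sgn_at x (insert y F) * c (insert y (insert x F))))"
              unfolding bd_def using False
              by (intro sum.mono_neutral_cong_right) (auto simp: c1_def insert_commute)
            also have "\<dots> = (\<Sum>y\<in>- insert x F. - (sgn_at x F * (sgn_at y (insert x F) * c (insert y (insert x F)))))"
            proof (intro sum.cong refl)
              fix y assume "y \<in> - insert x F"
              then have "sgn_at y F * sgn_at x (insert y F) = - (sgn_at x F * sgn_at y (insert x F) :: 'k)"
                using False by (intro sgn_at_anticommute(2)) auto
              then show "sgn_at y F * (sgn_at x (insert y F) * c (insert y (insert x F))) =
                  - (sgn_at x F * (sgn_at y (insert x F) * c (insert y (insert x F))))"
                by (simp flip: mult.assoc)
            qed
            also have "\<dots> = - (sgn_at x F * bd c (insert x F))"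
              by (simp add: bd_def sum_distrib_left sum_negf)
            finally show ?thesis using c(2) by simp
          qed
        qed
        ultimately obtain e1 where "e1 \<in> simplicial_chains (link \<Delta> x) i" "bd e1 = c1"
          unfolding acyclic_at_def Suc by blast
        then show ?thesis by (intro exI[of _ e1]) (auto simp: simplicial_chains_def)
      qed
      then obtain e1 where e1: "\<And>F. e1 F = 0 \<or> F \<in> link \<Delta> x \<and> card F = i" "bd e1 = c1" by auto
      have ce1: "cone x e1 \<in> simplicial_chains \<Delta> (Suc i)"
        by (rule cone_in_simplicial_chains[of _ "link \<Delta> x"]) (use e1 in \<open>auto simp: simplicial_chains_def link_def\<close>)
      \<comment> \<open>By \<open>bd_cone\<close> the correction is \<open>e1 - cone x c1\<close>,
        which cancels \<open>c\<close> on all faces containing \<open>x\<close>.\<close>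
      define c' where "c' = (\<lambda>F. c F + bd (cone x e1) F)"
      have c'_eq: "c' F = c F + (e1 F - cone x c1 F)" for F
        by (simp add: c'_def bd_cone e1(2))
      have "c' \<in> simplicial_chains (deletion \<Delta> x) i"
        unfolding simplicial_chains_def
      proof (intro CollectI allI impI)
        fix F assume F: "c' F \<noteq> 0"
        show "F \<in> deletion \<Delta> x \<and> card F = i"
        proof (cases "x \<in> F")
          case True
          then have "e1 F = 0" using e1(1)[of F] by (auto simp: link_def)
          with True F show ?thesis by (simp add: c'_eq c_cone)
        next
          case False
          with F have "c F \<noteq> 0 \<or> e1 F \<noteq> 0" by (auto simp: c'_eq cone_def)
          moreover have "F \<in> \<Delta>" if "F \<in> link \<Delta> x"
            using that matroidD(2)[OF m, of "insert x F" F] by (auto simp: link_def)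
          ultimately show ?thesis using c(1) e1(1)[of F] False
            by (auto simp: simplicial_chains_def deletion_def)
        qed
      qed
      moreover have "bd c' = (\<lambda>_. 0)"
      proof
        fix F show "bd c' F = 0"
          unfolding c'_def bd_add using c(2) by (simp add: bd_bd)
      qed
      ultimately obtain e2 where e2: "e2 \<in> simplicial_chains (deletion \<Delta> x) (Suc i)" "bd e2 = c'"
        using del unfolding acyclic_at_def by blast
      show "\<exists>e\<in>simplicial_chains \<Delta> (Suc i). bd e = c"
      proof (intro bexI[of _ "\<lambda>F. e2 F - cone x e1 F"])
        show "bd (\<lambda>F. e2 F - cone x e1 F) = c"
          by (rule ext) (simp add: bd_diff e2(2) c'_def)
        show "(\<lambda>F. e2 F - cone x e1 F) \<in> simplicial_chains \<Delta> (Suc i)"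
          using e2(1) ce1 by (intro simplicial_chains_diff) (rule simplicial_chains_deletion)
      qed
    qed
  qed
qed

text \<open>Induction on the rank. A nonzero top cycle \<open>c1\<close> of the link bounds in the
  deletion, which keeps full rank because \<open>x\<close> is no coloop. The chain it bounds, minus
  the cone over \<open>c1\<close>, is a cycle, and it is nonzero on some face through
  \<open>x\<close>.\<close>

lemma matroid_top_cycle:
  fixes \<Delta> :: "'n::{finite,linorder} set set"
  assumes "matroid \<Delta>" "\<And>F. F \<in> \<Delta> \<Longrightarrow> card F \<le> i" "G \<in> \<Delta>" "card G = i"
    "\<And>x. \<exists>F\<in>\<Delta>. insert x F \<notin> \<Delta>"
  obtains c :: "'n set \<Rightarrow> 'k::field" where "c \<in> simplicial_chains \<Delta> i" "bd c = (\<lambda>_. 0)" "c \<noteq> (\<lambda>_. 0)"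
proof -
  have "\<exists>c :: 'n set \<Rightarrow> 'k. c \<in> simplicial_chains \<Delta> i \<and> bd c = (\<lambda>_. 0) \<and> c \<noteq> (\<lambda>_. 0)"
    using assms
  proof (induction i arbitrary: \<Delta> G)
    case 0
    define c :: "'n set \<Rightarrow> 'k" where "c F = of_bool (F = {})" for F
    have "c \<in> simplicial_chains \<Delta> 0" using matroidD(1)[OF 0(1)] by (auto simp: c_def simplicial_chains_def)
    moreover have "bd c = (\<lambda>_. 0)" by (rule ext) (simp add: c_def bd_def)
    moreover have "c \<noteq> (\<lambda>_. 0)" by (metis c_def of_bool_eq(2) zero_neq_one)
    ultimately show ?case by blast
  next
    case (Suc i)
    note m = Suc.prems(1)
    obtain x where x: "x \<in> G" using Suc.prems(4) by fastforce
    have x\<Delta>: "{x} \<in> \<Delta>" using matroidD(2)[OF m Suc.prems(3), of "{x}"] x by simp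
    have avoid: "\<exists>H\<in>\<Delta>. y \<notin> H \<and> card H = Suc i" for y
    proof -
      obtain F where F: "F \<in> \<Delta>" "insert y F \<notin> \<Delta>" using Suc.prems(5) by blast
      obtain H where "H \<in> \<Delta>" "y \<notin> H" "card G \<le> card H"
        using matroid_avoiding[OF m F Suc.prems(3)] .
      with Suc.prems(2)[of H] Suc.prems(4) show ?thesis by auto
    qed
    have "\<exists>c :: 'n set \<Rightarrow> 'k. c \<in> simplicial_chains (link \<Delta> x) i \<and> bd c = (\<lambda>_. 0) \<and> c \<noteq> (\<lambda>_. 0)"
    proof (rule Suc.IH[of _ "G - {x}"])
      show "matroid (link \<Delta> x)" by (rule matroid_link[OF m x\<Delta>])
      show "card F \<le> i" if "F \<in> link \<Delta> x" for F
        using that Suc.prems(2)[of "insert x F"] by (simp add: link_def)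
      show "G - {x} \<in> link \<Delta> x" using x Suc.prems(3) by (simp add: link_def insert_absorb)
      show "card (G - {x}) = i" using x Suc.prems(4) by simp
      show "\<exists>F\<in>link \<Delta> x. insert y F \<notin> link \<Delta> x" for y
      proof (cases "y = x")
        case True
        then show ?thesis using x\<Delta> by (intro bexI[of _ "{}"]) (auto simp: link_def)
      next
        case False
        obtain H where H: "H \<in> \<Delta>" "y \<notin> H" "card H = Suc i" using avoid by blast
        \<comment> \<open>A base through \<open>x\<close> that avoids \<open>y\<close>; it shows
          that \<open>y\<close> is no coloop of the link.\<close>
        obtain H' where H': "H' \<in> \<Delta>" "x \<in> H'" "H' \<subseteq> {x} \<union> H" "card H \<le> card H'"
          using matroid_extend[OF m x\<Delta> H(1)] by blast
        have "y \<notin> H'" using H' H(2) False by auto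
        then have "insert y H' \<notin> \<Delta>"
          using Suc.prems(2)[of "insert y H'"] H' H(3) by auto
        moreover have "insert x (insert y (H' - {x})) = insert y H'" using H' by auto
        ultimately show ?thesis using H'
          by (intro bexI[of _ "H' - {x}"]) (auto simp: link_def insert_absorb)
      qed
    qed
    then obtain c1 :: "'n set \<Rightarrow> 'k" where c1: "c1 \<in> simplicial_chains (link \<Delta> x) i" "bd c1 = (\<lambda>_. 0)"
      "c1 \<noteq> (\<lambda>_. 0)" by blast
    obtain H where H: "H \<in> \<Delta>" "x \<notin> H" "card H = Suc i" using avoid by blast
    have "acyclic_at TYPE('k) (deletion \<Delta> x) i"
      by (rule matroid_acyclic_below_rank[OF matroid_deletion[OF m], of H])
        (use H in \<open>auto simp: deletion_def\<close>)
    moreover have "c1 \<in> simplicial_chains (deletion \<Delta> x) i"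
      using c1(1) matroidD(2)[OF m] by (fastforce simp: simplicial_chains_def deletion_def link_def)
    ultimately obtain e where e: "e \<in> simplicial_chains (deletion \<Delta> x) (Suc i)" "bd e = c1"
      using c1(2) unfolding acyclic_at_def by blast
    define c where "c = (\<lambda>F. e F - cone x c1 F)"
    have cone_c1: "cone x c1 \<in> simplicial_chains \<Delta> (Suc i)"
      by (rule cone_in_simplicial_chains[OF c1(1)]) (simp add: link_def)
    have "c \<in> simplicial_chains \<Delta> (Suc i)"
      unfolding c_def using e(1) cone_c1
      by (intro simplicial_chains_diff) (rule simplicial_chains_deletion)
    moreover have "bd c = (\<lambda>_. 0)"
      by (rule ext) (simp add: c_def bd_diff e(2) bd_cone c1(2))
    moreover have "c \<noteq> (\<lambda>_. 0)"
    proof -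
      obtain F where F: "c1 F \<noteq> 0" using c1(3) by auto
      then have "x \<notin> F" using c1(1) by (auto simp: simplicial_chains_def link_def)
      moreover have "e (insert x F) = 0" using e(1) by (auto simp: simplicial_chains_def deletion_def)
      ultimately have "c (insert x F) \<noteq> 0" using F by (simp add: c_def cone_def)
      then show ?thesis by metis
    qed
    ultimately show ?case by blast
  qed
  then show ?thesis using that by blast
qed

section \<open>Multidegrees of syzygies of polymatroidal ideals\<close>

text \<open>These are the bases of the uniform matroid of rank \<open>i\<close> on \<open>X\<close>:
  any element of \<open>G - F\<close> can be brought in.\<close>

lemma M_convex_indicator_mons:
  assumes "i \<le> card X"
  shows "M_convex i (indicator_mon ` {F. F \<subseteq> (X::'n::finite set) \<and> card F = i})"
  unfolding M_convex_def
proof (intro conjI ballI allI impI)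
  show "indicator_mon ` {F. F \<subseteq> X \<and> card F = i} \<noteq> {}"
    using obtain_subset_with_card_n[OF assms] by auto
  show "weight u UNIV = i" if "u \<in> indicator_mon ` {F. F \<subseteq> X \<and> card F = i}" for u
    using that by (auto simp: weight_indicator_mon)
  fix u v x
  assume "u \<in> indicator_mon ` {F. F \<subseteq> X \<and> card F = i}"
    "v \<in> indicator_mon ` {F. F \<subseteq> X \<and> card F = i}" and lt: "lookup v x < lookup u x"
  then obtain F G where FG: "u = indicator_mon F" "v = indicator_mon G" "F \<subseteq> X" "G \<subseteq> X"
    "card F = i" "card G = i" by auto
  with lt have x: "x \<in> F" "x \<notin> G" by (auto simp: of_bool_def split: if_splits)
  have "\<not> G \<subseteq> F" using x FG card_subset_eq[of F G] by auto
  then obtain y where y: "y \<in> G" "y \<notin> F" by auto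
  have "exchange u x y = indicator_mon (insert y (F - {x}))"
  proof (rule poly_mapping_eqI)
    have "x \<noteq> y" "lookup u x > 0" using x y FG by auto
    then show "lookup (exchange u x y) z = lookup (indicator_mon (insert y (F - {x}))) z" for z
      using x y FG by (auto simp: lookup_exchange)
  qed
  moreover have "card (insert y (F - {x})) = i"
    using x y FG card_Suc_Diff1[of F x] by simp
  ultimately show "\<exists>y. lookup u y < lookup v y \<and>
      exchange u x y \<in> indicator_mon ` {F. F \<subseteq> X \<and> card F = i}"
    using y FG by (intro exI[of _ y]) auto
qed

text \<open>
  The sets \<open>F\<close> with \<open>a - F \<in> B\<close> are the bases of a matroid; the condition says that it has rank \<open>i\<close> and
  no coloop.
\<close>

definition syzygy_degrees :: "nat \<Rightarrow> ('n::finite \<Rightarrow>\<^sub>0 nat) set \<Rightarrow> ('n \<Rightarrow>\<^sub>0 nat) set" where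
  "syzygy_degrees i B =
     {a. \<forall>x. \<exists>F. \<exists>b\<in>B. x \<notin> F \<and> card F = i \<and> a = b + indicator_mon F}"

text \<open>For fixed \<open>x\<close>, the condition says that \<open>a\<close> lies in the sum of
  \<open>B\<close> and the bases of the uniform matroid of rank \<open>i\<close> on the complement
  of \<open>x\<close>. This sum is M-convex, so membership amounts to rank inequalities; those with
  \<open>x\<close> in \<open>U\<close> are the sharpest, whence \<open>card U - 1\<close>.\<close>

lemma syzygy_degrees_iff:
  fixes B :: "('n::finite \<Rightarrow>\<^sub>0 nat) set"
  assumes B: "M_convex d B"
  shows "a \<in> syzygy_degrees i B \<longleftrightarrow> weight a UNIV = d + i \<and>
    (\<forall>U. U \<noteq> {} \<longrightarrow> weight a U \<le> max_weight B U + min i (card U - 1))"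
proof (intro iffI conjI allI impI)
  assume a: "a \<in> syzygy_degrees i B"
  then show "weight a UNIV = d + i"
    using M_convexD(2)[OF B] by (auto simp: syzygy_degrees_def weight_add weight_indicator_mon)
  fix U :: "'n set" assume "U \<noteq> {}"
  then obtain x where "x \<in> U" by blast
  obtain F b where F: "b \<in> B" "x \<notin> F" "card F = i" "a = b + indicator_mon F"
    using a unfolding syzygy_degrees_def by blast
  have "card (F \<inter> U) \<le> card (U - {x})" using F by (intro card_mono) auto
  moreover have "card (F \<inter> U) \<le> i" using F card_mono[of F "F \<inter> U"] by auto
  ultimately show "weight a U \<le> max_weight B U + min i (card U - 1)"
    using weight_le_max_weight[OF B F(1), of U] \<open>x \<in> U\<close>
    by (simp add: F weight_add weight_indicator_mon)
next
  assume *: "weight a UNIV = d + i \<and>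
    (\<forall>U. U \<noteq> {} \<longrightarrow> weight a U \<le> max_weight B U + min i (card U - 1))"
  have max_UNIV: "max_weight B UNIV = d"
    using max_weight_attained[OF B, of UNIV] M_convexD(2)[OF B] by metis
  show "a \<in> syzygy_degrees i B"
    unfolding syzygy_degrees_def
  proof (intro CollectI allI)
    fix x :: 'n
    let ?I = "indicator_mon ` {F. F \<subseteq> - {x} \<and> card F = i}"
    \<comment> \<open>The inequality for \<open>UNIV\<close> provides \<open>i\<close> elements
      other than \<open>x\<close>, so that the uniform matroid has rank \<open>i\<close>.\<close>
    have "d + i \<le> d + min i (card (UNIV :: 'n set) - 1)"
      using * max_UNIV by (metis UNIV_not_empty)
    then have i: "i \<le> card (- {x})" by (simp add: Compl_eq_Diff_UNIV)
    have I: "M_convex (d + i) (sumset B ?I)"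
      by (intro M_convex_sumset B M_convex_indicator_mons i)
    have "d + i \<le> weight a T + max_weight (sumset B ?I) (- T)" for T
    proof (cases "T = UNIV")
      case True
      then show ?thesis using * by simp
    next
      case False
      define U where "U = - T"
      have U: "U \<noteq> {}" using False by (auto simp: U_def)
      \<comment> \<open>\<open>F\<close> avoids \<open>x\<close> and fills \<open>U\<close> as far
        as its size permits; together with a base optimal on \<open>U\<close> it attains the
        required weight.\<close>
      obtain F where F: "F \<subseteq> - {x}" "card F = i" "min i (card (U - {x})) \<le> card (F \<inter> U)"
      proof (cases "i \<le> card (U - {x})")
        case True
        then obtain F where F: "F \<subseteq> U - {x}" "card F = i"
          using obtain_subset_with_card_n by metis
        then have "F \<inter> U = F" by auto
        with F show ?thesis by (intro that[of F]) auto
      next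
        case False
        then obtain F where F: "U - {x} \<subseteq> F" "F \<subseteq> - {x}" "card F = i"
          using exists_subset_between[of "U - {x}" i "- {x}"] i by auto
        then have "card (U - {x}) \<le> card (F \<inter> U)" by (intro card_mono) auto
        with F show ?thesis by (intro that[of F]) auto
      qed
      obtain b where b: "b \<in> B" "weight b U = max_weight B U"
        using max_weight_attained[OF B] .
      have "weight a U \<le> max_weight B U + min i (card U - 1)" using * U by simp
      also have "\<dots> \<le> weight (b + indicator_mon F) U"
        using F b diff_card_le_card_Diff[of "{x}" U] by (simp add: weight_add weight_indicator_mon)
      also have "\<dots> \<le> max_weight (sumset B ?I) U"
        by (rule weight_le_max_weight[OF I]) (use b F in \<open>auto simp: sumset_def\<close>)
      finally show ?thesis using * weight_Compl[of a T] by (simp add: U_def)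
    qed
    then obtain c where c: "c \<in> sumset B ?I" "c \<unlhd> a"
      using M_convex_divides_iff[OF I] by blast
    moreover have "c = a"
      using c * M_convexD(2)[OF I c(1)] by (intro divides_weight_eq) auto
    ultimately show "\<exists>F. \<exists>b\<in>B. x \<notin> F \<and> card F = i \<and> a = b + indicator_mon F"
      by (auto simp: sumset_def)
  qed
qed

section \<open>Upper Koszul complexes of polymatroidal ideals\<close>

definition shift_complex :: "('n::finite \<Rightarrow>\<^sub>0 nat) set \<Rightarrow> ('n \<Rightarrow>\<^sub>0 nat) \<Rightarrow> 'n set set" where
  "shift_complex B a = {F. \<exists>b\<in>B. b + indicator_mon F \<unlhd> a}"

text \<open>The inequalities for singletons show that \<open>indicator_mon F\<close> divides
  \<open>a\<close>; then \<open>M_convex_divides_iff\<close> applies to the quotient.\<close>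

lemma shift_complex_iff:
  fixes B :: "('n::finite \<Rightarrow>\<^sub>0 nat) set"
  assumes B: "M_convex d B"
  shows "F \<in> shift_complex B a \<longleftrightarrow>
    (\<forall>T. card (F \<inter> T) + d \<le> weight a T + max_weight B (- T))"
proof (intro iffI allI)
  fix T assume "F \<in> shift_complex B a"
  then obtain b where b: "b \<in> B" "b + indicator_mon F \<unlhd> a" by (auto simp: shift_complex_def)
  then show "card (F \<inter> T) + d \<le> weight a T + max_weight B (- T)"
    using weight_mono[OF b(2), of T] weight_le_max_weight[OF B b(1), of "- T"]
      M_convexD(2)[OF B b(1)] weight_Compl[of b T] by (simp add: weight_add weight_indicator_mon)
next
  assume *: "\<forall>T. card (F \<inter> T) + d \<le> weight a T + max_weight B (- T)"
  have "lookup a x \<ge> 1" if "x \<in> F" for x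
  proof -
    obtain b where b: "b \<in> B" "weight b (- {x}) = max_weight B (- {x})"
      using max_weight_attained[OF B] .
    then have "max_weight B (- {x}) \<le> d"
      using M_convexD(2)[OF B b(1)] weight_Compl[of b "{x}"] by simp
    with *[rule_format, of "{x}"] that show ?thesis by (simp add: weight_def)
  qed
  then have "indicator_mon F \<unlhd> a" by (auto simp: divides_def of_bool_def)
  then obtain f where f: "a = indicator_mon F + f" by (auto simp: divides_iff)
  have "\<exists>b\<in>B. b \<unlhd> f"
    unfolding M_convex_divides_iff[OF B]
    using * by (simp add: f weight_add weight_indicator_mon)
  then show "F \<in> shift_complex B a"
    by (auto simp: shift_complex_def f divides_def lookup_add add.commute)
qed

text \<open>An element that cannot be added to \<open>F\<close> lies in a set where the inequality
  for \<open>F\<close> is tight. By submodularity tight sets are closed under union, so one of them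
  contains all of \<open>X\<close>.\<close>

lemma shift_complex_tight_superset:
  fixes B :: "('n::finite \<Rightarrow>\<^sub>0 nat) set"
  assumes B: "M_convex d B" and F: "F \<in> shift_complex B a"
    and X: "\<And>x. x \<in> X \<Longrightarrow> insert x F \<notin> shift_complex B a"
  obtains T where "X \<subseteq> T" "card (F \<inter> T) + d = weight a T + max_weight B (- T)"
proof -
  let ?tight = "\<lambda>T. card (F \<inter> T) + d = weight a T + max_weight B (- T)"
  have le: "card (F \<inter> T) + d \<le> weight a T + max_weight B (- T)" for T
    using F shift_complex_iff[OF B] by blast
  have "finite X" by simp
  then have "\<exists>T. X \<subseteq> T \<and> ?tight T" using X
  proof induction
    case empty
    have "max_weight B UNIV = d"
      using max_weight_attained[OF B, of UNIV] M_convexD(2)[OF B] by metis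
    then show ?case by (intro exI[of _ "{}"]) simp
  next
    case (insert x X)
    then obtain T where T: "X \<subseteq> T" "?tight T" by auto
    from insert.prems[of x] obtain S where
      S: "\<not> card (insert x F \<inter> S) + d \<le> weight a S + max_weight B (- S)"
      using shift_complex_iff[OF B] by blast
    then have "x \<in> S" using le[of S] by (cases "x \<in> S") auto
    have "card (insert x F \<inter> S) \<le> Suc (card (F \<inter> S))"
      using card_insert_le_m1[of "Suc (card (F \<inter> S))" "F \<inter> S" x] \<open>x \<in> S\<close> by simp
    with S le[of S] have tS: "?tight S" by simp
    have "card (F \<inter> (S \<union> T)) + card (F \<inter> (S \<inter> T)) = card (F \<inter> S) + card (F \<inter> T)"
      using card_Un_Int[of "F \<inter> S" "F \<inter> T"] by (simp add: Int_Un_distrib Int_ac)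
    moreover have "max_weight B (- (S \<inter> T)) + max_weight B (- (S \<union> T)) \<le>
        max_weight B (- S) + max_weight B (- T)"
      using max_weight_submodular[OF B, of "- S" "- T"] by simp
    ultimately have "?tight (S \<union> T)"
      using weight_Un_Int[of a S T] le[of "S \<union> T"] le[of "S \<inter> T"] tS T(2) by linarith
    then show ?case using \<open>x \<in> S\<close> T by (intro exI[of _ "S \<union> T"]) auto
  qed
  then show ?thesis using that by blast
qed

text \<open>If nothing from \<open>G - F\<close> could be added, a tight \<open>T\<close> would
  contain \<open>G - F\<close>. Tightness makes \<open>G\<close> no larger than \<open>F\<close>
  inside \<open>T\<close>, and outside \<open>T\<close> every element of \<open>G\<close> lies in
  \<open>F\<close>.\<close>

lemma matroid_shift_complex:
  fixes B :: "('n::finite \<Rightarrow>\<^sub>0 nat) set"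
  assumes B: "M_convex d B" and ne: "{} \<in> shift_complex B a"
  shows "matroid (shift_complex B a)"
  unfolding matroid_def
proof (intro conjI ballI allI impI ne)
  fix F G assume "F \<in> shift_complex B a" and "G \<subseteq> F"
  then obtain b where b: "b \<in> B" "b + indicator_mon F \<unlhd> a"
    unfolding shift_complex_def by blast
  have "b + indicator_mon G \<unlhd> b + indicator_mon F"
    using \<open>G \<subseteq> F\<close> by (auto simp: divides_def lookup_add)
  with b show "G \<in> shift_complex B a"
    unfolding shift_complex_def using divides_trans by blast
next
  fix F G assume F: "F \<in> shift_complex B a" and G: "G \<in> shift_complex B a"
    and lt: "card F < card G"
  show "\<exists>x\<in>G - F. insert x F \<in> shift_complex B a"
  proof (rule ccontr)
    assume "\<not> ?thesis"
    then obtain T where T: "G - F \<subseteq> T" "card (F \<inter> T) + d = weight a T + max_weight B (- T)"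
      using shift_complex_tight_superset[OF B F, of "G - F"] by blast
    have "card (G \<inter> T) \<le> card (F \<inter> T)"
      using G shift_complex_iff[OF B] T(2) by (metis add_le_cancel_right)
    moreover have "card F = card (F \<inter> T) + card (F - T)" "card G = card (G \<inter> T) + card (G - T)"
      by (simp_all add: card_Int_Diff)
    moreover have "card (G - T) \<le> card (F - T)" using T by (intro card_mono) auto
    ultimately show False using lt by simp
  qed
qed

text \<open>The absence of coloops provides bases avoiding any given \<open>x\<close>. The main work
  in the converse is the degree of \<open>a\<close>, which is read off from a tight set that turns
  out to be \<open>UNIV\<close>.\<close>

lemma syzygy_degrees_iff_shift_complex:
  fixes B :: "('n::finite \<Rightarrow>\<^sub>0 nat) set" and a :: "'n \<Rightarrow>\<^sub>0 nat"
  assumes B: "M_convex d B"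
  defines "\<Delta> \<equiv> shift_complex B a"
  shows "a \<in> syzygy_degrees i B \<longleftrightarrow> {} \<in> \<Delta> \<and> (\<forall>F\<in>\<Delta>. card F \<le> i) \<and> (\<exists>F\<in>\<Delta>. card F = i) \<and>
    (\<forall>x. \<exists>F\<in>\<Delta>. insert x F \<notin> \<Delta>)"
proof (intro iffI conjI ballI allI)
  assume a: "a \<in> syzygy_degrees i B"
  have avoid: "\<exists>F\<in>\<Delta>. x \<notin> F \<and> card F = i" for x
  proof -
    obtain F b where "b \<in> B" "x \<notin> F" "card F = i" "a = b + indicator_mon F"
      using a unfolding syzygy_degrees_def by blast
    then show ?thesis
      by (intro bexI[of _ F]) (auto simp: \<Delta>_def shift_complex_def divides_def)
  qed
  then show "\<exists>F\<in>\<Delta>. card F = i" by blast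
  then obtain F b where "b \<in> B" "b + indicator_mon F \<unlhd> a"
    unfolding \<Delta>_def shift_complex_def by blast
  then show "{} \<in> \<Delta>"
    unfolding \<Delta>_def shift_complex_def
    using divides_trans[OF divides_add_right, of b "indicator_mon F" a] by auto
  have w: "weight a UNIV = d + i" using a syzygy_degrees_iff[OF B] by blast
  show le: "card F \<le> i" if F: "F \<in> \<Delta>" for F
  proof -
    obtain b where b: "b \<in> B" "b + indicator_mon F \<unlhd> a"
      using F unfolding \<Delta>_def shift_complex_def by blast
    then show ?thesis
      using weight_mono[OF b(2), of UNIV] w M_convexD(2)[OF B b(1)]
      by (simp add: weight_add weight_indicator_mon)
  qed
  show "\<exists>F\<in>\<Delta>. insert x F \<notin> \<Delta>" for x
  proof -
    obtain F where F: "F \<in> \<Delta>" "x \<notin> F" "card F = i" using avoid by blast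
    then have "insert x F \<notin> \<Delta>" using le[of "insert x F"] by auto
    with F show ?thesis by blast
  qed
next
  assume *: "{} \<in> \<Delta> \<and> (\<forall>F\<in>\<Delta>. card F \<le> i) \<and> (\<exists>F\<in>\<Delta>. card F = i) \<and>
    (\<forall>x. \<exists>F\<in>\<Delta>. insert x F \<notin> \<Delta>)"
  then have m: "matroid \<Delta>" unfolding \<Delta>_def using matroid_shift_complex[OF B] by blast
  obtain F where F: "F \<in> \<Delta>" "card F = i" using * by blast
  have avoid: "\<exists>H\<in>\<Delta>. x \<notin> H \<and> card H = i" for x
  proof -
    obtain F' where F': "F' \<in> \<Delta>" "insert x F' \<notin> \<Delta>" using * by blast
    obtain H where "H \<in> \<Delta>" "x \<notin> H" "card F \<le> card H"
      using matroid_avoiding[OF m F' F(1)] .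
    moreover from this have "card H = i" using * F by (simp add: antisym)
    ultimately show ?thesis by blast
  qed
  have "insert x F \<notin> \<Delta>" if "x \<in> - F" for x
  proof
    assume "insert x F \<in> \<Delta>"
    then have "card (insert x F) \<le> i" using * by blast
    then show False using that F by simp
  qed
  then obtain T where T: "- F \<subseteq> T" "card (F \<inter> T) + d = weight a T + max_weight B (- T)"
    using shift_complex_tight_superset[OF B, of F a "- F"] F by (auto simp: \<Delta>_def)
  \<comment> \<open>Otherwise a base \<open>H\<close> avoiding some \<open>x\<close> outside
    \<open>T\<close> is no larger than \<open>F\<close> inside \<open>T\<close> and strictly smaller
    outside it, although both have \<open>i\<close> elements.\<close>
  have "T = UNIV"
  proof (rule ccontr)
    assume "T \<noteq> UNIV"
    then obtain x where x: "x \<notin> T" by auto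
    obtain H where H: "H \<in> \<Delta>" "x \<notin> H" "card H = i" using avoid by blast
    have "card (H \<inter> T) \<le> card (F \<inter> T)"
      using H(1) shift_complex_iff[OF B] T(2) unfolding \<Delta>_def by (metis add_le_cancel_right)
    moreover have "card F = card (F \<inter> T) + card (F - T)" "card H = card (H \<inter> T) + card (H - T)"
      by (simp_all add: card_Int_Diff)
    moreover have "card (H - T) < card (F - T)"
      using T x H by (intro psubset_card_mono) auto
    ultimately show False using F H by simp
  qed
  obtain b0 where "b0 \<in> B" "weight b0 {} = max_weight B {}"
    using max_weight_attained[OF B] .
  with T \<open>T = UNIV\<close> F have w: "weight a UNIV = d + i" by simp
  show "a \<in> syzygy_degrees i B"
    unfolding syzygy_degrees_def
  proof (intro CollectI allI)
    fix x
    obtain H where H: "H \<in> \<Delta>" "x \<notin> H" "card H = i" using avoid by blast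
    then obtain b where b: "b \<in> B" "b + indicator_mon H \<unlhd> a"
      by (auto simp: \<Delta>_def shift_complex_def)
    have "b + indicator_mon H = a"
      by (rule divides_weight_eq[OF b(2)])
        (use w H M_convexD(2)[OF B b(1)] in \<open>simp add: weight_add weight_indicator_mon\<close>)
    then show "\<exists>F. \<exists>b\<in>B. x \<notin> F \<and> card F = i \<and> a = b + indicator_mon F"
      using H b by blast
  qed
qed

section \<open>Powers\<close>

primrec sum_power :: "('a::monoid_add) set \<Rightarrow> nat \<Rightarrow> 'a set" where
  "sum_power B 0 = {0}"
| "sum_power B (Suc k) = sumset B (sum_power B k)"

lemma M_convex_zero: "M_convex 0 {0 :: 'n::finite \<Rightarrow>\<^sub>0 nat}"
  by (auto simp: M_convex_def)

lemma M_convex_sum_power: "M_convex d B \<Longrightarrow> M_convex (k * d) (sum_power B k)"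
  by (induction k) (auto simp: M_convex_zero intro: M_convex_sumset)

lemma max_weight_sumset:
  assumes B: "M_convex d B" and C: "M_convex e C"
  shows "max_weight (sumset B C) U = max_weight B U + max_weight C U"
proof (rule antisym)
  show "max_weight (sumset B C) U \<le> max_weight B U + max_weight C U"
    by (rule max_weight_leI[OF M_convex_sumset[OF B C]])
      (auto simp: sumset_def weight_add intro!: add_mono weight_le_max_weight[OF B] weight_le_max_weight[OF C])
  obtain b where b: "b \<in> B" "weight b U = max_weight B U" using max_weight_attained[OF B] .
  obtain c where c: "c \<in> C" "weight c U = max_weight C U" using max_weight_attained[OF C] .
  have "weight (b + c) U \<le> max_weight (sumset B C) U"
    by (rule weight_le_max_weight[OF M_convex_sumset[OF B C]]) (use b c in \<open>auto simp: sumset_def\<close>)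
  then show "max_weight B U + max_weight C U \<le> max_weight (sumset B C) U"
    using b c by (simp add: weight_add)
qed

lemma max_weight_sum_power:
  assumes B: "M_convex d B"
  shows "max_weight (sum_power B k) U = k * max_weight B U"
proof (induction k)
  case 0
  then show ?case by (simp add: max_weight_def)
next
  case (Suc k)
  then show ?case using max_weight_sumset[OF B M_convex_sum_power[OF B]] by simp
qed

text \<open>Adding \<open>b\<close> changes the base but not \<open>F\<close>. This is the easy
  inclusion in the colon formula.\<close>

lemma syzygy_degrees_sumset:
  assumes "a \<in> syzygy_degrees i C" "b \<in> B"
  shows "b + a \<in> syzygy_degrees i (sumset B C)"
  unfolding syzygy_degrees_def
proof (intro CollectI allI)
  fix x
  obtain F c where "c \<in> C" "x \<notin> F" "card F = i" "a = c + indicator_mon F"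
    using assms(1) unfolding syzygy_degrees_def by blast
  then show "\<exists>F. \<exists>c\<in>sumset B C. x \<notin> F \<and> card F = i \<and> b + a = c + indicator_mon F"
    using assms(2) by (intro exI[of _ F] bexI[of _ "b + c"]) (auto simp: sumset_def add.assoc)
qed

text \<open>For intersecting sets \<open>card - 1\<close> is not truncated, hence modular, and
  capping a monotone modular function at a constant keeps submodularity.\<close>

lemma min_card_submodular:
  fixes U V :: "'n::finite set"
  assumes "U \<inter> V \<noteq> {}"
  shows "min i (card (U \<union> V) - 1) + min i (card (U \<inter> V) - 1) \<le>
    min i (card U - 1) + min i (card V - 1)"
proof -
  have "card U + card V = card (U \<union> V) + card (U \<inter> V)" by (rule card_Un_Int) auto
  moreover have "card (U \<inter> V) \<le> card U" "card (U \<inter> V) \<le> card V" "0 < card (U \<inter> V)"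
    using assms by (auto intro: card_mono simp: card_gt_0_iff)
  ultimately show ?thesis by linarith
qed

text \<open>Applied to an exponent in the support of a polynomial, this yields the hard inclusion of
  the colon formula.\<close>

lemma syzygy_degrees_colon:
  fixes B :: "('n::finite \<Rightarrow>\<^sub>0 nat) set"
  assumes B: "M_convex d B" and "i \<le> k"
    and ne: "syzygy_degrees i (sum_power B k) \<noteq> {}"
    and f: "\<And>a. a \<in> syzygy_degrees i (sum_power B k) \<Longrightarrow> \<not> a \<unlhd> f"
  obtains g where "g \<in> B" "\<And>a. a \<in> syzygy_degrees i (sum_power B (Suc k)) \<Longrightarrow> \<not> a \<unlhd> g + f"
proof -
  note Bk = M_convex_sum_power[OF B]
  define r where "r = max_weight B"
  define c where "c U = min i (card U - 1)" for U :: "'n set"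
  have syz: "a \<in> syzygy_degrees i (sum_power B l) \<longleftrightarrow> weight a UNIV = l * d + i \<and>
      (\<forall>U. U \<noteq> {} \<longrightarrow> weight a U \<le> l * r U + c U)" for a l
    using syzygy_degrees_iff[OF Bk] by (simp add: max_weight_sum_power[OF B] r_def c_def)
  define A where "A = syzygy_degrees i (sum_power B k)"
  \<comment> \<open>The size of the positive part of \<open>a - f\<close>. Its minimality will
    forbid trading \<open>y\<close> for an element where \<open>f\<close> exceeds
    \<open>a\<close>.\<close>
  define e where "e a = (\<Sum>x\<in>UNIV. lookup a x - lookup f x)" for a
  obtain a where a: "a \<in> A" and a_min: "\<And>a'. a' \<in> A \<Longrightarrow> e a \<le> e a'"
    using ne ex_has_least_nat[of "\<lambda>a. a \<in> A" _ e] unfolding A_def by blast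
  have wa: "weight a UNIV = k * d + i" and aU: "\<And>U. U \<noteq> {} \<Longrightarrow> weight a U \<le> k * r U + c U"
    using a syz unfolding A_def by blast+
  obtain y where y: "lookup f y < lookup a y"
    using f a unfolding A_def divides_def by (meson not_le)
  define R where "R = {z. z = y \<or> exchange a y z \<in> A}"
  have fR: "weight f R < weight a R"
  proof -
    have "lookup f z \<le> lookup a z" if "z \<in> R" for z
    proof (rule ccontr)
      assume *: "\<not> lookup f z \<le> lookup a z"
      then have "z \<noteq> y" using y by auto
      moreover from this have "exchange a y z \<in> A" using that by (simp add: R_def)
      moreover have "e (exchange a y z) < e a"
        unfolding e_def using y * \<open>z \<noteq> y\<close>
        by (intro sum_strict_mono_ex1) (auto simp: lookup_exchange)
      ultimately show False using a_min by fastforce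
    qed
    then show ?thesis
      unfolding weight_def using y by (intro sum_strict_mono_ex1) (auto simp: R_def)
  qed
  \<comment> \<open>Tight sets avoiding \<open>y\<close> are what blocks trading \<open>y\<close>
    for one of their elements.\<close>
  define T where "T = {U. U \<noteq> {} \<and> y \<notin> U \<and> weight a U = k * r U + c U}"
  \<comment> \<open>Submodularity of \<open>c\<close> is available for intersecting pairs, so
    overlapping tight sets can be merged; the maximal ones, collected in \<open>M\<close>, are
    therefore disjoint.\<close>
  have T_Un: "U \<union> V \<in> T" if "U \<in> T" "V \<in> T" "U \<inter> V \<noteq> {}" for U V
  proof -
    have "c (U \<union> V) + c (U \<inter> V) \<le> c U + c V"
      unfolding c_def by (rule min_card_submodular[OF that(3)])
    moreover have "k * r (U \<union> V) + k * r (U \<inter> V) \<le> k * r U + k * r V"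
      using mult_le_mono2[OF max_weight_submodular[OF B, of U V], of k]
      by (simp add: r_def distrib_left)
    moreover have "weight a (U \<union> V) \<le> k * r (U \<union> V) + c (U \<union> V)"
      "weight a (U \<inter> V) \<le> k * r (U \<inter> V) + c (U \<inter> V)"
      using that(3) by (auto intro!: aU)
    moreover have "weight a U = k * r U + c U" "weight a V = k * r V + c V"
      using that by (auto simp: T_def)
    ultimately have "weight a (U \<union> V) = k * r (U \<union> V) + c (U \<union> V)"
      using weight_Un_Int[of a U V] by linarith
    with that show ?thesis by (auto simp: T_def)
  qed
  define M where "M = {U\<in>T. \<forall>V\<in>T. U \<subseteq> V \<longrightarrow> V = U}"
  have disj: "U \<inter> V = {}" if "U \<in> M" "V \<in> M" "U \<noteq> V" for U V
  proof (rule ccontr)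
    assume ne: "U \<inter> V \<noteq> {}"
    have UV: "U \<in> T" "V \<in> T" using that by (auto simp: M_def)
    have "U \<union> V \<in> T" using T_Un[OF UV ne] .
    then have "U \<union> V = U" "U \<union> V = V" using that by (auto simp: M_def)
    with that(3) show False by simp
  qed
  have "\<Union>M = - R"
  proof (intro equalityI subsetI)
    fix z assume "z \<in> \<Union>M"
    then obtain U where U: "U \<in> T" "z \<in> U" by (auto simp: M_def)
    show "z \<in> - R"
    proof (rule ComplI)
      assume "z \<in> R"
      moreover have "z \<noteq> y" "y \<notin> U" using U by (auto simp: T_def)
      ultimately have "exchange a y z \<in> A" by (simp add: R_def)
      then have "weight (exchange a y z) U \<le> k * r U + c U"
        using syz[of "exchange a y z" k] U(2) unfolding A_def by auto
      moreover have "weight (exchange a y z) U = Suc (weight a U)"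
        using weight_exchange[of a y z U] y U \<open>y \<notin> U\<close> by simp
      ultimately show False using U by (simp add: T_def)
    qed
  next
    fix z assume z: "z \<in> - R"
    then have "exchange a y z \<notin> A" "z \<noteq> y" by (auto simp: R_def)
    moreover have "weight (exchange a y z) UNIV = k * d + i"
      using weight_exchange[of a y z UNIV] y wa by simp
    ultimately obtain U where U: "U \<noteq> {}" "\<not> weight (exchange a y z) U \<le> k * r U + c U"
      using syz[of "exchange a y z" k] unfolding A_def by auto
    have "weight (exchange a y z) U + of_bool (y \<in> U) = weight a U + of_bool (z \<in> U)"
      using weight_exchange[of a y z U] y by simp
    with U aU[OF U(1)] have "y \<notin> U" "z \<in> U" "weight a U = k * r U + c U"
      by (auto simp: of_bool_def split: if_splits)
    then have "U \<in> T" by (auto simp: T_def)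
    then obtain V where "V \<in> T" "U \<subseteq> V" "\<forall>W\<in>T. V \<subseteq> W \<longrightarrow> V = W"
      using finite_has_maximal2[of T U] by auto
    then have "V \<in> M" by (auto simp: M_def)
    with \<open>U \<subseteq> V\<close> \<open>z \<in> U\<close> show "z \<in> \<Union>M" by blast
  qed
  have weight_R: "weight w (- R) = (\<Sum>U\<in>M. weight w U)" for w
    unfolding \<open>\<Union>M = - R\<close>[symmetric] by (rule weight_UN_disjoint[OF disj])
  define rM where "rM = (\<Sum>U\<in>M. r U)"
  define cM where "cM = (\<Sum>U\<in>M. c U)"
  \<comment> \<open>Tightness on the disjoint members of \<open>M\<close> determines the weight of
    \<open>a\<close> outside \<open>R\<close>.\<close>
  have aR: "weight a (- R) = k * rM + cM"
    unfolding weight_R rM_def cM_def sum_distrib_left sum.distrib[symmetric]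
    by (intro sum.cong) (auto simp: M_def T_def)
  \<comment> \<open>Maximal weight outside \<open>R\<close> means minimal weight on
    \<open>R\<close>, as all bases have degree \<open>d\<close>.\<close>
  obtain g where g: "g \<in> B" "weight g (- R) = r (- R)"
    using max_weight_attained[OF B] unfolding r_def .
  have "r (- R) = (\<Sum>U\<in>M. weight g U)" using g(2) weight_R[of g] by simp
  also have "\<dots> \<le> rM"
    unfolding rM_def r_def by (intro sum_mono weight_le_max_weight[OF B g(1)])
  finally have rM: "r (- R) \<le> rM" .
  have wg: "weight g R + r (- R) = d"
    using g M_convexD(2)[OF B g(1)] weight_Compl[of g R] by simp
  show ?thesis
  proof (rule that[OF g(1)])
    fix a' assume a': "a' \<in> syzygy_degrees i (sum_power B (Suc k))"
    have wa': "weight a' UNIV = d + k * d + i"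
      and a'U: "\<And>U. U \<noteq> {} \<Longrightarrow> weight a' U \<le> Suc k * r U + c U"
      using a' syz[of a' "Suc k"] by auto
    show "\<not> a' \<unlhd> g + f"
    proof
      assume "a' \<unlhd> g + f"
      then have le: "weight a' R \<le> weight g R + weight f R"
        using weight_mono[of a' "g + f" R] by (simp add: weight_add)
      show False
      proof (cases "rM = r (- R)")
        case True
        \<comment> \<open>Summing the inequalities over \<open>M\<close> and comparing total
          degrees, \<open>a'\<close> weighs at least as much on \<open>R\<close> as
          \<open>a + g\<close>, which outweighs \<open>f + g\<close> there.\<close>
        have "weight a' (- R) \<le> (\<Sum>U\<in>M. Suc k * r U + c U)"
          unfolding weight_R by (intro sum_mono a'U) (auto simp: M_def T_def)
        also have "\<dots> = Suc k * rM + cM"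
          by (simp add: rM_def cM_def sum.distrib sum_distrib_left)
        finally have "weight a' (- R) \<le> rM + k * rM + cM" by simp
        then show False
          using le fR aR wa wa' wg weight_Compl[of a R] weight_Compl[of a' R] True by linarith
      next
        case False
        \<comment> \<open>Since \<open>rM\<close> exceeds \<open>r (- R)\<close> by at least one,
          the factor \<open>k \<ge> i\<close> absorbs the surplus \<open>i\<close>: on
          \<open>R\<close>, \<open>a\<close> weighs at most \<open>k\<close> times as much as
          \<open>g\<close>. But \<open>a'\<close> weighs at least \<open>k + 1\<close> times as much
          as \<open>g\<close>, already through its base \<open>b\<close>.\<close>
        then have "k * Suc (r (- R)) \<le> k * rM" using rM by (intro mult_le_mono2) simp
        then have aRd: "weight a R + k * r (- R) \<le> k * d"
          using aR wa weight_Compl[of a R] \<open>i \<le> k\<close> by simp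
        obtain b F where b: "b \<in> sum_power B (Suc k)" "a' = b + indicator_mon F"
          using a' unfolding syzygy_degrees_def by blast
        have "weight b (- R) \<le> Suc k * r (- R)"
          using weight_le_max_weight[OF Bk b(1), of "- R"]
          unfolding max_weight_sum_power[OF B] r_def .
        moreover have "weight b UNIV = Suc k * d" by (rule M_convexD(2)[OF Bk b(1)])
        moreover have "weight b R \<le> weight a' R" by (simp add: b(2) weight_add)
        ultimately have "d + k * d \<le> weight a' R + r (- R) + k * r (- R)"
          using weight_Compl[of b R] unfolding mult_Suc by linarith
        then show False
          using le fR wg aRd by linarith
      qed
    qed
  qed
qed

text \<open>
  The edges of the linear relation graph of Herzog and Qureshi. If an \<open>i\<close>-element set \<open>F\<close> contains no
  connected component of this graph, then some \<open>b + F\<close> is the multidegree of an \<open>i\<close>-th syzygy of \<open>I\<^sup>i\<close>.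
\<close>

definition linear_relations :: "('n \<Rightarrow>\<^sub>0 nat) set \<Rightarrow> ('n \<times> 'n) set" where
  "linear_relations B = {(x, y). \<exists>b\<in>B. \<exists>c\<in>B. b + single x 1 = c + single y 1}"

text \<open>No exchange leads out of a closed set, so by \<open>M_convex_closed_min\<close> every
  base has the least weight on it.\<close>

lemma weight_linear_relations_closed:
  fixes B :: "('n::finite \<Rightarrow>\<^sub>0 nat) set"
  assumes B: "M_convex d B" and R: "linear_relations B `` R \<subseteq> R"
    and bc: "b \<in> B" "c \<in> B"
  shows "weight b R = weight c R"
proof -
  have "weight b R \<le> weight c R" if bc: "b \<in> B" "c \<in> B" for b c
  proof (rule M_convex_closed_min[OF B bc])
    fix x y assume xy: "x \<in> R" "y \<notin> R" "lookup b x > 0"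
    show "exchange b x y \<notin> B"
    proof
      assume "exchange b x y \<in> B"
      then have "(x, y) \<in> linear_relations B"
        using exchange_add[OF xy(3), of y] bc(1) unfolding linear_relations_def by blast
      with R xy show False by blast
    qed
  qed
  with bc show ?thesis by (simp add: antisym)
qed

lemma weight_sum_power_linear_relations_closed:
  fixes B :: "('n::finite \<Rightarrow>\<^sub>0 nat) set"
  assumes B: "M_convex d B" and R: "linear_relations B `` R \<subseteq> R"
    and "b \<in> sum_power B k" "c \<in> sum_power B k"
  shows "weight b R = weight c R"
  using assms(3,4)
proof (induction k arbitrary: b c)
  case (Suc k)
  then obtain b1 b2 c1 c2 where *: "b = b1 + b2" "c = c1 + c2" "b1 \<in> B" "c1 \<in> B"
    "b2 \<in> sum_power B k" "c2 \<in> sum_power B k"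
    by (auto simp: sumset_def)
  have "weight b1 R = weight c1 R"
    using weight_linear_relations_closed[OF B R *(3,4)] .
  with Suc.IH[OF *(5,6)] show ?case by (simp add: * weight_add)
qed auto

lemma rtrancl_exit:
  assumes "(x, y) \<in> r\<^sup>*" "x \<in> F" "y \<notin> F"
  obtains u v where "u \<in> F" "v \<notin> F" "(u, v) \<in> r"
proof -
  have "\<exists>u v. u \<in> F \<and> v \<notin> F \<and> (u, v) \<in> r"
    using assms(1,2)
  proof (induction rule: converse_rtrancl_induct)
    case base
    then show ?case using assms(3) by simp
  next
    case (step x z)
    then show ?case by (cases "z \<in> F") auto
  qed
  then show ?thesis using that by blast
qed

text \<open>Induction on \<open>F\<close>: choose a relation \<open>p\<close>, \<open>q\<close>
  along an edge from \<open>u\<close> in \<open>F\<close> to \<open>v\<close> outside, and add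
  \<open>p\<close> to the solution for \<open>F - {u}\<close>. Where that solution trades an element
  for \<open>u\<close>, the relation trades \<open>u\<close> on to \<open>v\<close>.\<close>

lemma linear_relations_syzygy:
  fixes B :: "('n::finite \<Rightarrow>\<^sub>0 nat) set"
  assumes B: "M_convex d B" and "\<And>x. x \<in> F \<Longrightarrow> \<exists>y. y \<notin> F \<and> (x, y) \<in> (linear_relations B)\<^sup>*"
  shows "\<exists>b\<in>sum_power B (card F). \<forall>x\<in>F. \<exists>y. y \<notin> F \<and>
    (\<exists>c\<in>sum_power B (card F). b + single x 1 = c + single y 1)"
  using assms(2)
proof (induction "card F" arbitrary: F)
  case 0
  then show ?case by simp
next
  case (Suc n)
  obtain x0 where "x0 \<in> F" using Suc.hyps(2) by fastforce
  with Suc.prems obtain y0 where "y0 \<notin> F" "(x0, y0) \<in> (linear_relations B)\<^sup>*" by blast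
  with \<open>x0 \<in> F\<close> obtain u v where uv: "u \<in> F" "v \<notin> F" "(u, v) \<in> linear_relations B"
    using rtrancl_exit[of x0 y0 _ F] by metis
  obtain p q where pq: "p \<in> B" "q \<in> B" "p + single u 1 = q + single v 1"
    using uv(3) unfolding linear_relations_def by blast
  have card: "card F = Suc (card (F - {u}))" using uv(1) card_Suc_Diff1[of F u] by simp
  have "\<exists>b\<in>sum_power B (card (F - {u})). \<forall>x\<in>F - {u}. \<exists>y. y \<notin> F - {u} \<and>
      (\<exists>c\<in>sum_power B (card (F - {u})). b + single x 1 = c + single y 1)"
  proof (rule Suc.hyps(1))
    show "n = card (F - {u})" using card Suc.hyps(2) by simp
    show "\<exists>y. y \<notin> F - {u} \<and> (x, y) \<in> (linear_relations B)\<^sup>*" if "x \<in> F - {u}" for x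
      using that Suc.prems[of x] by blast
  qed
  then obtain b where b: "b \<in> sum_power B (card (F - {u}))"
    and bF: "\<And>x. x \<in> F - {u} \<Longrightarrow> \<exists>y. y \<notin> F - {u} \<and>
      (\<exists>c\<in>sum_power B (card (F - {u})). b + single x 1 = c + single y 1)" by blast
  show ?case
  proof (intro bexI ballI)
    show "p + b \<in> sum_power B (card F)"
      unfolding card using b pq by (auto simp: sumset_def)
    fix x assume x: "x \<in> F"
    show "\<exists>y. y \<notin> F \<and> (\<exists>c\<in>sum_power B (card F). p + b + single x 1 = c + single y 1)"
    proof (cases "x = u")
      case True
      have "q + b \<in> sum_power B (card F)"
        unfolding card using b pq by (auto simp: sumset_def)
      moreover have "p + b + single x 1 = (p + single u 1) + b"
        using True by (simp only: ac_simps)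
      then have "p + b + single x 1 = q + b + single v 1"
        unfolding pq(3) by (simp only: ac_simps)
      ultimately show ?thesis using uv(2) by blast
    next
      case False
      with x bF obtain y c where y: "y \<notin> F - {u}" "c \<in> sum_power B (card (F - {u}))"
        "b + single x 1 = c + single y 1" by blast
      show ?thesis
      proof (cases "y = u")
        case True
        have "q + c \<in> sum_power B (card F)"
          unfolding card using y pq by (auto simp: sumset_def)
        moreover have "p + b + single x 1 = p + (b + single x 1)"
          by (simp only: ac_simps)
        then have "p + b + single x 1 = (p + single u 1) + c"
          unfolding y(3) True by (simp only: ac_simps)
        then have "p + b + single x 1 = q + c + single v 1"
          unfolding pq(3) by (simp only: ac_simps)
        ultimately show ?thesis using uv(2) by blast
      next
        case False
        have "p + c \<in> sum_power B (card F)"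
          unfolding card using y pq by (auto simp: sumset_def)
        moreover have "p + b + single x 1 = p + c + single y 1"
          using y(3) by (simp add: add.assoc)
        ultimately show ?thesis using y(1) False by blast
      qed
    qed
  qed
qed

text \<open>All elements of a sum power have the same weight on a component of the relation graph.
  If \<open>F\<close> contained a component, an \<open>F'\<close> avoiding one of its vertices could
  not balance it. So a syzygy degree exists for the power \<open>i\<close>, and adding bases reaches
  \<open>k\<close>. This settles the case of a zero shift ideal.\<close>

lemma syzygy_degrees_nonempty:
  fixes B :: "('n::finite \<Rightarrow>\<^sub>0 nat) set"
  assumes B: "M_convex d B" and "i \<le> k" and "syzygy_degrees i (sum_power B l) \<noteq> {}"
  shows "syzygy_degrees i (sum_power B k) \<noteq> {}"
proof -
  obtain a where a: "\<And>x. \<exists>F. \<exists>b\<in>sum_power B l. x \<notin> F \<and> card F = i \<and> a = b + indicator_mon F"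
    using assms(3) unfolding syzygy_degrees_def by blast
  \<comment> \<open>Any variable will do here; the freedom in \<open>x\<close> is used below to
    obtain \<open>F'\<close>.\<close>
  from this[of undefined] obtain F b
    where F: "b \<in> sum_power B l" "card F = i" "a = b + indicator_mon F" by blast
  have "\<exists>y. y \<notin> F \<and> (x, y) \<in> (linear_relations B)\<^sup>*" if "x \<in> F" for x
  proof (rule ccontr)
    assume *: "\<not> ?thesis"
    define R where "R = {y. (x, y) \<in> (linear_relations B)\<^sup>*}"
    have "R \<subseteq> F" using * by (auto simp: R_def)
    obtain F' b' where F': "b' \<in> sum_power B l" "x \<notin> F'" "a = b' + indicator_mon F'"
      using a by blast
    have closed: "linear_relations B `` R \<subseteq> R"
      by (auto simp: R_def)
    have "weight b R = weight b' R"
      using weight_sum_power_linear_relations_closed[OF B closed F(1) F'(1)] .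
    then have "card (F \<inter> R) = card (F' \<inter> R)"
      using arg_cong[OF trans[OF F(3)[symmetric] F'(3)], of "\<lambda>a. weight a R"]
      by (simp add: weight_add weight_indicator_mon)
    moreover have "F \<inter> R = R" using \<open>R \<subseteq> F\<close> by auto
    moreover have "card (F' \<inter> R) < card R"
      using F'(2) by (intro psubset_card_mono) (auto simp: R_def)
    ultimately show False by simp
  qed
  from linear_relations_syzygy[OF B this] obtain c where c: "c \<in> sum_power B i"
    and cF: "\<And>x. x \<in> F \<Longrightarrow> \<exists>y. y \<notin> F \<and> (\<exists>c'\<in>sum_power B i. c + single x 1 = c' + single y 1)"
    unfolding F(2) by blast
  have "c + indicator_mon F \<in> syzygy_degrees i (sum_power B i)"
    unfolding syzygy_degrees_def
  proof (intro CollectI allI)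
    fix x
    show "\<exists>G. \<exists>b\<in>sum_power B i. x \<notin> G \<and> card G = i \<and> c + indicator_mon F = b + indicator_mon G"
    proof (cases "x \<in> F")
      case False
      then show ?thesis using c F(2) by (intro exI[of _ F] bexI[of _ c]) simp_all
    next
      case True
      then obtain y c' where y: "y \<notin> F" "c' \<in> sum_power B i" "c + single x 1 = c' + single y 1"
        using cF by blast
      have "indicator_mon F = single x 1 + indicator_mon (F - {x})"
        using indicator_mon_insert[of x "F - {x}"] True by (simp add: insert_absorb)
      then have "c + indicator_mon F = (c + single x 1) + indicator_mon (F - {x})"
        by (simp only: add.assoc)
      also have "\<dots> = c' + indicator_mon (insert y (F - {x}))"
        unfolding y(3) using y(1) by (simp add: indicator_mon_insert add.assoc)
      finally have "c + indicator_mon F = c' + indicator_mon (insert y (F - {x}))" .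
      moreover have "card (insert y (F - {x})) = i"
        using y True F(2) card_Suc_Diff1[of F x] by simp
      moreover have "x \<notin> insert y (F - {x})" using y True by auto
      ultimately show ?thesis
        using y(2) by (intro exI[of _ "insert y (F - {x})"] bexI[of _ c']) simp_all
    qed
  qed
  then have "syzygy_degrees i (sum_power B (i + j)) \<noteq> {}" for j
  proof (induction j)
    case (Suc j)
    then obtain a where "a \<in> syzygy_degrees i (sum_power B (i + j))" by auto
    moreover obtain b where "b \<in> B" using M_convexD(1)[OF B] by blast
    ultimately have "b + a \<in> syzygy_degrees i (sumset B (sum_power B (i + j)))"
      by (rule syzygy_degrees_sumset)
    then show ?case by auto
  qed auto
  from this[of "k - i"] \<open>i \<le> k\<close> show ?thesis by simp
qed

section \<open>Comparison of resolutions of the residue field\<close>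

interpretation ideal: module "(*) :: 'a::comm_ring_1 \<Rightarrow> 'a \<Rightarrow> 'a"
  by unfold_locales (simp_all add: algebra_simps)

declare ideal.scale_scale [simp del]

text \<open>The linear map sending the \<open>c\<close>-th basis vector to \<open>t c\<close>. Chain
  maps and homotopies are kept as such families \<open>t\<close>, so that they also act on vectors
  with entries in an ideal.\<close>

definition lincomb :: "nat \<Rightarrow> (nat \<Rightarrow> nat \<Rightarrow> 'a::comm_ring_1) \<Rightarrow> (nat \<Rightarrow> 'a) \<Rightarrow> nat \<Rightarrow> 'a" where
  "lincomb n t v b = (\<Sum>c<n. v c * t c b)"

definition unit_vector :: "nat \<Rightarrow> nat \<Rightarrow> 'a::comm_ring_1" where
  "unit_vector c b = (if b = c then 1 else 0)"

lemma lincomb_lincomb: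
  "lincomb n (\<lambda>c. lincomb n' t (s c)) v = lincomb n' t (lincomb n s v)"
proof
  fix b
  have "lincomb n (\<lambda>c. lincomb n' t (s c)) v b = (\<Sum>c<n. \<Sum>d<n'. v c * s c d * t d b)"
    by (simp add: lincomb_def sum_distrib_left mult.assoc)
  also have "\<dots> = (\<Sum>d<n'. \<Sum>c<n. v c * s c d * t d b)" by (rule sum.swap)
  also have "\<dots> = lincomb n' t (lincomb n s v) b"
    by (simp add: lincomb_def sum_distrib_right)
  finally show "lincomb n (\<lambda>c. lincomb n' t (s c)) v b = lincomb n' t (lincomb n s v) b" .
qed

lemma lincomb_cong: "(\<And>c. c < n \<Longrightarrow> t c = t' c) \<Longrightarrow> lincomb n t v = lincomb n t' v"
  unfolding lincomb_def by (intro ext sum.cong refl) simp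

lemma lincomb_diff:
  "lincomb n (\<lambda>c b. t c b - t' c b) v b = lincomb n t v b - lincomb n t' v b"
  by (simp add: lincomb_def algebra_simps sum_subtractf)

lemma lincomb_diff_right:
  "lincomb n t (\<lambda>c. v c - w c) b = lincomb n t v b - lincomb n t w b"
  by (simp add: lincomb_def algebra_simps sum_subtractf)

lemma lincomb_zero [simp]: "lincomb n t (\<lambda>_. 0) = (\<lambda>_. 0)"
  by (auto simp: lincomb_def)

lemma lincomb_unit_vector:
  assumes "v \<in> vectors n J"
  shows "lincomb n unit_vector v = v"
proof
  fix b
  have "lincomb n unit_vector v b = (\<Sum>c<n. if c = b then v c else 0)"
    unfolding lincomb_def unit_vector_def by (intro sum.cong) auto
  then show "lincomb n unit_vector v b = v b"
    using assms by (simp add: vectors_def)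
qed

lemma lincomb_of_unit_vector:
  assumes "c < n"
  shows "lincomb n t (unit_vector c) = t c"
proof
  fix b
  have "lincomb n t (unit_vector c) b = (\<Sum>d<n. if d = c then t d b else 0)"
    unfolding lincomb_def unit_vector_def by (intro sum.cong) auto
  then show "lincomb n t (unit_vector c) b = t c b"
    using assms by simp
qed

lemma lincomb_in_vectors:
  assumes "is_ideal J" "v \<in> vectors n J" "\<And>c. c < n \<Longrightarrow> t c \<in> vectors r UNIV"
  shows "lincomb n t v \<in> vectors r J"
  unfolding vectors_def
proof (intro CollectI conjI allI impI)
  fix b assume "b < r"
  show "lincomb n t v b \<in> J"
    unfolding lincomb_def
  proof (rule ideal.subspace_sum[OF assms(1)])
    fix c assume "c \<in> {..<n}"
    then have "v c \<in> J" using assms(2) by (simp add: vectors_def)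
    then show "v c * t c b \<in> J"
      using ideal.subspace_scale[OF assms(1), of "v c" "t c b"] by (simp add: mult.commute)
  qed
next
  fix b assume "r \<le> b"
  then show "lincomb n t v b = 0"
    unfolding lincomb_def using assms(3) by (intro sum.neutral) (auto simp: vectors_def)
qed

lemma vectors_diff: "is_ideal J \<Longrightarrow> v \<in> vectors r J \<Longrightarrow> w \<in> vectors r J \<Longrightarrow> (\<lambda>b. v b - w b) \<in> vectors r J"
  by (auto simp: vectors_def intro: ideal.subspace_diff)

lemma vectors_add: "is_ideal J \<Longrightarrow> v \<in> vectors r J \<Longrightarrow> w \<in> vectors r J \<Longrightarrow> (\<lambda>b. v b + w b) \<in> vectors r J"
  by (auto simp: vectors_def intro: ideal.subspace_add)

lemma vectors_UNIV: "v \<in> vectors r J \<Longrightarrow> v \<in> vectors r UNIV"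
  by (simp add: vectors_def)

lemma is_ideal_UNIV: "is_ideal UNIV"
  by (rule ideal.subspace_UNIV)

definition column :: "('n, 'k::field) free_complex \<Rightarrow> nat \<Rightarrow> nat \<Rightarrow> nat \<Rightarrow> ('n, 'k) mpoly" where
  "column P j c b = (if b < rank P j then diff P j b c else 0)"

lemma boundary_map_lincomb: "boundary_map P j v = lincomb (rank P (Suc j)) (column P j) v"
  by (rule ext) (auto simp: boundary_map_def lincomb_def column_def mult.commute)

lemma boundary_map_of_lincomb:
  "boundary_map P j (lincomb n t v) = lincomb n (\<lambda>c. boundary_map P j (t c)) v"
  unfolding boundary_map_lincomb lincomb_lincomb ..

lemma boundary_map_diff:
  "boundary_map P j (\<lambda>c. v c - w c) = (\<lambda>b. boundary_map P j v b - boundary_map P j w b)"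
  unfolding boundary_map_lincomb by (rule ext) (rule lincomb_diff_right)

lemma boundary_map_unit_vector: "c < rank P (Suc j) \<Longrightarrow> boundary_map P j (unit_vector c) = column P j c"
  unfolding boundary_map_lincomb by (rule lincomb_of_unit_vector)

lemma unit_vector_in_vectors: "c < r \<Longrightarrow> unit_vector c \<in> vectors r UNIV"
  by (auto simp: vectors_def unit_vector_def)

lemma boundary_map_in_vectors:
  assumes "is_ideal J" "v \<in> vectors (rank P (Suc j)) J"
  shows "boundary_map P j v \<in> vectors (rank P j) J"
  unfolding boundary_map_lincomb
  by (rule lincomb_in_vectors[OF assms]) (simp add: column_def vectors_def)

lemma lookup_mult_zero:
  fixes f g :: "('n::finite, 'k::field) mpoly"
  shows "lookup (f * g) 0 = lookup f 0 * lookup g 0"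
proof -
  have "lookup (f * g) 0 = Sum_any (\<lambda>l. lookup f l * Sum_any (\<lambda>q. lookup g q when 0 = l + q))"
    by (rule lookup_mult)
  also have "(\<lambda>l. lookup f l * Sum_any (\<lambda>q. lookup g q when 0 = l + q)) =
      (\<lambda>l. (lookup f 0 * lookup g 0) when l = 0)"
  proof
    fix l :: "'n \<Rightarrow>\<^sub>0 nat"
    have eq: "(0 = l + q) = (l = 0 \<and> q = 0)" for q
    proof
      assume *: "0 = l + q"
      have "lookup l x = 0 \<and> lookup q x = 0" for x
        using arg_cong[OF *, of "\<lambda>m. lookup m x"] by (simp add: lookup_add)
      then show "l = 0 \<and> q = 0" by (auto intro: poly_mapping_eqI)
    qed auto
    show "lookup f l * Sum_any (\<lambda>q. lookup g q when 0 = l + q) = ((lookup f 0 * lookup g 0) when l = 0)"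
      unfolding eq by (cases "l = 0") simp_all
  qed
  finally show ?thesis by simp
qed

lemma augmentation_lincomb:
  fixes P :: "('n::finite, 'k::field) free_complex"
  shows "augmentation P (lincomb n t v) = (\<Sum>c<n. lookup (v c) 0 * augmentation P (t c))"
proof -
  have "augmentation P (lincomb n t v) =
      (\<Sum>b<rank P 0. \<Sum>c<n. lookup (v c) 0 * (lookup (t c b) 0 * aug P b))"
    by (simp add: augmentation_def lincomb_def lookup_sum lookup_mult_zero sum_distrib_right mult.assoc)
  also have "\<dots> = (\<Sum>c<n. \<Sum>b<rank P 0. lookup (v c) 0 * (lookup (t c b) 0 * aug P b))"
    by (rule sum.swap)
  finally show ?thesis by (simp add: augmentation_def sum_distrib_left)
qed

lemma augmentation_diff:
  "augmentation P (\<lambda>b. v b - w b) = augmentation P v - augmentation P w"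
  by (simp add: augmentation_def lookup_minus left_diff_distrib sum_subtractf)

lemma augmentation_unit_vector: "c < rank P 0 \<Longrightarrow> augmentation P (unit_vector c) = aug P c"
proof -
  assume "c < rank P 0"
  have "augmentation P (unit_vector c) = (\<Sum>b<rank P 0. if b = c then aug P b else 0)"
    unfolding augmentation_def by (intro sum.cong) (auto simp: unit_vector_def)
  then show ?thesis using \<open>c < rank P 0\<close> by simp
qed

text \<open>Treating the augmentation as the differential out of degree 0 lets the lifting arguments
  run uniformly in \<open>j\<close>.\<close>

definition kernel :: "('n, 'k::field) free_complex \<Rightarrow> nat \<Rightarrow> (nat \<Rightarrow> ('n, 'k) mpoly) set" where
  "kernel P j = {v \<in> vectors (rank P j) UNIV.
     case j of 0 \<Rightarrow> augmentation P v = 0 | Suc i \<Rightarrow> boundary_map P i v = (\<lambda>_. 0)}"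

lemma kernel_eq_image:
  "resolves_residue_field P \<Longrightarrow> kernel P j = boundary_map P j ` vectors (rank P (Suc j)) UNIV"
  unfolding resolves_residue_field_def kernel_def by (cases j) simp_all

lemma kernel_preimage:
  assumes "resolves_residue_field P" "w \<in> kernel P j"
  shows "\<exists>v. v \<in> vectors (rank P (Suc j)) UNIV \<and> boundary_map P j v = w"
proof -
  from assms(2) obtain v where "v \<in> vectors (rank P (Suc j)) UNIV" "w = boundary_map P j v"
    unfolding kernel_eq_image[OF assms(1)] by (rule imageE)
  then show ?thesis by auto
qed

lemma column_in_kernel:
  "resolves_residue_field P \<Longrightarrow> c < rank P (Suc j) \<Longrightarrow> column P j c \<in> kernel P j"
  using boundary_map_unit_vector[of c P j] unit_vector_in_vectors[of c "rank P (Suc j)"]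
  by (subst kernel_eq_image) (auto intro: image_eqI[OF sym])

lemma boundary_map_column:
  "resolves_residue_field P \<Longrightarrow> c < rank P (Suc (Suc j)) \<Longrightarrow> boundary_map P j (column P (Suc j) c) = (\<lambda>_. 0)"
  using column_in_kernel[of P c "Suc j"] by (simp add: kernel_def)

lemma augmentation_column:
  "resolves_residue_field P \<Longrightarrow> c < rank P (Suc 0) \<Longrightarrow> augmentation P (column P 0 c) = 0"
  using column_in_kernel[of P c 0] by (simp add: kernel_def)

section \<open>Multihomogeneous components\<close>

definition component ::
  "('n, 'k::field) free_complex \<Rightarrow> nat \<Rightarrow> ('n \<Rightarrow>\<^sub>0 nat) \<Rightarrow> (nat \<Rightarrow> ('n, 'k) mpoly) \<Rightarrow> nat \<Rightarrow> ('n, 'k) mpoly" where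
  "component P i a v b = Poly_Mapping.mapp (\<lambda>m x. x when m + shift P i b = a) (v b)"

lemma lookup_component: "lookup (component P i a v b) m = (lookup (v b) m when m + shift P i b = a)"
  by (auto simp: component_def lookup_mapp in_keys_iff when_def)

lemma component_homogeneous: "component P i a v \<in> homogeneous_vectors P i a"
  by (auto simp: homogeneous_vectors_def in_keys_iff lookup_component)

lemma component_in_vectors:
  assumes "v \<in> vectors r UNIV"
  shows "component P i a v \<in> vectors r UNIV"
proof -
  have "component P i a v b = 0" if "v b = 0" for b
    by (rule poly_mapping_eqI) (simp add: lookup_component that)
  with assms show ?thesis by (auto simp: vectors_def)
qed

lemma component_of_homogeneous:
  assumes "v \<in> homogeneous_vectors P i a" "v \<in> vectors (rank P i) J"
  shows "component P i a v = v"
proof (intro ext poly_mapping_eqI)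
  fix b m
  show "lookup (component P i a v b) m = lookup (v b) m"
  proof (cases "b < rank P i")
    case True
    then show ?thesis using assms(1)
      by (cases "m \<in> keys (v b)") (auto simp: lookup_component homogeneous_vectors_def in_keys_iff)
  next
    case False
    then show ?thesis using assms(2) by (simp add: lookup_component vectors_def)
  qed
qed

text \<open>Every monomial of \<open>p\<close> accounts for the difference between the shifts
  \<open>s\<close> and \<open>t\<close>, so multiplication by \<open>p\<close> preserves
  multidegrees.\<close>

lemma lookup_mult_homogeneous:
  fixes p f :: "('n, 'k::field) mpoly"
  assumes p: "\<And>l. l \<in> keys p \<Longrightarrow> l + s = t"
    and f': "\<And>q. lookup f' q = (lookup f q when q + t = a)"
  shows "lookup (p * f') m = (lookup (p * f) m when m + s = a)"
proof -
  have *: "lookup p l * Sum_any (\<lambda>q. lookup f' q when m = l + q) =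
      (lookup p l * Sum_any (\<lambda>q. lookup f q when m = l + q) when m + s = a)" for l
  proof (cases "l \<in> keys p")
    case True
    have "(lookup f' q when m = l + q) = ((lookup f q when m = l + q) when m + s = a)" for q
    proof (cases "m = l + q")
      case True
      have "m + s = q + t" using p[OF \<open>l \<in> keys p\<close>] True by (simp add: ac_simps flip: p[OF \<open>l \<in> keys p\<close>])
      then show ?thesis using True by (simp add: f')
    qed simp
    then show ?thesis by (cases "m + s = a") simp_all
  qed (simp add: in_keys_iff)
  show ?thesis
    unfolding lookup_mult * by (cases "m + s = a") simp_all
qed

lemma component_boundary_map:
  assumes "multigraded P"
  shows "component P j a (boundary_map P j v) = boundary_map P j (component P (Suc j) a v)"
proof (intro ext poly_mapping_eqI)
  fix b m
  show "lookup (component P j a (boundary_map P j v) b) m =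
      lookup (boundary_map P j (component P (Suc j) a v) b) m"
  proof (cases "b < rank P j")
    case True
    have "lookup (diff P j b c * component P (Suc j) a v c) m =
        (lookup (diff P j b c * v c) m when m + shift P j b = a)" if "c < rank P (Suc j)" for c
      by (rule lookup_mult_homogeneous[of _ _ "shift P (Suc j) c"])
        (use assms True that in \<open>auto simp: multigraded_def lookup_component\<close>)
    then show ?thesis
      using True by (cases "m + shift P j b = a")
        (simp_all add: lookup_component boundary_map_def lookup_sum)
  qed (simp add: lookup_component boundary_map_def)
qed

text \<open>Differentials commute with taking components, so the component of degree
  \<open>a\<close> of any preimage works.\<close>

lemma homogeneous_preimage:
  assumes P: "resolves_residue_field P" and w: "w \<in> kernel P j" "w \<in> homogeneous_vectors P j a"
  obtains v where "v \<in> vectors (rank P (Suc j)) UNIV" "v \<in> homogeneous_vectors P (Suc j) a"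
    "boundary_map P j v = w"
proof -
  obtain v where v: "v \<in> vectors (rank P (Suc j)) UNIV" "w = boundary_map P j v"
    using w(1) kernel_eq_image[OF P] by blast
  have "multigraded P" using P by (simp add: resolves_residue_field_def)
  then have "boundary_map P j (component P (Suc j) a v) = component P j a w"
    by (simp add: component_boundary_map v(2))
  also have "\<dots> = w"
    by (rule component_of_homogeneous[OF w(2), of UNIV]) (use w(1) in \<open>simp add: kernel_def\<close>)
  finally show ?thesis
    using that component_in_vectors[OF v(1)] component_homogeneous by blast
qed

lemma homogeneous_lincomb:
  assumes t: "\<And>c. c < rank P i \<Longrightarrow> t c \<in> homogeneous_vectors Q j (shift P i c)"
    and v: "v \<in> homogeneous_vectors P i a"
  shows "lincomb (rank P i) t v \<in> homogeneous_vectors Q j a"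
  unfolding homogeneous_vectors_def
proof (intro CollectI allI impI ballI)
  fix b m assume b: "b < rank Q j" and "m \<in> keys (lincomb (rank P i) t v b)"
  then have "lookup (\<Sum>c<rank P i. v c * t c b) m \<noteq> 0" by (simp add: lincomb_def in_keys_iff)
  then obtain c where c: "c < rank P i" "m \<in> keys (v c * t c b)"
    unfolding lookup_sum by (elim sum.not_neutral_contains_not_neutral) (simp add: in_keys_iff)
  then obtain l q where "m = l + q" "l \<in> keys (v c)" "q \<in> keys (t c b)"
    using keys_mult[of "v c" "t c b"] by blast
  moreover from this have "l + shift P i c = a" "q + shift Q j b = shift P i c"
    using t[OF c(1)] v b c(1) by (auto simp: homogeneous_vectors_def)
  ultimately show "m + shift Q j b = a" by (simp add: add.assoc)
qed

lemma column_homogeneous: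
  "multigraded P \<Longrightarrow> c < rank P (Suc j) \<Longrightarrow> column P j c \<in> homogeneous_vectors P j (shift P (Suc j) c)"
  by (auto simp: multigraded_def homogeneous_vectors_def column_def)

text \<open>A basis element with nonzero augmentation has multidegree 0. Passing to the component of
  degree 0 keeps the augmentation of a lift, because only basis elements of \<open>Q\<close> in
  multidegree 0 contribute.\<close>

lemma augmentation_homogeneous_lift:
  fixes P Q :: "('n::finite, 'k::field) free_complex"
  assumes P: "resolves_residue_field P" and Q: "resolves_residue_field Q" and c: "c < rank P 0"
  obtains w where "w \<in> vectors (rank Q 0) UNIV" "w \<in> homogeneous_vectors Q 0 (shift P 0 c)"
    "augmentation Q w = aug P c"
proof (cases "aug P c = 0")
  case True
  show ?thesis
    by (rule that[of "\<lambda>_. 0"]) (use True in \<open>simp_all add: vectors_def homogeneous_vectors_def augmentation_def\<close>)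
next
  case False
  then have s: "shift P 0 c = 0"
    using P c by (simp add: resolves_residue_field_def multigraded_def)
  have "aug P c \<in> augmentation Q ` vectors (rank Q 0) UNIV"
    using Q by (simp add: resolves_residue_field_def)
  then obtain w where w: "w \<in> vectors (rank Q 0) UNIV" "aug P c = augmentation Q w" by blast
  have "augmentation Q (component Q 0 0 w) = augmentation Q w"
    unfolding augmentation_def
  proof (intro sum.cong refl)
    fix b assume "b \<in> {..<rank Q 0}"
    then have "aug Q b \<noteq> 0 \<longrightarrow> shift Q 0 b = 0"
      using Q by (simp add: resolves_residue_field_def multigraded_def)
    then show "lookup (component Q 0 0 w b) 0 * aug Q b = lookup (w b) 0 * aug Q b"
      by (auto simp: lookup_component)
  qed
  then show ?thesis
    using that[of "component Q 0 0 w"] component_in_vectors[OF w(1)] component_homogeneous[of Q 0 0 w] w(2) s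
    by simp
qed

section \<open>Chain maps and homotopies between resolutions\<close>

definition chain_map ::
  "('n, 'k::field) free_complex \<Rightarrow> ('n, 'k) free_complex \<Rightarrow> (nat \<Rightarrow> nat \<Rightarrow> nat \<Rightarrow> ('n, 'k) mpoly) \<Rightarrow> bool" where
  "chain_map P Q f \<longleftrightarrow>
     (\<forall>j. \<forall>c<rank P j. f j c \<in> vectors (rank Q j) UNIV \<inter> homogeneous_vectors Q j (shift P j c)) \<and>
     (\<forall>c<rank P 0. augmentation Q (f 0 c) = aug P c) \<and>
     (\<forall>j. \<forall>c<rank P (Suc j). boundary_map Q j (f (Suc j) c) = lincomb (rank P j) (f j) (column P j c))"

text \<open>Lifting degree by degree through homogeneous preimages. The predicate
  \<open>good\<close> records that the columns of the next differential are sent into the kernel,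
  which makes the next lift possible.\<close>

lemma chain_map_exists:
  fixes P Q :: "('n::finite, 'k::field) free_complex"
  assumes P: "resolves_residue_field P" and Q: "resolves_residue_field Q"
  obtains f where "chain_map P Q f"
proof -
  have mP: "multigraded P" using P by (simp add: resolves_residue_field_def)
  define good where "good j t \<longleftrightarrow>
      (\<forall>c<rank P j. t c \<in> vectors (rank Q j) UNIV \<inter> homogeneous_vectors Q j (shift P j c)) \<and>
      (\<forall>c<rank P (Suc j). lincomb (rank P j) t (column P j c) \<in> kernel Q j) \<and>
      (j = 0 \<longrightarrow> (\<forall>c<rank P 0. augmentation Q (t c) = aug P c))" for j t
  define step where "step j t t' \<longleftrightarrow>
      (\<forall>c<rank P (Suc j). boundary_map Q j (t' c) = lincomb (rank P j) t (column P j c))"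
    for j and t t' :: "nat \<Rightarrow> nat \<Rightarrow> ('n, 'k) mpoly"
  have lincomb_vec: "lincomb (rank P j) t (column P j c) \<in> vectors (rank Q j) UNIV"
    if "\<And>c. c < rank P j \<Longrightarrow> t c \<in> vectors (rank Q j) UNIV" for j t c
    by (rule lincomb_in_vectors[OF is_ideal_UNIV _ that]) (simp add: column_def vectors_def)
  have "\<exists>t. good 0 t"
  proof -
    have "\<forall>c\<in>{..<rank P 0}. \<exists>w. w \<in> vectors (rank Q 0) UNIV \<and>
        w \<in> homogeneous_vectors Q 0 (shift P 0 c) \<and> augmentation Q w = aug P c"
      using augmentation_homogeneous_lift[OF P Q] by (metis lessThan_iff)
    then obtain t where t: "\<And>c. c < rank P 0 \<Longrightarrow> t c \<in> vectors (rank Q 0) UNIV \<and>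
        t c \<in> homogeneous_vectors Q 0 (shift P 0 c) \<and> augmentation Q (t c) = aug P c"
      by (auto dest!: bchoice)
    have "lincomb (rank P 0) t (column P 0 c) \<in> kernel Q 0" if "c < rank P (Suc 0)" for c
    proof -
      have "augmentation Q (lincomb (rank P 0) t (column P 0 c)) = augmentation P (column P 0 c)"
        unfolding augmentation_lincomb augmentation_def[of P] using t by simp
      then show ?thesis
        using lincomb_vec[of 0 t c] t augmentation_column[OF P that] by (simp add: kernel_def)
    qed
    with t show ?thesis unfolding good_def by blast
  qed
  moreover have "\<exists>t'. good (Suc j) t' \<and> step j t t'" if "good j t" for j t
  proof -
    have "\<exists>w. w \<in> vectors (rank Q (Suc j)) UNIV \<and>
        w \<in> homogeneous_vectors Q (Suc j) (shift P (Suc j) c) \<and>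
        boundary_map Q j w = lincomb (rank P j) t (column P j c)" if c: "c < rank P (Suc j)" for c
    proof -
      have "lincomb (rank P j) t (column P j c) \<in> homogeneous_vectors Q j (shift P (Suc j) c)"
        using \<open>good j t\<close> column_homogeneous[OF mP c]
        by (intro homogeneous_lincomb) (auto simp: good_def)
      moreover have "lincomb (rank P j) t (column P j c) \<in> kernel Q j"
        using \<open>good j t\<close> c by (simp add: good_def)
      ultimately show ?thesis using homogeneous_preimage[OF Q] by metis
    qed
    then have "\<forall>c\<in>{..<rank P (Suc j)}. \<exists>w. w \<in> vectors (rank Q (Suc j)) UNIV \<and>
        w \<in> homogeneous_vectors Q (Suc j) (shift P (Suc j) c) \<and>
        boundary_map Q j w = lincomb (rank P j) t (column P j c)" by blast
    then obtain t' where t': "\<And>c. c < rank P (Suc j) \<Longrightarrow> t' c \<in> vectors (rank Q (Suc j)) UNIV \<and>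
        t' c \<in> homogeneous_vectors Q (Suc j) (shift P (Suc j) c) \<and>
        boundary_map Q j (t' c) = lincomb (rank P j) t (column P j c)"
      by (auto dest!: bchoice)
    have "lincomb (rank P (Suc j)) t' (column P (Suc j) c) \<in> kernel Q (Suc j)"
      if "c < rank P (Suc (Suc j))" for c
    proof -
      have "boundary_map Q j (lincomb (rank P (Suc j)) t' (column P (Suc j) c)) =
          lincomb (rank P (Suc j)) (\<lambda>d. lincomb (rank P j) t (column P j d)) (column P (Suc j) c)"
        unfolding boundary_map_of_lincomb by (rule lincomb_cong) (use t' in blast)
      also have "\<dots> = lincomb (rank P j) t (boundary_map P j (column P (Suc j) c))"
        unfolding lincomb_lincomb boundary_map_lincomb ..
      also have "\<dots> = (\<lambda>_. 0)" using boundary_map_column[OF P that] by simp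
      finally show ?thesis using lincomb_vec[of "Suc j" t' c] t' by (simp add: kernel_def)
    qed
    with t' show ?thesis unfolding good_def step_def by blast
  qed
  ultimately obtain f where "\<And>j. good j (f j)" "\<And>j. step j (f j) (f (Suc j))"
    using dependent_nat_choice[of good step] by blast
  then have "chain_map P Q f"
    unfolding chain_map_def good_def step_def by blast
  then show ?thesis by (rule that)
qed

text \<open>The same scheme, applied to \<open>f\<close> minus the homotopy built so far; this
  difference lands in the kernel because \<open>f\<close> commutes with the differentials and lifts
  zero.\<close>

lemma null_homotopy_exists:
  fixes P Q :: "('n::finite, 'k::field) free_complex"
  assumes P: "resolves_residue_field P" and Q: "resolves_residue_field Q"
    and vec: "\<And>j c. c < rank P j \<Longrightarrow> f j c \<in> vectors (rank Q j) UNIV"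
    and aug: "\<And>c. c < rank P 0 \<Longrightarrow> augmentation Q (f 0 c) = 0"
    and comm: "\<And>j c. c < rank P (Suc j) \<Longrightarrow>
      boundary_map Q j (f (Suc j) c) = lincomb (rank P j) (f j) (column P j c)"
  obtains h where "\<And>j c. c < rank P j \<Longrightarrow> h j c \<in> vectors (rank Q (Suc j)) UNIV"
    "\<And>c. c < rank P 0 \<Longrightarrow> boundary_map Q 0 (h 0 c) = f 0 c"
    "\<And>j c. c < rank P (Suc j) \<Longrightarrow> boundary_map Q (Suc j) (h (Suc j) c) =
      (\<lambda>b. f (Suc j) c b - lincomb (rank P j) (h j) (column P j c) b)"
proof -
  define good where "good j t \<longleftrightarrow>
      (\<forall>c<rank P j. t c \<in> vectors (rank Q (Suc j)) UNIV) \<and>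
      (\<forall>c<rank P (Suc j). (\<lambda>b. f (Suc j) c b - lincomb (rank P j) t (column P j c) b) \<in> kernel Q (Suc j)) \<and>
      (j = 0 \<longrightarrow> (\<forall>c<rank P 0. boundary_map Q 0 (t c) = f 0 c))" for j t
  define step where "step j t t' \<longleftrightarrow>
      (\<forall>c<rank P (Suc j). boundary_map Q (Suc j) (t' c) =
        (\<lambda>b. f (Suc j) c b - lincomb (rank P j) t (column P j c) b))"
    for j and t t' :: "nat \<Rightarrow> nat \<Rightarrow> ('n, 'k) mpoly"
  have diff_vec: "(\<lambda>b. f (Suc j) c b - lincomb (rank P j) t (column P j c) b) \<in> vectors (rank Q (Suc j)) UNIV"
    if "\<And>c. c < rank P j \<Longrightarrow> t c \<in> vectors (rank Q (Suc j)) UNIV" "c < rank P (Suc j)" for j t c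
    by (intro vectors_diff[OF is_ideal_UNIV] vec that(2) lincomb_in_vectors[OF is_ideal_UNIV _ that(1)])
      (simp add: column_def vectors_def)
  have "\<exists>t. good 0 t"
  proof -
    have "\<forall>c\<in>{..<rank P 0}. \<exists>w. w \<in> vectors (rank Q (Suc 0)) UNIV \<and> boundary_map Q 0 w = f 0 c"
    proof
      fix c assume "c \<in> {..<rank P 0}"
      then have "f 0 c \<in> kernel Q 0" using vec aug by (simp add: kernel_def)
      then show "\<exists>w. w \<in> vectors (rank Q (Suc 0)) UNIV \<and> boundary_map Q 0 w = f 0 c"
        by (rule kernel_preimage[OF Q])
    qed
    then obtain t where t: "\<And>c. c < rank P 0 \<Longrightarrow> t c \<in> vectors (rank Q (Suc 0)) UNIV \<and>
        boundary_map Q 0 (t c) = f 0 c"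
      by (auto dest!: bchoice)
    have "(\<lambda>b. f (Suc 0) c b - lincomb (rank P 0) t (column P 0 c) b) \<in> kernel Q (Suc 0)"
      if "c < rank P (Suc 0)" for c
    proof -
      have "boundary_map Q 0 (lincomb (rank P 0) t (column P 0 c)) = lincomb (rank P 0) (f 0) (column P 0 c)"
        unfolding boundary_map_of_lincomb by (rule lincomb_cong) (use t in blast)
      then show ?thesis
        using diff_vec[of 0 t c] t that comm[OF that] by (simp add: kernel_def boundary_map_diff)
    qed
    with t show ?thesis unfolding good_def by blast
  qed
  moreover have "\<exists>t'. good (Suc j) t' \<and> step j t t'" if "good j t" for j t
  proof -
    have "\<forall>c\<in>{..<rank P (Suc j)}. \<exists>w. w \<in> vectors (rank Q (Suc (Suc j))) UNIV \<and>
        boundary_map Q (Suc j) w = (\<lambda>b. f (Suc j) c b - lincomb (rank P j) t (column P j c) b)"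
    proof
      fix c assume "c \<in> {..<rank P (Suc j)}"
      then have "(\<lambda>b. f (Suc j) c b - lincomb (rank P j) t (column P j c) b) \<in> kernel Q (Suc j)"
        using that by (simp add: good_def)
      then show "\<exists>w. w \<in> vectors (rank Q (Suc (Suc j))) UNIV \<and>
        boundary_map Q (Suc j) w = (\<lambda>b. f (Suc j) c b - lincomb (rank P j) t (column P j c) b)"
        by (rule kernel_preimage[OF Q])
    qed
    then obtain t' where t': "\<And>c. c < rank P (Suc j) \<Longrightarrow> t' c \<in> vectors (rank Q (Suc (Suc j))) UNIV \<and>
        boundary_map Q (Suc j) (t' c) = (\<lambda>b. f (Suc j) c b - lincomb (rank P j) t (column P j c) b)"
      by (auto dest!: bchoice)
    have "(\<lambda>b. f (Suc (Suc j)) c b - lincomb (rank P (Suc j)) t' (column P (Suc j) c) b) \<in> kernel Q (Suc (Suc j))"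
      if c: "c < rank P (Suc (Suc j))" for c
    proof -
      have "boundary_map Q (Suc j) (lincomb (rank P (Suc j)) t' (column P (Suc j) c)) =
          lincomb (rank P (Suc j)) (\<lambda>d b. f (Suc j) d b - lincomb (rank P j) t (column P j d) b) (column P (Suc j) c)"
        unfolding boundary_map_of_lincomb by (rule lincomb_cong) (use t' in blast)
      also have "\<dots> = (\<lambda>b. lincomb (rank P (Suc j)) (f (Suc j)) (column P (Suc j) c) b -
          lincomb (rank P j) t (boundary_map P j (column P (Suc j) c)) b)"
        by (rule ext) (simp only: lincomb_diff lincomb_lincomb boundary_map_lincomb)
      also have "\<dots> = lincomb (rank P (Suc j)) (f (Suc j)) (column P (Suc j) c)"
        using boundary_map_column[OF P c] by simp
      finally show ?thesis
        using diff_vec[of "Suc j" t' c] t' c comm[OF c] by (simp add: kernel_def boundary_map_diff)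
    qed
    with t' show ?thesis unfolding good_def step_def by blast
  qed
  ultimately obtain h where "\<And>j. good j (h j)" "\<And>j. step j (h j) (h (Suc j))"
    using dependent_nat_choice[of good step] by blast
  then show ?thesis
    using that[of h] unfolding good_def step_def by blast
qed

text \<open>\<open>Tor_nonzero\<close> speaks of some resolution, so vanishing has to pass from one
  resolution to every other. For comparison maps \<open>f\<close> and \<open>g\<close>, a cycle
  \<open>z\<close> differs from \<open>g (f z)\<close> by the boundary of \<open>h z\<close>, and
  \<open>f z\<close> is a boundary by assumption.\<close>

theorem tor_vanishing_transfer:
  fixes P Q :: "('n::finite, 'k::field) free_complex"
  assumes P: "resolves_residue_field P" and Q: "resolves_residue_field Q" and J: "is_ideal J"
    and van: "cycles Q J i \<inter> homogeneous_vectors Q i a \<subseteq> boundaries Q J i"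
  shows "cycles P J i \<inter> homogeneous_vectors P i a \<subseteq> boundaries P J i"
proof
  fix z assume z: "z \<in> cycles P J i \<inter> homogeneous_vectors P i a"
  then have zJ: "z \<in> vectors (rank P i) J" by (simp add: cycles_def)
  obtain f where f: "chain_map P Q f" using chain_map_exists[OF P Q] .
  obtain g where g: "chain_map Q P g" using chain_map_exists[OF Q P] .
  have f_vec: "f j c \<in> vectors (rank Q j) UNIV" if "c < rank P j" for j c
    using f that by (simp add: chain_map_def)
  have g_vec: "g j c \<in> vectors (rank P j) UNIV" if "c < rank Q j" for j c
    using g that by (simp add: chain_map_def)
  have f_comm: "boundary_map Q j (lincomb (rank P (Suc j)) (f (Suc j)) v) =
      lincomb (rank P j) (f j) (boundary_map P j v)" for j v
    unfolding boundary_map_of_lincomb boundary_map_lincomb[of P] lincomb_lincomb[symmetric]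
    by (rule lincomb_cong) (use f in \<open>simp add: chain_map_def\<close>)
  have g_comm: "boundary_map P j (lincomb (rank Q (Suc j)) (g (Suc j)) v) =
      lincomb (rank Q j) (g j) (boundary_map Q j v)" for j v
    unfolding boundary_map_of_lincomb boundary_map_lincomb[of Q] lincomb_lincomb[symmetric]
    by (rule lincomb_cong) (use g in \<open>simp add: chain_map_def\<close>)
  \<comment> \<open>The identity minus \<open>g f\<close>; it lifts zero on the residue field and is
    therefore null-homotopic.\<close>
  define e where "e j c = (\<lambda>b. unit_vector c b - lincomb (rank Q j) (g j) (f j c) b)" for j c
  have e_lincomb: "lincomb (rank P j) (e j) v =
      (\<lambda>b. lincomb (rank P j) unit_vector v b - lincomb (rank Q j) (g j) (lincomb (rank P j) (f j) v) b)" for j v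
    unfolding e_def by (rule ext) (simp only: lincomb_diff lincomb_lincomb)
  obtain h where h_vec: "\<And>j c. c < rank P j \<Longrightarrow> h j c \<in> vectors (rank P (Suc j)) UNIV"
    and h0: "\<And>c. c < rank P 0 \<Longrightarrow> boundary_map P 0 (h 0 c) = e 0 c"
    and hS: "\<And>j c. c < rank P (Suc j) \<Longrightarrow> boundary_map P (Suc j) (h (Suc j) c) =
      (\<lambda>b. e (Suc j) c b - lincomb (rank P j) (h j) (column P j c) b)"
  proof (rule null_homotopy_exists[OF P P, of e])
    show "e j c \<in> vectors (rank P j) UNIV" if "c < rank P j" for j c
      unfolding e_def using that
      by (intro vectors_diff lincomb_in_vectors is_ideal_UNIV unit_vector_in_vectors f_vec g_vec)
    show "augmentation P (e 0 c) = 0" if "c < rank P 0" for c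
    proof -
      have "augmentation P (lincomb (rank Q 0) (g 0) (f 0 c)) = augmentation Q (f 0 c)"
        unfolding augmentation_lincomb augmentation_def[of Q] using g by (simp add: chain_map_def)
      then show ?thesis
        using f that by (simp add: e_def augmentation_diff augmentation_unit_vector chain_map_def)
    qed
    show "boundary_map P j (e (Suc j) c) = lincomb (rank P j) (e j) (column P j c)"
      if c: "c < rank P (Suc j)" for j c
    proof -
      have "boundary_map P j (e (Suc j) c) = (\<lambda>b. column P j c b -
          lincomb (rank Q j) (g j) (boundary_map Q j (f (Suc j) c)) b)"
        unfolding e_def by (rule ext) (simp add: boundary_map_diff boundary_map_unit_vector[OF c] g_comm)
      moreover have "boundary_map Q j (f (Suc j) c) = lincomb (rank P j) (f j) (column P j c)"
        using f c by (simp add: chain_map_def)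
      moreover have "lincomb (rank P j) unit_vector (column P j c) = column P j c"
        by (rule lincomb_unit_vector[of _ _ UNIV]) (simp add: vectors_def column_def)
      ultimately show ?thesis unfolding e_lincomb by simp
    qed
  qed blast
  define y where "y = lincomb (rank P i) (f i) z"
  have y: "y \<in> cycles Q J i \<inter> homogeneous_vectors Q i a"
  proof
    show "y \<in> homogeneous_vectors Q i a"
      unfolding y_def using f z by (intro homogeneous_lincomb) (auto simp: chain_map_def)
    have "y \<in> vectors (rank Q i) J"
      unfolding y_def by (rule lincomb_in_vectors[OF J zJ f_vec])
    moreover have "boundary_map Q j y = (\<lambda>_. 0)" if "i = Suc j" for j
      using z that unfolding y_def by (simp add: f_comm cycles_def)
    ultimately show "y \<in> cycles Q J i"
      by (auto simp: cycles_def split: nat.split)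
  qed
  with van obtain x where x: "x \<in> vectors (rank Q (Suc i)) J" "y = boundary_map Q i x"
    unfolding boundaries_def by blast
  define u where "u = lincomb (rank Q (Suc i)) (g (Suc i)) x"
  define w where "w = lincomb (rank P i) (h i) z"
  have u: "u \<in> vectors (rank P (Suc i)) J"
    unfolding u_def by (rule lincomb_in_vectors[OF J x(1) g_vec])
  have w: "w \<in> vectors (rank P (Suc i)) J"
    unfolding w_def by (rule lincomb_in_vectors[OF J zJ h_vec])
  have "boundary_map P i u = lincomb (rank Q i) (g i) y"
    unfolding u_def by (simp add: g_comm x(2))
  moreover have "boundary_map P i w = lincomb (rank P i) (e i) z"
  proof (cases i)
    case 0
    then show ?thesis
      unfolding w_def boundary_map_of_lincomb by (intro lincomb_cong) (simp add: h0)
  next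
    case (Suc j)
    have "boundary_map P i w = lincomb (rank P i) (\<lambda>c b. e i c b - lincomb (rank P j) (h j) (column P j c) b) z"
      unfolding w_def boundary_map_of_lincomb Suc by (intro lincomb_cong) (simp add: hS)
    also have "\<dots> = (\<lambda>b. lincomb (rank P i) (e i) z b - lincomb (rank P j) (h j) (boundary_map P j z) b)"
      unfolding Suc by (rule ext) (simp only: lincomb_diff lincomb_lincomb boundary_map_lincomb)
    also have "\<dots> = lincomb (rank P i) (e i) z"
      using z Suc by (simp add: cycles_def)
    finally show ?thesis .
  qed
  ultimately have "z = (\<lambda>b. boundary_map P i u b + boundary_map P i w b)"
    unfolding e_lincomb y_def[symmetric] lincomb_unit_vector[OF zJ] by simp
  also have "\<dots> = boundary_map P i (\<lambda>b. u b + w b)"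
    by (rule ext) (simp add: boundary_map_lincomb lincomb_def distrib_right sum.distrib)
  finally show "z \<in> boundaries P J i"
    unfolding boundaries_def using vectors_add[OF J u w] by blast
qed

section \<open>The Koszul complex\<close>

lemma poly_mapping_sum_single:
  "f = (\<Sum>m\<in>keys f. single m (lookup f m))"
proof (rule poly_mapping_eqI)
  fix k
  have "lookup (\<Sum>m\<in>keys f. single m (lookup f m)) k = (\<Sum>m\<in>keys f. if m = k then lookup f m else 0)"
    unfolding lookup_sum by (intro sum.cong refl) (simp add: lookup_single when_def)
  then show "lookup f k = lookup (\<Sum>m\<in>keys f. single m (lookup f m)) k"
    by (simp add: in_keys_iff)
qed

definition mon_ideal :: "('n \<Rightarrow>\<^sub>0 nat) set \<Rightarrow> ('n, 'k::field) mpoly set" where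
  "mon_ideal B = {f. \<forall>m\<in>keys f. \<exists>b\<in>B. b \<unlhd> m}"

lemma is_ideal_mon_ideal: "is_ideal (mon_ideal B)"
proof (rule ideal.subspaceI)
  show "0 \<in> mon_ideal B" by (simp add: mon_ideal_def)
next
  fix f g :: "('a, 'b) mpoly" assume "f \<in> mon_ideal B" "g \<in> mon_ideal B"
  then show "f + g \<in> mon_ideal B"
    using Poly_Mapping.keys_add[of f g] by (auto simp: mon_ideal_def)
next
  fix c f :: "('a, 'b) mpoly" assume f: "f \<in> mon_ideal B"
  show "c * f \<in> mon_ideal B"
    unfolding mon_ideal_def
  proof (intro CollectI ballI)
    fix m assume "m \<in> keys (c * f)"
    then obtain l q where "m = l + q" "q \<in> keys f" using keys_mult[of c f] by blast
    moreover from this obtain b where "b \<in> B" "b \<unlhd> q" using f by (auto simp: mon_ideal_def)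
    ultimately show "\<exists>b\<in>B. b \<unlhd> m"
      using divides_trans[OF _ divides_add_right[of q l]] by (auto simp: add.commute)
  qed
qed

lemma ideal_span_monom: "ideal_span (monom ` B) = mon_ideal B"
proof (intro equalityI)
  show "ideal_span (monom ` B) \<subseteq> mon_ideal B"
  proof (rule ideal.span_minimal[OF _ is_ideal_mon_ideal])
    show "monom ` B \<subseteq> mon_ideal B"
      by (auto simp: monom_def mon_ideal_def divides_def)
  qed
  show "mon_ideal B \<subseteq> ideal_span (monom ` B)"
  proof
    fix f assume f: "f \<in> mon_ideal B"
    have "(\<Sum>m\<in>keys f. single m (lookup f m)) \<in> ideal_span (monom ` B)"
    proof (rule ideal.span_sum)
      fix m assume "m \<in> keys f"
      with f obtain b where b: "b \<in> B" "b \<unlhd> m" by (auto simp: mon_ideal_def)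
      then obtain q where "m = b + q" by (auto simp: divides_iff)
      then have "single m (lookup f m) = single q (lookup f m) * monom b"
        by (simp add: monom_def mult_single add.commute)
      then show "single m (lookup f m) \<in> ideal_span (monom ` B)"
        using ideal.span_scale[OF ideal.span_base[of "monom b" "monom ` B"]] b by simp
    qed
    then show "f \<in> ideal_span (monom ` B)"
      by (simp flip: poly_mapping_sum_single)
  qed
qed

lemma lookup_single_mult:
  fixes f :: "('n, 'k::field) mpoly"
  shows "lookup (single k s * f) (k + q) = s * lookup f q"
    "(\<And>q. m \<noteq> k + q) \<Longrightarrow> lookup (single k s * f) m = 0"
proof -
  have *: "lookup (single k s * f) m = s * Sum_any (\<lambda>q. lookup f q when m = k + q)" for m
  proof -
    have "lookup (single k s * f) m =
        Sum_any (\<lambda>l. (s * Sum_any (\<lambda>q. lookup f q when m = l + q)) when l = k)"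
      unfolding lookup_mult lookup_single by (intro arg_cong[of _ _ Sum_any] ext) (auto simp: when_def)
    then show ?thesis by simp
  qed
  show "lookup (single k s * f) (k + q) = s * lookup f q"
    unfolding * by simp
  show "lookup (single k s * f) m = 0" if "\<And>q. m \<noteq> k + q"
    unfolding * using that by simp
qed

text \<open>The basis elements of a \<open>free_complex\<close> are numbered, so the faces of each
  size are enumerated in an arbitrary order.\<close>

definition face :: "nat \<Rightarrow> nat \<Rightarrow> 'n::finite set" where
  "face j = (SOME h. bij_betw h {..<card {F :: 'n set. card F = j}} {F. card F = j})"

definition face_index :: "'n::finite set \<Rightarrow> nat" where
  "face_index F = the_inv_into {..<card {G :: 'n set. card G = card F}} (face (card F)) F"

lemma bij_betw_face: "bij_betw (face j) {..<card {F :: 'n::finite set. card F = j}} {F :: 'n set. card F = j}"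
proof -
  have "\<exists>h. bij_betw h {..<card {F :: 'n set. card F = j}} {F :: 'n set. card F = j}"
    using ex_bij_betw_nat_finite[of "{F :: 'n set. card F = j}"] by (simp add: atLeast0LessThan)
  then show ?thesis unfolding face_def by (rule someI_ex)
qed

lemma card_face: "b < card {F :: 'n::finite set. card F = j} \<Longrightarrow> card (face j b :: 'n set) = j"
  using bij_betwE[OF bij_betw_face, of j] by auto

lemma face_face_index [simp]: "face (card F) (face_index F) = F"
  unfolding face_index_def
  by (rule f_the_inv_into_f_bij_betw[OF bij_betw_face]) simp

lemma face_index_less:
  fixes F :: "'n::finite set"
  shows "face_index F < card {G :: 'n set. card G = card F}"
  using bij_betw_apply[OF bij_betw_the_inv_into[OF bij_betw_face], of F "card F"]
  unfolding face_index_def by simp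

lemma face_index_face [simp]:
  "b < card {F :: 'n::finite set. card F = j} \<Longrightarrow> face_index (face j b :: 'n set) = b"
  unfolding face_index_def
  using the_inv_into_f_f[OF bij_betw_imp_inj_on[OF bij_betw_face], of b j] by (simp add: card_face)

definition koszul_entry :: "'n::{finite,linorder} set \<Rightarrow> 'n set \<Rightarrow> ('n, 'k::field) mpoly" where
  "koszul_entry G F = (\<Sum>x\<in>-G. if F = insert x G then single (single x 1) (sgn_at x G) else 0)"

definition koszul :: "('n::{finite,linorder}, 'k::field) free_complex" where
  "koszul = \<lparr>rank = (\<lambda>j. card {F :: 'n set. card F = j}),
     shift = (\<lambda>j b. indicator_mon (face j b)),
     diff = (\<lambda>j b c. koszul_entry (face j b) (face (Suc j) c)),
     aug = (\<lambda>_. 1)\<rparr>"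

lemma koszul_simps [simp]:
  "rank (koszul :: ('n::{finite,linorder}, 'k::field) free_complex) j = card {F :: 'n set. card F = j}"
  "shift (koszul :: ('n, 'k) free_complex) j b = indicator_mon (face j b)"
  "diff (koszul :: ('n, 'k) free_complex) j b c = koszul_entry (face j b) (face (Suc j) c)"
  "aug (koszul :: ('n, 'k) free_complex) b = 1"
  by (simp_all add: koszul_def)

text \<open>
  The part of \<open>v\<close> in multidegree \<open>a\<close> as a simplicial chain: the coefficient of \<open>x\<^sup>a/x\<^sup>F\<close> at the basis
  element belonging to \<open>F\<close>.
\<close>

definition strand ::
  "nat \<Rightarrow> (nat \<Rightarrow> ('n::{finite,linorder}, 'k::field) mpoly) \<Rightarrow> ('n \<Rightarrow>\<^sub>0 nat) \<Rightarrow> 'n set \<Rightarrow> 'k" where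
  "strand j v a F =
     (if card F = j \<and> indicator_mon F \<unlhd> a then lookup (v (face_index F)) (a - indicator_mon F) else 0)"

lemma boundary_map_koszul:
  fixes v :: "nat \<Rightarrow> ('n::{finite,linorder}, 'k::field) mpoly"
  assumes "card G = j"
  shows "boundary_map koszul j v (face_index G) =
    (\<Sum>x\<in>-G. single (single x 1) (sgn_at x G) * v (face_index (insert x G)))"
proof -
  let ?N = "card {F :: 'n set. card F = Suc j}"
  have "boundary_map koszul j v (face_index G) =
      (\<Sum>c<?N. koszul_entry G (face (Suc j) c) * v (face_index (face (Suc j) c :: 'n set)))"
    using face_index_less[of G] assms by (auto simp: boundary_map_def)
  also have "\<dots> = (\<Sum>F | card F = Suc j. koszul_entry G F * v (face_index F))"
    by (rule sum.reindex_bij_betw[OF bij_betw_face])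
  also have "\<dots> = (\<Sum>F | card F = Suc j. \<Sum>x\<in>-G. if F = insert x G
      then single (single x 1) (sgn_at x G) * v (face_index F) else 0)"
    unfolding koszul_entry_def sum_distrib_right by (intro sum.cong refl) simp
  also have "\<dots> = (\<Sum>x\<in>-G. \<Sum>F | card F = Suc j. if F = insert x G
      then single (single x 1) (sgn_at x G) * v (face_index F) else 0)"
    by (rule sum.swap)
  also have "\<dots> = (\<Sum>x\<in>-G. single (single x 1) (sgn_at x G) * v (face_index (insert x G)))"
    using assms by (intro sum.cong refl) simp
  finally show ?thesis .
qed

text \<open>Multiplication by the variable \<open>x\<close> moves the coefficient at
  \<open>insert x G\<close> to the one at \<open>G\<close>; the term vanishes on both sides if
  \<open>insert x G\<close> does not fit into \<open>a\<close>. In each multidegree the Koszul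
  complex thus becomes a complex of simplicial chains.\<close>

lemma strand_boundary_map: "strand j (boundary_map koszul j v) a = bd (strand (Suc j) v a)"
proof
  fix G
  show "strand j (boundary_map koszul j v) a G = bd (strand (Suc j) v a) G"
  proof (cases "card G = j \<and> indicator_mon G \<unlhd> a")
    case False
    have "strand (Suc j) v a (insert x G) = 0" if "x \<notin> G" for x
    proof -
      have "\<not> (card (insert x G) = Suc j \<and> indicator_mon (insert x G) \<unlhd> a)"
      proof
        assume *: "card (insert x G) = Suc j \<and> indicator_mon (insert x G) \<unlhd> a"
        moreover have "indicator_mon G \<unlhd> indicator_mon (insert x G)" by (simp add: divides_def)
        ultimately show False using False that divides_trans by auto
      qed
      then show ?thesis by (auto simp: strand_def)
    qed
    then have "bd (strand (Suc j) v a) G = 0" by (simp add: bd_def)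
    with False show ?thesis by (auto simp: strand_def)
  next
    case True
    then obtain q where q: "a = indicator_mon G + q" by (auto simp: divides_iff)
    have "lookup (single (single x 1) (sgn_at x G) * v (face_index (insert x G))) q =
        sgn_at x G * strand (Suc j) v a (insert x G)" if x: "x \<notin> G" for x
    proof (cases "indicator_mon (insert x G) \<unlhd> a")
      case True
      then obtain p where p: "a = indicator_mon (insert x G) + p" by (auto simp: divides_iff)
      then have "indicator_mon G + q = indicator_mon G + (single x 1 + p)"
        unfolding q using x by (simp add: indicator_mon_insert ac_simps)
      then have "q = single x 1 + p" by (rule add_left_imp_eq)
      then show ?thesis
        using True x \<open>card G = j \<and> _\<close> by (simp add: strand_def p lookup_single_mult)
    next
      case False
      have "q \<noteq> single x 1 + p" for p
      proof
        assume "q = single x 1 + p"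
        then have "a = indicator_mon (insert x G) + p"
          unfolding q using x by (simp add: indicator_mon_insert ac_simps)
        with False show False by (simp add: divides_add_right)
      qed
      with False show ?thesis by (simp add: strand_def lookup_single_mult(2))
    qed
    then show ?thesis
      using True by (simp add: strand_def[of j] boundary_map_koszul lookup_sum q bd_def)
  qed
qed

lemma strand_eqI:
  fixes v w :: "nat \<Rightarrow> ('n::{finite,linorder}, 'k::field) mpoly"
  assumes "v \<in> vectors (card {F :: 'n set. card F = j}) UNIV"
    "w \<in> vectors (card {F :: 'n set. card F = j}) UNIV" "\<And>a. strand j v a = strand j w a"
  shows "v = w"
proof
  fix b
  show "v b = w b"
  proof (cases "b < card {F :: 'n set. card F = j}")
    case True
    have "lookup (u b) m = strand j u (m + indicator_mon (face j b)) (face j b)"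
      for m and u :: "nat \<Rightarrow> ('n, 'k) mpoly"
      using True by (simp add: strand_def card_face divides_def lookup_add)
    with assms(3) show ?thesis by (intro poly_mapping_eqI) simp
  next
    case False
    with assms show ?thesis by (simp add: vectors_def)
  qed
qed

text \<open>The inverse of \<open>strand\<close>, assembling chains from all multidegrees.
  \<open>Abs_poly_mapping\<close> is meaningful only if each entry has finite support.\<close>

definition vector_of ::
  "nat \<Rightarrow> (('n::{finite,linorder} \<Rightarrow>\<^sub>0 nat) \<Rightarrow> 'n set \<Rightarrow> 'k::field) \<Rightarrow> nat \<Rightarrow> ('n, 'k) mpoly" where
  "vector_of j e b = (if b < card {F :: 'n set. card F = j}
     then Abs_poly_mapping (\<lambda>m. e (m + indicator_mon (face j b)) (face j b)) else 0)"

lemma vector_of_in_vectors: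
  fixes e :: "('n::{finite,linorder} \<Rightarrow>\<^sub>0 nat) \<Rightarrow> 'n set \<Rightarrow> 'k::field"
  shows "vector_of j e \<in> vectors (card {F :: 'n set. card F = j}) UNIV"
  by (simp add: vectors_def vector_of_def)

lemma lookup_vector_of:
  fixes e :: "('n::{finite,linorder} \<Rightarrow>\<^sub>0 nat) \<Rightarrow> 'n set \<Rightarrow> 'k::field"
  assumes "\<And>F. finite {m. e (m + indicator_mon F) F \<noteq> 0}" "b < card {F :: 'n set. card F = j}"
  shows "lookup (vector_of j e b) m = e (m + indicator_mon (face j b)) (face j b)"
  using assms by (simp add: vector_of_def)

lemma strand_vector_of:
  assumes "\<And>F. finite {m. e (m + indicator_mon F) F \<noteq> 0}"
  shows "strand j (vector_of j e) a F = (if card F = j \<and> indicator_mon F \<unlhd> a then e a F else 0)"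
proof (cases "card F = j \<and> indicator_mon F \<unlhd> a")
  case True
  then obtain q where "a = indicator_mon F + q" by (auto simp: divides_iff)
  then show ?thesis
    using True face_index_less[of F] assms
    by (auto simp: strand_def lookup_vector_of add.commute)
qed (auto simp: strand_def)

text \<open>In a multidegree \<open>a \<noteq> 0\<close>, coning with a variable that occurs in
  \<open>a\<close> fills the strand. The fillings for all \<open>a\<close> assemble to polynomials,
  since each of their monomials stems from a monomial of \<open>v\<close>.\<close>

lemma koszul_exact:
  fixes v :: "nat \<Rightarrow> ('n::{finite,linorder}, 'k::field) mpoly"
  assumes v: "v \<in> vectors (card {F :: 'n set. card F = j}) UNIV"
    and cyc: "\<And>a. bd (strand j v a) = (\<lambda>_. 0)" and zero: "strand j v 0 = (\<lambda>_. 0)"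
  obtains w where "w \<in> vectors (card {F :: 'n set. card F = Suc j}) UNIV" "boundary_map koszul j w = v"
proof -
  define pivot where "pivot a = (SOME x. lookup a x \<noteq> 0)" for a :: "'n \<Rightarrow>\<^sub>0 nat"
  have pivot: "lookup a (pivot a) \<noteq> 0" if "a \<noteq> 0" for a
  proof -
    have "\<exists>x. lookup a x \<noteq> 0"
    proof (rule ccontr)
      assume "\<not> (\<exists>x. lookup a x \<noteq> 0)"
      then have "a = 0" by (intro poly_mapping_eqI) simp
      with that show False ..
    qed
    then show ?thesis unfolding pivot_def by (rule someI_ex)
  qed
  define e where "e a = (if a = 0 then (\<lambda>_. 0) else cone (pivot a) (strand j v a))" for a
  have e_supp: "\<exists>x q. x \<in> F \<and> card F = Suc j \<and> a = indicator_mon F + q \<and>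
      single x 1 + q \<in> keys (v (face_index (F - {x})))" if nz: "e a F \<noteq> 0" for a F
  proof -
    have a: "a \<noteq> 0" and x: "pivot a \<in> F" and s: "strand j v a (F - {pivot a}) \<noteq> 0"
      using nz by (auto simp: e_def cone_def split: if_splits)
    from s have card: "card (F - {pivot a}) = j" and le: "indicator_mon (F - {pivot a}) \<unlhd> a"
      and key: "a - indicator_mon (F - {pivot a}) \<in> keys (v (face_index (F - {pivot a})))"
      by (auto simp: strand_def in_keys_iff split: if_splits)
    have "indicator_mon F \<unlhd> a"
      unfolding divides_def
    proof
      fix y show "lookup (indicator_mon F) y \<le> lookup a y"
        using le pivot[OF a] unfolding divides_def by (cases "y = pivot a") (auto dest: spec[of _ y])
    qed
    then obtain q where q: "a = indicator_mon F + q" by (auto simp: divides_iff)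
    have "indicator_mon F = single (pivot a) 1 + indicator_mon (F - {pivot a})"
      using indicator_mon_insert[of "pivot a" "F - {pivot a}"] x by (simp add: insert_absorb)
    then have "a = indicator_mon (F - {pivot a}) + (single (pivot a) 1 + q)"
      using q by (simp only: ac_simps)
    then have "a - indicator_mon (F - {pivot a}) = single (pivot a) 1 + q"
      by (metis add_diff_cancel_left')
    with key q x card card_Suc_Diff1[of F "pivot a"] show ?thesis by auto
  qed
  have fin: "finite {m. e (m + indicator_mon F) F \<noteq> 0}" for F
  proof (rule finite_subset)
    show "{m. e (m + indicator_mon F) F \<noteq> 0} \<subseteq>
        (\<Union>x\<in>F. (\<lambda>q. single x 1 + q) -` keys (v (face_index (F - {x}))))"
    proof
      fix m assume "m \<in> {m. e (m + indicator_mon F) F \<noteq> 0}"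
      then obtain x q where "x \<in> F" "m + indicator_mon F = indicator_mon F + q"
        "single x 1 + q \<in> keys (v (face_index (F - {x})))"
        using e_supp by blast
      then show "m \<in> (\<Union>x\<in>F. (\<lambda>q. single x 1 + q) -` keys (v (face_index (F - {x}))))"
        by (auto simp: add.commute[of m])
    qed
    show "finite (\<Union>x\<in>F. (\<lambda>q. single x 1 + q) -` keys (v (face_index (F - {x}))))"
      by (intro finite_UN_I finite finite_vimageI injI) auto
  qed
  define w where "w = vector_of (Suc j) e"
  have w: "w \<in> vectors (card {F :: 'n set. card F = Suc j}) UNIV"
    unfolding w_def by (rule vector_of_in_vectors)
  have "strand (Suc j) w a = e a" for a
  proof
    fix F
    have "e a F = 0" if "\<not> (card F = Suc j \<and> indicator_mon F \<unlhd> a)"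
      using e_supp[of a F] that divides_add_right by blast
    then show "strand (Suc j) w a F = e a F"
      unfolding w_def strand_vector_of[OF fin] by auto
  qed
  then have "strand j (boundary_map koszul j w) a = strand j v a" for a
    unfolding strand_boundary_map using zero by (auto simp: e_def bd_cone cyc)
  moreover have "boundary_map koszul j w \<in> vectors (card {F :: 'n set. card F = j}) UNIV"
    using boundary_map_in_vectors[OF is_ideal_UNIV, of w koszul j] w by simp
  ultimately have "boundary_map koszul j w = v"
    using strand_eqI[OF _ v] by blast
  with w show ?thesis by (rule that)
qed

lemma not_indicator_mon_divides_zero: "x \<in> F \<Longrightarrow> \<not> indicator_mon F \<unlhd> 0"
  by (auto simp: divides_def of_bool_def)

lemma strand_Suc_zero [simp]: "strand (Suc j) v 0 = (\<lambda>_. 0)"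
proof
  fix F
  show "strand (Suc j) v 0 F = 0"
  proof (cases "F = {}")
    case False
    then show ?thesis using not_indicator_mon_divides_zero by (auto simp: strand_def)
  qed (simp add: strand_def)
qed

lemma strand_of_zero [simp]: "strand j (\<lambda>_. 0) a = (\<lambda>_. 0)"
  by (auto simp: strand_def)

lemma boundary_map_koszul_twice:
  fixes v :: "nat \<Rightarrow> ('n::{finite,linorder}, 'k::field) mpoly"
  assumes "v \<in> vectors (card {F :: 'n set. card F = Suc (Suc j)}) UNIV"
  shows "boundary_map koszul j (boundary_map koszul (Suc j) v) = (\<lambda>_. 0)"
proof (rule strand_eqI)
  have "boundary_map koszul (Suc j) v \<in> vectors (card {F :: 'n set. card F = Suc j}) UNIV"
    using boundary_map_in_vectors[OF is_ideal_UNIV, of v koszul "Suc j"] assms by simp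
  then show "boundary_map koszul j (boundary_map koszul (Suc j) v) \<in>
      vectors (card {F :: 'n set. card F = j}) UNIV"
    using boundary_map_in_vectors[OF is_ideal_UNIV, of _ koszul j] by simp
qed (auto simp: vectors_def strand_boundary_map bd_bd)

lemma augmentation_koszul:
  fixes v :: "nat \<Rightarrow> ('n::{finite,linorder}, 'k::field) mpoly"
  shows "augmentation koszul v = lookup (v 0) 0"
proof -
  have "{F :: 'n set. card F = 0} = {{}}" by auto
  then show ?thesis by (simp add: augmentation_def)
qed

lemma strand_zero:
  fixes v :: "nat \<Rightarrow> ('n::{finite,linorder}, 'k::field) mpoly"
  shows "strand 0 v a {} = lookup (v 0) a"
proof -
  have "{F :: 'n set. card F = 0} = {{}}" by auto
  then have "face_index ({} :: 'n set) = 0"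
    using face_index_less[of "{} :: 'n set"] by simp
  then show ?thesis by (simp add: strand_def divides_def)
qed

lemma resolves_koszul:
  "resolves_residue_field (koszul :: ('n::{finite,linorder}, 'k::field) free_complex)"
proof -
  let ?K = "koszul :: ('n, 'k) free_complex"
  let ?N = "\<lambda>j. card {F :: 'n set. card F = j}"
  have "multigraded ?K"
    unfolding multigraded_def
  proof (intro conjI allI impI ballI)
    fix j b c m
    assume *: "b < rank ?K j" "c < rank ?K (Suc j)" "m \<in> keys (diff ?K j b c)"
    let ?G = "face j b :: 'n set" and ?F = "face (Suc j) c :: 'n set"
    from * have "m \<in> keys (\<Sum>x\<in>-?G. if ?F = insert x ?G then single (single x 1) (sgn_at x ?G :: 'k) else 0)"
      by (simp add: koszul_entry_def)
    from subsetD[OF keys_sum this]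
    have "m \<in> (\<Union>x\<in>-?G. keys (if ?F = insert x ?G then single (single x 1) (sgn_at x ?G :: 'k) else 0))" .
    then obtain x where "x \<notin> ?G" "?F = insert x ?G" "m = single x 1"
      by (auto split: if_splits)
    then show "m + shift ?K j b = shift ?K (Suc j) c"
      by (simp add: indicator_mon_insert)
  next
    fix b assume "b < rank ?K 0"
    then show "shift ?K 0 b = 0" using card_face[of b 0, where 'n = 'n] by simp
  qed
  moreover have "augmentation ?K ` vectors (rank ?K 0) UNIV = UNIV"
  proof (intro equalityI subsetI)
    fix k :: 'k
    let ?v = "\<lambda>b. if b = 0 then single 0 k else 0 :: ('n, 'k) mpoly"
    have "{F :: 'n set. card F = 0} = {{}}" by auto
    then have "?v \<in> vectors (rank ?K 0) UNIV" by (simp add: vectors_def)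
    moreover have "augmentation ?K ?v = k" by (simp add: augmentation_koszul)
    ultimately show "k \<in> augmentation ?K ` vectors (rank ?K 0) UNIV" by (metis imageI)
  qed simp
  moreover have "{v \<in> vectors (rank ?K 0) UNIV. augmentation ?K v = 0} =
      boundary_map ?K 0 ` vectors (rank ?K 1) UNIV"
  proof (intro equalityI subsetI)
    fix v assume "v \<in> {v \<in> vectors (rank ?K 0) UNIV. augmentation ?K v = 0}"
    then have v: "v \<in> vectors (?N 0) UNIV" "lookup (v 0) 0 = 0" by (auto simp: augmentation_koszul)
    have s0: "strand 0 v a F = 0" if "F \<noteq> {}" for a F using that by (simp add: strand_def)
    have "bd (strand 0 v a) = (\<lambda>_. 0)" for a by (rule ext) (simp add: bd_def s0)
    moreover have "strand 0 v 0 F = 0" for F using s0[of F] v by (cases "F = {}") (simp_all add: strand_zero)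
    ultimately obtain w where "w \<in> vectors (?N (Suc 0)) UNIV" "boundary_map ?K 0 w = v"
      using koszul_exact[OF v(1)] by blast
    then show "v \<in> boundary_map ?K 0 ` vectors (rank ?K 1) UNIV" by auto
  next
    fix v assume "v \<in> boundary_map ?K 0 ` vectors (rank ?K 1) UNIV"
    then obtain w where w: "w \<in> vectors (rank ?K (Suc 0)) UNIV" "v = boundary_map ?K 0 w" by auto
    have "lookup (v 0) 0 = bd (strand (Suc 0) w 0) {}"
      unfolding strand_boundary_map[symmetric] w(2) strand_zero ..
    then have "augmentation ?K v = 0" by (simp add: augmentation_koszul)
    with w boundary_map_in_vectors[OF is_ideal_UNIV w(1)]
    show "v \<in> {v \<in> vectors (rank ?K 0) UNIV. augmentation ?K v = 0}" by simp
  qed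
  moreover have "{v \<in> vectors (rank ?K (Suc j)) UNIV. boundary_map ?K j v = (\<lambda>_. 0)} =
      boundary_map ?K (Suc j) ` vectors (rank ?K (Suc (Suc j))) UNIV" for j
  proof (intro equalityI subsetI)
    fix v assume "v \<in> {v \<in> vectors (rank ?K (Suc j)) UNIV. boundary_map ?K j v = (\<lambda>_. 0)}"
    then have v: "v \<in> vectors (?N (Suc j)) UNIV" "boundary_map ?K j v = (\<lambda>_. 0)" by auto
    have "bd (strand (Suc j) v a) = (\<lambda>_. 0)" for a
      unfolding strand_boundary_map[symmetric] v(2) by simp
    then obtain w where "w \<in> vectors (?N (Suc (Suc j))) UNIV" "boundary_map ?K (Suc j) w = v"
      using koszul_exact[OF v(1)] strand_Suc_zero by blast
    then show "v \<in> boundary_map ?K (Suc j) ` vectors (rank ?K (Suc (Suc j))) UNIV" by auto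
  next
    fix v assume "v \<in> boundary_map ?K (Suc j) ` vectors (rank ?K (Suc (Suc j))) UNIV"
    then obtain w where w: "w \<in> vectors (rank ?K (Suc (Suc j))) UNIV" "v = boundary_map ?K (Suc j) w" by auto
    with boundary_map_in_vectors[OF is_ideal_UNIV w(1)] boundary_map_koszul_twice[of w j]
    show "v \<in> {v \<in> vectors (rank ?K (Suc j)) UNIV. boundary_map ?K j v = (\<lambda>_. 0)}" by simp
  qed
  ultimately show ?thesis unfolding resolves_residue_field_def by blast
qed

text \<open>A coefficient at \<open>F\<close> belongs to the monomial \<open>a\<close> minus
  \<open>F\<close>, which has to lie in the ideal; this is what membership in the complex
  says.\<close>

lemma strand_in_simplicial_chains:
  fixes z :: "nat \<Rightarrow> ('n::{finite,linorder}, 'k::field) mpoly"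
  assumes "z \<in> vectors (card {F :: 'n set. card F = i}) (mon_ideal B)"
  shows "strand i z a \<in> simplicial_chains (shift_complex B a) i"
  unfolding simplicial_chains_def
proof (intro CollectI allI impI)
  fix F assume "strand i z a F \<noteq> 0"
  then have F: "card F = i" "indicator_mon F \<unlhd> a" "a - indicator_mon F \<in> keys (z (face_index F))"
    by (auto simp: strand_def in_keys_iff split: if_splits)
  from F(2) obtain q where q: "a = indicator_mon F + q" by (auto simp: divides_iff)
  have "z (face_index F) \<in> mon_ideal B"
    using assms face_index_less[of F] F(1) by (simp add: vectors_def)
  with F(3) obtain b where "b \<in> B" "b \<unlhd> q" by (auto simp: mon_ideal_def q)
  then show "F \<in> shift_complex B a \<and> card F = i"
    using F(1) divides_add_mono[of b q "indicator_mon F" "indicator_mon F"]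
    by (auto simp: shift_complex_def q add.commute divides_def)
qed

lemma chain_vector:
  fixes c :: "'n::{finite,linorder} set \<Rightarrow> 'k::field"
  assumes c: "c \<in> simplicial_chains (shift_complex B a) i"
  defines "z \<equiv> vector_of i (\<lambda>a'. if a' = a then c else (\<lambda>_. 0))"
  shows "z \<in> vectors (card {F :: 'n set. card F = i}) (mon_ideal B)"
    "z \<in> homogeneous_vectors koszul i a"
    "strand i z a' = (if a' = a then c else (\<lambda>_. 0))"
proof -
  have fin: "finite {m. (if m + indicator_mon F = a then c else (\<lambda>_. 0)) F \<noteq> 0}" for F
    by (rule finite_subset[of _ "{a - indicator_mon F}"]) (auto split: if_splits)
  have key: "\<exists>b0\<in>B. b0 \<unlhd> m" "m + indicator_mon (face i b) = a"
    if b: "b < card {F :: 'n set. card F = i}" and m: "m \<in> keys (z b)" for b m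
  proof -
    have nz: "m + indicator_mon (face i b) = a" "c (face i b) \<noteq> 0"
      using m unfolding in_keys_iff z_def lookup_vector_of[OF fin b] by (auto split: if_splits)
    then have "face i b \<in> shift_complex B a" using c by (auto simp: simplicial_chains_def)
    then obtain b0 where "b0 \<in> B" "b0 + indicator_mon (face i b) \<unlhd> m + indicator_mon (face i b)"
      unfolding shift_complex_def nz(1) by auto
    then show "\<exists>b0\<in>B. b0 \<unlhd> m" by (auto simp: divides_def lookup_add)
    show "m + indicator_mon (face i b) = a" by (rule nz(1))
  qed
  then show "z \<in> vectors (card {F :: 'n set. card F = i}) (mon_ideal B)"
    using vector_of_in_vectors[of i] unfolding z_def by (simp add: vectors_def mon_ideal_def)
  show "z \<in> homogeneous_vectors koszul i a"
    using key by (simp add: homogeneous_vectors_def)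
  show "strand i z a' = (if a' = a then c else (\<lambda>_. 0))"
  proof
    fix F
    have "c F = 0" if "\<not> (card F = i \<and> indicator_mon F \<unlhd> a)"
    proof (rule ccontr)
      assume "c F \<noteq> 0"
      with c have "card F = i" "F \<in> shift_complex B a" by (auto simp: simplicial_chains_def)
      moreover from this obtain b where "b + indicator_mon F \<unlhd> a" by (auto simp: shift_complex_def)
      then have "indicator_mon F \<unlhd> a"
        using divides_trans[OF divides_add_right[of "indicator_mon F" b]] by (simp add: add.commute)
      ultimately show False using that by simp
    qed
    then show "strand i z a' F = (if a' = a then c else (\<lambda>_. 0)) F"
      unfolding z_def strand_vector_of[OF fin] by auto
  qed
qed

lemma koszul_tor_vanishes:
  fixes B :: "('n::{finite,linorder} \<Rightarrow>\<^sub>0 nat) set"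
  assumes ac: "acyclic_at TYPE('k::field) (shift_complex B a) i"
  shows "cycles (koszul :: ('n, 'k) free_complex) (mon_ideal B) i \<inter> homogeneous_vectors koszul i a \<subseteq>
    boundaries koszul (mon_ideal B) i"
proof
  fix z assume "z \<in> cycles (koszul :: ('n, 'k) free_complex) (mon_ideal B) i \<inter> homogeneous_vectors koszul i a"
  then have zc: "z \<in> cycles (koszul :: ('n, 'k) free_complex) (mon_ideal B) i"
    and zh: "z \<in> homogeneous_vectors koszul i a" by auto
  then have z: "z \<in> vectors (card {F :: 'n set. card F = i}) (mon_ideal B)"
    by (simp add: cycles_def)
  have "bd (strand i z a) = (\<lambda>_. 0)"
  proof (cases i)
    case 0
    then show ?thesis by (auto simp: bd_def strand_def)
  next
    case (Suc j)
    then have "boundary_map koszul j z = (\<lambda>_. 0)" using zc by (simp add: cycles_def)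
    then show ?thesis by (simp add: Suc flip: strand_boundary_map)
  qed
  then obtain e where e: "e \<in> simplicial_chains (shift_complex B a) (Suc i)" "bd e = strand i z a"
    using ac strand_in_simplicial_chains[OF z, of a] unfolding acyclic_at_def by blast
  define y where "y = vector_of (Suc i) (\<lambda>a'. if a' = a then e else (\<lambda>_. 0))"
  note y = chain_vector[OF e(1), folded y_def]
  have "boundary_map koszul i y = z"
  proof (rule strand_eqI)
    show "boundary_map koszul i y \<in> vectors (card {F :: 'n set. card F = i}) UNIV"
      using boundary_map_in_vectors[OF is_ideal_UNIV, of y koszul i] vectors_UNIV[OF y(1)] by simp
    show "z \<in> vectors (card {F :: 'n set. card F = i}) UNIV" by (rule vectors_UNIV[OF z])
    show "strand i (boundary_map koszul i y) a' = strand i z a'" for a'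
    proof (cases "a' = a")
      case True
      then show ?thesis by (simp add: strand_boundary_map y(3) e(2))
    next
      case False
      \<comment> \<open>Homogeneity confines \<open>z\<close> to the multidegree
        \<open>a\<close>.\<close>
      have "strand i z a' F = 0" for F
      proof (rule ccontr)
        assume "strand i z a' F \<noteq> 0"
        then have F: "card F = i" "indicator_mon F \<unlhd> a'" "a' - indicator_mon F \<in> keys (z (face_index F))"
          by (auto simp: strand_def in_keys_iff split: if_splits)
        from F(2) obtain q where q: "a' = indicator_mon F + q" by (auto simp: divides_iff)
        have "q + indicator_mon (face i (face_index F)) = a"
          using zh F face_index_less[of F] by (auto simp: homogeneous_vectors_def q)
        then show False using False F(1) q by (auto simp: add.commute)
      qed
      moreover have "bd (strand (Suc i) y a') = (\<lambda>_. 0)" using False by (auto simp: y(3))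
      ultimately show ?thesis by (auto simp: strand_boundary_map)
    qed
  qed
  with y(1) show "z \<in> boundaries koszul (mon_ideal B) i"
    unfolding boundaries_def by auto
qed

text \<open>There are no nonzero chains of degree \<open>i + 1\<close>, so a nonzero cycle of degree
  \<open>i\<close> cannot be a boundary.\<close>

lemma koszul_tor_nonzero:
  fixes B :: "('n::{finite,linorder} \<Rightarrow>\<^sub>0 nat) set" and c :: "'n set \<Rightarrow> 'k::field"
  assumes c: "c \<in> simplicial_chains (shift_complex B a) i" "bd c = (\<lambda>_. 0)" "c \<noteq> (\<lambda>_. 0)"
    and top: "\<And>F. F \<in> shift_complex B a \<Longrightarrow> card F \<le> i"
  shows "\<not> cycles (koszul :: ('n, 'k) free_complex) (mon_ideal B) i \<inter> homogeneous_vectors koszul i a \<subseteq>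
    boundaries koszul (mon_ideal B) i"
proof
  assume sub: "cycles (koszul :: ('n, 'k) free_complex) (mon_ideal B) i \<inter> homogeneous_vectors koszul i a \<subseteq>
    boundaries koszul (mon_ideal B) i"
  define z where "z = vector_of i (\<lambda>a'. if a' = a then c else (\<lambda>_. 0))"
  note z = chain_vector[OF c(1), folded z_def]
  have "boundary_map koszul j z = (\<lambda>_. 0)" if "i = Suc j" for j
  proof (rule strand_eqI)
    show "boundary_map koszul j z \<in> vectors (card {F :: 'n set. card F = j}) UNIV"
      using boundary_map_in_vectors[OF is_ideal_UNIV, of z koszul j] vectors_UNIV[OF z(1)] that by simp
    show "strand j (boundary_map koszul j z) a' = strand j (\<lambda>_. 0) a'" for a'
      by (auto simp: strand_boundary_map z(3)[unfolded that] c(2))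
  qed (simp add: vectors_def)
  then have "z \<in> cycles (koszul :: ('n, 'k) free_complex) (mon_ideal B) i"
    using z(1) by (auto simp: cycles_def split: nat.split)
  with sub z(2) obtain y where y: "y \<in> vectors (card {F :: 'n set. card F = Suc i}) (mon_ideal B)"
    "z = boundary_map koszul i y"
    unfolding boundaries_def by auto
  have "strand (Suc i) y a = (\<lambda>_. 0)"
  proof
    fix F
    show "strand (Suc i) y a F = 0"
      using strand_in_simplicial_chains[OF y(1), of a] top[of F]
      by (fastforce simp: simplicial_chains_def)
  qed
  then have "strand i z a = (\<lambda>_. 0)" by (auto simp: y(2) strand_boundary_map)
  with z(3)[of a] c(3) show False by simp
qed

text \<open>The complex is void or a matroid. At rank above \<open>i\<close> it is acyclic in degree
  \<open>i\<close>; at rank below \<open>i\<close> there are no nonzero chains; at rank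
  \<open>i\<close> a coloop makes it a cone, and otherwise there is a nonzero top cycle. Vanishing
  passes from the Koszul complex to all resolutions.\<close>

theorem Tor_nonzero_iff:
  fixes B :: "('n::{finite,linorder} \<Rightarrow>\<^sub>0 nat) set"
  assumes B: "M_convex d B"
  shows "Tor_nonzero i (mon_ideal B :: ('n, 'k::field) mpoly set) a \<longleftrightarrow> a \<in> syzygy_degrees i B"
proof
  assume a: "a \<in> syzygy_degrees i B"
  note \<Delta> = a[unfolded syzygy_degrees_iff_shift_complex[OF B]]
  then obtain G where "G \<in> shift_complex B a" "card G = i" by blast
  with \<Delta> matroid_shift_complex[OF B] obtain c :: "'n set \<Rightarrow> 'k" where
    "c \<in> simplicial_chains (shift_complex B a) i" "bd c = (\<lambda>_. 0)" "c \<noteq> (\<lambda>_. 0)"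
    using matroid_top_cycle[of "shift_complex B a" i G] by metis
  then have "\<not> cycles (koszul :: ('n, 'k) free_complex) (mon_ideal B) i \<inter> homogeneous_vectors koszul i a \<subseteq>
      boundaries koszul (mon_ideal B) i"
    using \<Delta> by (intro koszul_tor_nonzero) auto
  then show "Tor_nonzero i (mon_ideal B :: ('n, 'k) mpoly set) a"
    unfolding Tor_nonzero_def using resolves_koszul by blast
next
  assume T: "Tor_nonzero i (mon_ideal B :: ('n, 'k) mpoly set) a"
  show "a \<in> syzygy_degrees i B"
  proof (rule ccontr)
    assume a: "a \<notin> syzygy_degrees i B"
    have trivial: "acyclic_at TYPE('k) (shift_complex B a) i"
      if "\<And>F. F \<in> shift_complex B a \<Longrightarrow> card F \<noteq> i"
      unfolding acyclic_at_def
    proof (intro ballI impI)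
      fix c :: "'n set \<Rightarrow> 'k" assume "c \<in> simplicial_chains (shift_complex B a) i"
      with that have "c = (\<lambda>_. 0)" by (auto simp: simplicial_chains_def)
      then show "\<exists>e\<in>simplicial_chains (shift_complex B a) (Suc i). bd e = c"
        by (intro bexI[of _ "\<lambda>_. 0"]) (auto simp: simplicial_chains_def)
    qed
    have "acyclic_at TYPE('k) (shift_complex B a) i"
    proof (cases "{} \<in> shift_complex B a")
      case False
      have "F \<notin> shift_complex B a" for F
      proof
        assume "F \<in> shift_complex B a"
        then obtain b where "b \<in> B" "b + indicator_mon F \<unlhd> a" by (auto simp: shift_complex_def)
        then have "{} \<in> shift_complex B a"
          using divides_trans[OF divides_add_right[of b "indicator_mon F"]] by (auto simp: shift_complex_def)
        with False show False ..
      qed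
      then show ?thesis by (intro trivial) blast
    next
      case True
      note m = matroid_shift_complex[OF B True]
      show ?thesis
      proof (cases "\<exists>F\<in>shift_complex B a. i < card F")
        case True
        then show ?thesis using matroid_acyclic_below_rank[OF m] by blast
      next
        case False
        then have le: "\<forall>F\<in>shift_complex B a. card F \<le> i" by (simp add: not_less)
        show ?thesis
        proof (cases "\<exists>F\<in>shift_complex B a. card F = i")
          case False
          then show ?thesis by (intro trivial) blast
        next
          case True
          with a le \<open>{} \<in> shift_complex B a\<close>
          have "\<exists>x. \<forall>F\<in>shift_complex B a. insert x F \<in> shift_complex B a"
            unfolding syzygy_degrees_iff_shift_complex[OF B] by blast
          then obtain x where "\<And>F. F \<in> shift_complex B a \<Longrightarrow> insert x F \<in> shift_complex B a" by blast
          then show ?thesis by (rule acyclic_at_coloop)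
        qed
      qed
    qed
    then have "cycles P (mon_ideal B) i \<inter> homogeneous_vectors P i a \<subseteq> boundaries P (mon_ideal B) i"
      if "resolves_residue_field P" for P :: "('n, 'k) free_complex"
      using tor_vanishing_transfer[OF that resolves_koszul is_ideal_mon_ideal] koszul_tor_vanishes by blast
    with T show False unfolding Tor_nonzero_def by blast
  qed
qed

corollary HS_mon_ideal:
  fixes B :: "('n::{finite,linorder} \<Rightarrow>\<^sub>0 nat) set"
  assumes "M_convex d B"
  shows "HS i (mon_ideal B) = mon_ideal (syzygy_degrees i B)"
  unfolding HS_def Tor_nonzero_iff[OF assms] by (simp add: ideal_span_monom)

section \<open>Associated primes\<close>

lemma monom_in_mon_ideal: "(monom m :: ('n, 'k::field) mpoly) \<in> mon_ideal A \<longleftrightarrow> (\<exists>a\<in>A. a \<unlhd> m)"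
  by (simp add: monom_def mon_ideal_def)

lemma ideal_mult_mon_ideal:
  "ideal_mult (mon_ideal B) (mon_ideal C) = (mon_ideal (sumset B C) :: ('n, 'k::field) mpoly set)"
proof (intro equalityI)
  show "ideal_mult (mon_ideal B) (mon_ideal C) \<subseteq> (mon_ideal (sumset B C) :: ('n, 'k) mpoly set)"
    unfolding ideal_mult_def
  proof (rule ideal.span_minimal[OF _ is_ideal_mon_ideal], safe)
    fix f g :: "('n, 'k) mpoly" assume fg: "f \<in> mon_ideal B" "g \<in> mon_ideal C"
    show "f * g \<in> mon_ideal (sumset B C)"
      unfolding mon_ideal_def
    proof (intro CollectI ballI)
      fix m assume "m \<in> keys (f * g)"
      then obtain l q where lq: "m = l + q" "l \<in> keys f" "q \<in> keys g" using keys_mult[of f g] by blast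
      with fg obtain b c where "b \<in> B" "b \<unlhd> l" "c \<in> C" "c \<unlhd> q" unfolding mon_ideal_def by blast
      then have "b + c \<in> sumset B C" "b + c \<unlhd> m"
        using divides_add_mono lq(1) by (auto simp: sumset_def)
      then show "\<exists>b\<in>sumset B C. b \<unlhd> m" by blast
    qed
  qed
  have "monom ` sumset B C \<subseteq> ideal_mult (mon_ideal B) (mon_ideal C :: ('n, 'k) mpoly set)"
  proof safe
    fix m assume "m \<in> sumset B C"
    then obtain b c where bc: "m = b + c" "b \<in> B" "c \<in> C" by (auto simp: sumset_def)
    then have "monom m = (monom b * monom c :: ('n, 'k) mpoly)" by (simp add: monom_def mult_single)
    moreover have "monom b \<in> mon_ideal B" "monom c \<in> mon_ideal C"
      using bc by (auto simp: monom_in_mon_ideal divides_def)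
    ultimately show "monom m \<in> ideal_mult (mon_ideal B) (mon_ideal C :: ('n, 'k) mpoly set)"
      unfolding ideal_mult_def by (intro ideal.span_base) blast
  qed
  then show "mon_ideal (sumset B C) \<subseteq> (ideal_mult (mon_ideal B) (mon_ideal C) :: ('n, 'k) mpoly set)"
    unfolding ideal_span_monom[symmetric, of "sumset B C"] ideal_mult_def
    by (rule ideal.span_minimal) (rule ideal.subspace_span)
qed

lemma ideal_power_mon_ideal: "ideal_power (mon_ideal B) k = mon_ideal (sum_power B k)"
proof (induction k)
  case 0
  show ?case by (auto simp: mon_ideal_def divides_def)
next
  case (Suc k)
  then show ?case by (simp add: ideal_mult_mon_ideal)
qed

text \<open>An associated prime \<open>P\<close> of the colon ideal \<open>L\<close> is the
  intersection of the finitely many colons of \<open>L'\<close> by \<open>s * f\<close>, and a prime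
  that is a finite intersection of ideals equals one of them.\<close>

lemma Ass_colon_subset:
  fixes L L' :: "'a::comm_ring_1 set"
  assumes L': "is_ideal L'" and "finite S" and L: "L = {f. \<forall>s\<in>S. s * f \<in> L'}"
  shows "Ass L \<subseteq> Ass L'"
proof
  fix P assume "P \<in> Ass L"
  then obtain f where prime: "is_prime_ideal P" and P: "P = {g. g * f \<in> L}" unfolding Ass_def by blast
  define Q where "Q s = {g. g * (s * f) \<in> L'}" for s
  have P_eq: "g \<in> P \<longleftrightarrow> (\<forall>s\<in>S. g \<in> Q s)" for g
    unfolding P L Q_def by (simp add: mult.left_commute)
  have Q_mult: "h * g \<in> Q s" if "g \<in> Q s" for g h s
    using ideal.subspace_scale[OF L', of "g * (s * f)" h] that by (simp add: Q_def mult.assoc)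
  have "\<exists>s\<in>S. Q s \<subseteq> P"
  proof (rule ccontr)
    assume "\<not> ?thesis"
    then have "\<forall>s\<in>S. \<exists>g. g \<in> Q s \<and> g \<notin> P" by blast
    then obtain h where h: "\<And>s. s \<in> S \<Longrightarrow> h s \<in> Q s \<and> h s \<notin> P"
      by (auto dest!: bchoice)
    have "prod h T \<notin> P" if "T \<subseteq> S" for T
      using finite_subset[OF that \<open>finite S\<close>] that
    proof induction
      case empty
      have "1 \<notin> P"
      proof
        assume "1 \<in> P"
        then have "g \<in> P" for g
          using prime ideal.subspace_scale[of P 1 g] by (simp add: is_prime_ideal_def)
        with prime show False by (auto simp: is_prime_ideal_def)
      qed
      then show ?case by simp
    next
      case (insert s T)
      then show ?case using prime h[of s] by (auto simp: is_prime_ideal_def)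
    qed
    moreover have "prod h S \<in> Q s" if "s \<in> S" for s
      using Q_mult[of "h s" s "prod h (S - {s})"] h[OF that] prod.remove[OF \<open>finite S\<close> that, of h]
      by (simp add: mult.commute)
    ultimately show False using P_eq by blast
  qed
  then obtain s where "s \<in> S" "Q s \<subseteq> P" by blast
  with P_eq have "P = Q s" by blast
  with prime show "P \<in> Ass L'" unfolding Ass_def Q_def by blast
qed

text \<open>The ideal for \<open>k\<close> is the colon of the ideal for \<open>Suc k\<close> by the
  generators of \<open>I\<close>, so \<open>Ass_colon_subset\<close> applies.\<close>

lemma Ass_syzygy_degrees_subset:
  fixes B :: "('n::finite \<Rightarrow>\<^sub>0 nat) set"
  assumes B: "M_convex d B" and "i \<le> k"
  shows "Ass (mon_ideal (syzygy_degrees i (sum_power B k)) :: ('n, 'k::field) mpoly set) \<subseteq>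
    Ass (mon_ideal (syzygy_degrees i (sum_power B (Suc k))))"
proof (cases "syzygy_degrees i (sum_power B k) = {}")
  \<comment> \<open>The colon lemma assumes a syzygy degree for \<open>k\<close>. If there is none,
    there is none for \<open>Suc k\<close> either, and both ideals are zero.\<close>
  case True
  then have "syzygy_degrees i (sum_power B (Suc k)) = {}"
    using syzygy_degrees_nonempty[OF B \<open>i \<le> k\<close>] by blast
  with True show ?thesis by (simp only:)
next
  case False
  let ?A = "\<lambda>k. syzygy_degrees i (sum_power B k)"
  have keys_monom: "m \<in> keys (monom b * f) \<longleftrightarrow> (\<exists>q\<in>keys f. m = b + q)"
    for b m and f :: "('n, 'k) mpoly"
    unfolding monom_def
    by (cases "\<exists>q. m = b + q") (auto simp: in_keys_iff lookup_single_mult)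
  show ?thesis
  proof (rule Ass_colon_subset[OF is_ideal_mon_ideal])
    show "finite (monom ` B :: ('n, 'k) mpoly set)" using M_convex_finite[OF B] by simp
    have "f \<in> mon_ideal (?A k) \<longleftrightarrow> (\<forall>b\<in>B. monom b * f \<in> mon_ideal (?A (Suc k)))"
      for f :: "('n, 'k) mpoly"
    proof (intro iffI ballI)
      fix b assume f: "f \<in> mon_ideal (?A k)" and b: "b \<in> B"
      show "monom b * f \<in> mon_ideal (?A (Suc k))"
        unfolding mon_ideal_def
      proof (intro CollectI ballI)
        fix m assume "m \<in> keys (monom b * f)"
        then obtain q where q: "q \<in> keys f" "m = b + q" unfolding keys_monom by blast
        then obtain a where a: "a \<in> ?A k" "a \<unlhd> q" using f unfolding mon_ideal_def by blast
        have "b + a \<in> ?A (Suc k)" using syzygy_degrees_sumset[OF a(1) b] by simp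
        moreover have "b + a \<unlhd> m" using a(2) by (simp add: q(2) divides_def lookup_add)
        ultimately show "\<exists>a\<in>?A (Suc k). a \<unlhd> m" by blast
      qed
    next
      assume *: "\<forall>b\<in>B. monom b * f \<in> mon_ideal (?A (Suc k))"
      show "f \<in> mon_ideal (?A k)"
        unfolding mon_ideal_def
      proof (intro CollectI ballI, rule ccontr)
        fix m assume m: "m \<in> keys f" and "\<not> (\<exists>a\<in>?A k. a \<unlhd> m)"
        then obtain g where g: "g \<in> B" "\<And>a. a \<in> ?A (Suc k) \<Longrightarrow> \<not> a \<unlhd> g + m"
          using syzygy_degrees_colon[OF B \<open>i \<le> k\<close> False, of m] by blast
        have "g + m \<in> keys (monom g * f)" unfolding keys_monom using m by blast
        with * g show False unfolding mon_ideal_def by blast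
      qed
    qed
    then show "mon_ideal (?A k) =
        {f :: ('n, 'k) mpoly. \<forall>s\<in>monom ` B. s * f \<in> mon_ideal (?A (Suc k))}"
      by auto
  qed
qed

section \<open>Minimal monomial generators and polymatroidal ideals\<close>

lemma mon_ideal_minimal_subset:
  fixes A H :: "('n::finite \<Rightarrow>\<^sub>0 nat) set"
  assumes eq: "mon_ideal H = (mon_ideal A :: ('n, 'k::field) mpoly set)"
    and m: "m \<in> A" "\<And>a. a \<in> A \<Longrightarrow> a \<unlhd> m \<Longrightarrow> a = m"
  shows "m \<in> H"
proof -
  have "(monom m :: ('n, 'k) mpoly) \<in> mon_ideal H"
    unfolding eq monom_in_mon_ideal using m(1) by (auto simp: divides_def)
  then obtain h where h: "h \<in> H" "h \<unlhd> m" unfolding monom_in_mon_ideal by blast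
  then have "(monom h :: ('n, 'k) mpoly) \<in> mon_ideal A"
    unfolding eq[symmetric] monom_in_mon_ideal by (auto simp: divides_def)
  then obtain a where a: "a \<in> A" "a \<unlhd> h" unfolding monom_in_mon_ideal by blast
  then have "a = m" using m(2) divides_trans h(2) by blast
  with a h show ?thesis using divides_antisym by blast
qed

text \<open>The divisibility-minimal elements of a generating set \<open>A\<close> generate, by
  descent on the degree, and lie in every set of monomials generating \<open>I\<close>. They are
  thus the unique irredundant one, which justifies the definite description in
  \<open>min_gens\<close>.\<close>

lemma mon_ideal_min_gens:
  fixes I :: "('n::finite, 'k::field) mpoly set"
  assumes "is_monomial_ideal I"
  shows "mon_ideal (min_gens I) = I"
proof -
  from assms obtain A where A: "I = mon_ideal A"
    unfolding is_monomial_ideal_def by (auto simp: ideal_span_monom)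
  define G where "G = {m\<in>A. \<forall>a\<in>A. a \<unlhd> m \<longrightarrow> a = m}"
  have below: "\<exists>g\<in>G. g \<unlhd> a" if "a \<in> A" for a
    using that
  proof (induction "weight a UNIV" arbitrary: a rule: less_induct)
    case less
    show ?case
    proof (cases "a \<in> G")
      case True
      then show ?thesis by (auto simp: divides_def)
    next
      case False
      then obtain b where b: "b \<in> A" "b \<unlhd> a" "b \<noteq> a" using less.prems by (auto simp: G_def)
      then have "weight b UNIV < weight a UNIV" using divides_weight_eq[of b a] by force
      then obtain g where "g \<in> G" "g \<unlhd> b" using less.hyps b(1) by blast
      then show ?thesis using divides_trans b(2) by blast
    qed
  qed
  have GI: "mon_ideal G = I"
    unfolding A
  proof (intro equalityI subsetI)
    show "f \<in> mon_ideal A" if "f \<in> mon_ideal G" for f :: "('n, 'k) mpoly"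
      using that by (auto simp: mon_ideal_def G_def)
    show "f \<in> mon_ideal G" if "f \<in> mon_ideal A" for f :: "('n, 'k) mpoly"
      unfolding mon_ideal_def
    proof (intro CollectI ballI)
      fix m assume "m \<in> keys f"
      with that obtain a where "a \<in> A" "a \<unlhd> m" unfolding mon_ideal_def by blast
      with below[of a] show "\<exists>b\<in>G. b \<unlhd> m" using divides_trans by blast
    qed
  qed
  have G_sub: "G \<subseteq> H" if "mon_ideal H = I" for H
    using mon_ideal_minimal_subset[of H A] that unfolding A G_def by blast
  have "min_gens I = G"
    unfolding min_gens_def ideal_span_monom
  proof (rule the_equality)
    show "mon_ideal G = I \<and> (\<forall>H. H \<subset> G \<longrightarrow> mon_ideal H \<noteq> I)"
      using GI G_sub by blast
    show "G' = G" if "mon_ideal G' = I \<and> (\<forall>H. H \<subset> G' \<longrightarrow> mon_ideal H \<noteq> I)" for G'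
      using that GI G_sub[of G'] by blast
  qed
  with GI show ?thesis by simp
qed

lemma polymatroidal_M_convex:
  fixes I :: "('n::finite, 'k::field) mpoly set"
  assumes "polymatroidal I"
  obtains d B where "M_convex d B" "I = mon_ideal B"
proof -
  have I: "mon_ideal (min_gens I) = I"
    using assms by (intro mon_ideal_min_gens) (simp add: polymatroidal_def)
  have "min_gens I \<noteq> {}"
  proof
    assume "min_gens I = {}"
    then have "I = mon_ideal {}" using I by simp
    also have "\<dots> = {0}" by (auto simp: mon_ideal_def)
    finally show False using assms by (simp add: polymatroidal_def)
  qed
  then obtain u0 where "u0 \<in> min_gens I" by blast
  with assms have "M_convex (weight u0 UNIV) (min_gens I)"
    unfolding M_convex_def polymatroidal_def total_degree_def weight_def by blast
  with I show ?thesis using that by blast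
qed

section \<open>Principal Borel ideals as products of ideals of variables\<close>

fun borel_gens :: "'n::{finite,linorder} list \<Rightarrow> ('n \<Rightarrow>\<^sub>0 nat) set" where
  "borel_gens [] = {0}"
| "borel_gens (j # js) = sumset {single p 1 |p. p \<le> j} (borel_gens js)"

text \<open>Each factor is the base set of a uniform matroid of rank one, and sums of M-convex sets
  are M-convex.\<close>

lemma M_convex_borel_gens: "M_convex (length js) (borel_gens js)"
proof (induction js)
  case Nil
  then show ?case by (simp add: M_convex_zero)
next
  case (Cons j js)
  have "{single p 1 |p. p \<le> j} = indicator_mon ` {F. F \<subseteq> {..j} \<and> card F = 1}"
  proof -
    have "{F. F \<subseteq> {..j} \<and> card F = 1} = (\<lambda>p. {p}) ` {..j}"
      by (auto simp: card_1_singleton_iff)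
    then show ?thesis by (auto simp: image_image indicator_mon_def)
  qed
  moreover have "0 < card {..j}" by (simp add: card_gt_0_iff)
  then have "M_convex 1 (indicator_mon ` {F. F \<subseteq> {..j} \<and> card F = 1})"
    by (intro M_convex_indicator_mons) simp
  ultimately show ?case
    using M_convex_sumset[OF _ Cons.IH, of 1 "{single p 1 |p. p \<le> j}"] by simp
qed

definition list_mon :: "'n list \<Rightarrow> 'n \<Rightarrow>\<^sub>0 nat" where
  "list_mon ps = sum_list (map (\<lambda>p. single p 1) ps)"

lemma prod_list_var: "prod_list (map var ps) = (monom (list_mon ps) :: ('n, 'k::field) mpoly)"
  by (induction ps) (simp_all add: list_mon_def var_def monom_def mult_single)

lemma borel_gens_eq: "borel_gens js = {list_mon ps |ps. list_all2 (\<le>) ps js}"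
proof (induction js)
  case Nil
  then show ?case by (simp add: list_mon_def)
next
  case (Cons j js)
  show ?case
    unfolding borel_gens.simps Cons.IH sumset_def
    by (auto simp: list_all2_Cons2 list_mon_def) (metis list.simps(9) sum_list.Cons)+
qed

lemma list_mon_insort: "list_mon (insort p ps) = single p 1 + list_mon ps"
  by (induction ps) (simp_all add: list_mon_def add.left_commute)

lemma list_mon_sort: "list_mon (sort ps) = list_mon ps"
  by (induction ps) (simp_all add: list_mon_insort, simp add: list_mon_def)

lemma list_all2_insort:
  fixes p :: "'a::linorder"
  assumes "p \<le> j" "list_all2 (\<le>) ps js" "sorted (j # js)"
  shows "list_all2 (\<le>) (insort p ps) (j # js)"
  using assms(2,1,3)
  by (induction arbitrary: j rule: list_all2_induct) auto

text \<open>Each insertion keeps the pointwise bound. Hence requiring sorted index lists in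
  \<open>borel_ideal\<close> loses no generators.\<close>

lemma list_all2_sort:
  fixes ps :: "'a::linorder list"
  assumes "list_all2 (\<le>) ps js" "sorted js"
  shows "list_all2 (\<le>) (sort ps) js"
  using assms by (induction rule: list_all2_induct) (auto intro: list_all2_insort)

lemma borel_ideal_eq:
  assumes "sorted js"
  shows "borel_ideal js = (mon_ideal (borel_gens js) :: ('n::{finite,linorder}, 'k::field) mpoly set)"
proof -
  have "borel_gens js = list_mon ` {ps. sorted ps \<and> list_all2 (\<le>) ps js}"
  proof (intro equalityI subsetI)
    fix m assume "m \<in> borel_gens js"
    then obtain ps where ps: "m = list_mon ps" "list_all2 (\<le>) ps js"
      unfolding borel_gens_eq by blast
    then have "m = list_mon (sort ps)" "list_all2 (\<le>) (sort ps) js"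
      using list_all2_sort assms by (auto simp: list_mon_sort)
    then show "m \<in> list_mon ` {ps. sorted ps \<and> list_all2 (\<le>) ps js}" by auto
  qed (auto simp: borel_gens_eq)
  moreover have "{prod_list (map var ps) |ps. sorted ps \<and> list_all2 (\<le>) ps js} =
      (monom ` list_mon ` {ps. sorted ps \<and> list_all2 (\<le>) ps js} :: ('n, 'k) mpoly set)"
    unfolding prod_list_var by blast
  ultimately show ?thesis
    unfolding borel_ideal_def ideal_span_monom[symmetric] by simp
qed

theorem corollary7p5:
  fixes I :: "('n::{finite,linorder}, 'k::field) mpoly set"
    and i :: nat
  assumes "principal_borel I \<or> (polymatroidal I \<and> strong_exchange I) \<or> matroidal_edge_ideal I"
    and "i > 0"
  shows "\<forall>k\<ge>i. Ass (HS i (ideal_power I k)) \<subseteq> Ass (HS i (ideal_power I (Suc k)))"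
proof -
  obtain d B where B: "M_convex d B" and I: "I = mon_ideal B"
  proof (cases "principal_borel I")
    case True
    then obtain js where "sorted js" "I = borel_ideal js" unfolding principal_borel_def by blast
    then show ?thesis using that M_convex_borel_gens borel_ideal_eq by blast
  next
    case False
    with assms(1) have "polymatroidal I" by (auto simp: matroidal_edge_ideal_def)
    then show ?thesis using that polymatroidal_M_convex by blast
  qed
  show ?thesis
    unfolding I ideal_power_mon_ideal HS_mon_ideal[OF M_convex_sum_power[OF B]]
    using Ass_syzygy_degrees_subset[OF B] by blast
qed

end
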